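(* For $n\in\mathbb N$ let $X_n=[f_\alpha:\alpha\in\mathcal T_n]\subset JT$ be the closed linear span in James' tree space $JT$ of the node vectors $f_\alpha$ with $\alpha\in\mathcal T_n$, where $\mathcal T_n$ is the set of nodes containing at most $n$ entries equal to $1$, and let $Z=\ell^1(X_n)$ be the direct $\ell^1$-sum of the sequence $(X_n)_{n\in\mathbb N}$. Then $Z$ has the unbounded W.A.P., but not the W.A.P.
   Context: A Banach space $E$ has the weakly compact approximation property (W.A.P.) if there is a constant $C<\infty$ such that for every weakly compact set $D\subset E$ and every $\varepsilon>0$ there is a weakly compact operator $V:E\to E$ with $\sup_{x\in D}\|x-Vx\|<\varepsilon$ and $\|V\|\le C$. $E$ has the unbounded W.A.P. if for every weakly compact set $D\subset E$ and every $\varepsilon>0$ there is a weakly compact operator $V:E\to E$ with $\sup_{x\in D}\|x-Vx\|<\varepsilon$ (no uniform bound on $\|V\|$). James' tree space $JT$: let $\mathcal T=\bigcup_{n=0}^\infty\{0,1\}^n$ be the infinite binary tree of finite $0$-$1$ sequences (nodes), including the empty one $\emptyset$, ordered by $\alpha\le\beta$ iff $\alpha$ is an initial part of $\beta$. A segment is a set $S=\{\gamma\in\mathcal T:\alpha\le\gamma\le\beta\}$ with $\alpha\le\beta$ in $\mathcal T$. For $\alpha\in\mathcal T$ let $f_\alpha:\mathcal T\to\mathbb R$ be the function with $f_\alpha(\alpha)=1$ and $f_\alpha(\beta)=0$ for $\beta\ne\alpha$. $JT$ is the Banach space of functions $\sum_\alpha a_\alpha f_\alpha:\mathcal T\to\mathbb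 R$ for which $$\Big\|\sum_\alpha a_\alpha f_\alpha\Big\|=\sup\Big(\sum_{j=1}^k\Big(\sum_{\alpha\in S_j}a_\alpha\Big)^2\Big)^{1/2}<\infty,$$ where the supremum is over all $k\in\mathbb N$ and all pairwise disjoint segments $S_1,\dots,S_k$ of $\mathcal T$. For $n\in\mathbb N$, $\mathcal T_n=\{\alpha\in\mathcal T:\text{there are at most } n \text{ entries equal to } 1 \text{ in } \alpha\}$. $\ell^1(X_n)$ is the space of sequences $(x_n)$ with $x_n\in X_n$ and norm $\sum_n\|x_n\|<\infty$. *)

theory Defs
  imports "HOL-Analysis.Analysis" "HOL-Library.Sublist"
begin

section \<open>Weak compactness and the weakly compact approximation property\<close>

definition weak_topology :: "'a::real_normed_vector topology" where
  "weak_topology = pullback_topology UNIV (\<lambda>x (f :: 'a \<Rightarrow>\<^sub>L real). blinfun_apply f x) euclidean"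

definition weakly_compact :: "'a::real_normed_vector set \<Rightarrow> bool" where
  "weakly_compact D \<longleftrightarrow> compactin weak_topology D"

definition weakly_compact_operator ::
    "('a::real_normed_vector \<Rightarrow>\<^sub>L 'b::real_normed_vector) \<Rightarrow> bool" where
  "weakly_compact_operator V \<longleftrightarrow>
     weakly_compact (weak_topology closure_of (blinfun_apply V ` cball 0 1))"

text \<open>The suprema below are taken in \<^typ>\<open>ennreal\<close>, so that the supremum over the empty set is 0.\<close>

definition WAP :: "'a::banach itself \<Rightarrow> bool" where
  "WAP (E :: 'a itself) \<longleftrightarrow>
     (\<exists>C::real. \<forall>(D :: 'a set) (\<epsilon>::real). weakly_compact D \<longrightarrow> \<epsilon> > 0 \<longrightarrow>
        (\<exists>V :: 'a \<Rightarrow>\<^sub>L 'a. weakly_compact_operator V \<and>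
           (SUP x\<in>D. ennreal (norm (x - blinfun_apply V x))) < ennreal \<epsilon> \<and> norm V \<le> C))"

definition unbounded_WAP :: "'a::banach itself \<Rightarrow> bool" where
  "unbounded_WAP (E :: 'a itself) \<longleftrightarrow>
     (\<forall>(D :: 'a set) (\<epsilon>::real). weakly_compact D \<longrightarrow> \<epsilon> > 0 \<longrightarrow>
        (\<exists>V :: 'a \<Rightarrow>\<^sub>L 'a. weakly_compact_operator V \<and>
           (SUP x\<in>D. ennreal (norm (x - blinfun_apply V x))) < ennreal \<epsilon>))"


section \<open>James' tree space\<close>

text \<open>Nodes are finite 0-1 sequences, with \<^const>\<open>True\<close> for the entry 1; the tree order is
  \<^const>\<open>prefix\<close>.\<close>

type_synonym node = "bool list"

definition segments :: "node set set" where
  "segments = {S. \<exists>\<alpha> \<beta>. prefix \<alpha> \<beta> \<and> S = {\<gamma>. prefix \<alpha> \<gamma> \<and> prefix \<gamma> \<beta>}}"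

definition segment_families :: "node set set set" where
  "segment_families = {F. finite F \<and> F \<subseteq> segments \<and> disjoint F}"

definition family_norm :: "(node \<Rightarrow> real) \<Rightarrow> node set set \<Rightarrow> real" where
  "family_norm a F = sqrt (\<Sum>S\<in>F. (\<Sum>\<alpha>\<in>S. a \<alpha>)\<^sup>2)"

definition jt_norm :: "(node \<Rightarrow> real) \<Rightarrow> real" where
  "jt_norm a = (SUP F\<in>segment_families. family_norm a F)"

definition jt_finite :: "(node \<Rightarrow> real) \<Rightarrow> bool" where
  "jt_finite a \<longleftrightarrow> bdd_above (family_norm a ` segment_families)"

lemma family_norm_L2: "family_norm a F = L2_set (\<lambda>S. sum a S) F"
  by (simp add: family_norm_def L2_set_def)

lemma empty_in_segment_families: "{} \<in> segment_families"
  by (simp add: segment_families_def)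

lemma family_norm_empty [simp]: "family_norm a {} = 0"
  by (simp add: family_norm_def)

lemma family_norm_nonneg: "0 \<le> family_norm a F"
  by (simp add: family_norm_def sum_nonneg)

lemma family_norm_le_jt_norm:
  "jt_finite a \<Longrightarrow> F \<in> segment_families \<Longrightarrow> family_norm a F \<le> jt_norm a"
  unfolding jt_norm_def jt_finite_def by (rule cSUP_upper)

lemma jt_norm_le:
  "(\<And>F. F \<in> segment_families \<Longrightarrow> family_norm a F \<le> c) \<Longrightarrow> jt_norm a \<le> c"
  unfolding jt_norm_def using empty_in_segment_families by (intro cSUP_least) auto

lemma jt_finiteI:
  "(\<And>F. F \<in> segment_families \<Longrightarrow> family_norm a F \<le> c) \<Longrightarrow> jt_finite a"
  unfolding jt_finite_def by (rule bdd_aboveI2)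

lemma family_norm_add:
  "family_norm (\<lambda>\<alpha>. a \<alpha> + b \<alpha>) F \<le> family_norm a F + family_norm b F"
  by (simp add: family_norm_L2 sum.distrib L2_set_triangle_ineq)

lemma family_norm_scale: "family_norm (\<lambda>\<alpha>. r * a \<alpha>) F = \<bar>r\<bar> * family_norm a F"
  by (simp add: family_norm_def power_mult_distrib real_sqrt_mult flip: sum_distrib_left)

lemma jt_finite_add:
  "jt_finite a \<Longrightarrow> jt_finite b \<Longrightarrow> jt_finite (\<lambda>\<alpha>. a \<alpha> + b \<alpha>)"
  by (rule jt_finiteI[of _ "jt_norm a + jt_norm b"])
    (rule order_trans[OF family_norm_add add_mono]; rule family_norm_le_jt_norm)

lemma jt_finite_scale: "jt_finite a \<Longrightarrow> jt_finite (\<lambda>\<alpha>. r * a \<alpha>)"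
  by (rule jt_finiteI[of _ "\<bar>r\<bar> * jt_norm a"])
    (simp add: family_norm_scale family_norm_le_jt_norm mult_left_mono)

lemma jt_finite_zero: "jt_finite (\<lambda>_. 0)"
  by (rule jt_finiteI[of _ 0]) (simp add: family_norm_def)

lemma jt_finite_uminus: "jt_finite a \<Longrightarrow> jt_finite (\<lambda>\<alpha>. - a \<alpha>)"
  using jt_finite_scale[of a "-1"] by simp

lemma jt_finite_minus: "jt_finite a \<Longrightarrow> jt_finite b \<Longrightarrow> jt_finite (\<lambda>\<alpha>. a \<alpha> - b \<alpha>)"
  using jt_finite_add[OF _ jt_finite_uminus] by fastforce

lemma jt_norm_add:
  "jt_finite a \<Longrightarrow> jt_finite b \<Longrightarrow> jt_norm (\<lambda>\<alpha>. a \<alpha> + b \<alpha>) \<le> jt_norm a + jt_norm b"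
  by (rule jt_norm_le)
    (rule order_trans[OF family_norm_add add_mono]; rule family_norm_le_jt_norm)

lemma jt_norm_scale_le: "jt_finite a \<Longrightarrow> jt_norm (\<lambda>\<alpha>. r * a \<alpha>) \<le> \<bar>r\<bar> * jt_norm a"
  by (rule jt_norm_le) (simp add: family_norm_scale family_norm_le_jt_norm mult_left_mono)

lemma jt_norm_scale:
  assumes "jt_finite a"
  shows "jt_norm (\<lambda>\<alpha>. r * a \<alpha>) = \<bar>r\<bar> * jt_norm a"
proof (cases "r = 0")
  case True
  have "jt_norm (\<lambda>_. 0) \<ge> 0"
    using family_norm_le_jt_norm[OF jt_finite_zero empty_in_segment_families] by simp
  with True jt_norm_scale_le[OF assms, of r] show ?thesis by simp
next
  case False
  have "jt_norm (\<lambda>\<alpha>. inverse r * (r * a \<alpha>)) \<le> \<bar>inverse r\<bar> * jt_norm (\<lambda>\<alpha>. r * a \<alpha>)"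
    by (rule jt_norm_scale_le[OF jt_finite_scale[OF assms]])
  moreover have "(\<lambda>\<alpha>. inverse r * (r * a \<alpha>)) = a"
    using False by auto
  ultimately have "\<bar>r\<bar> * jt_norm a \<le> jt_norm (\<lambda>\<alpha>. r * a \<alpha>)"
    using False by (simp add: field_simps)
  with jt_norm_scale_le[OF assms, of r] show ?thesis by simp
qed

lemma singleton_in_segment_families: "{{\<alpha>}} \<in> segment_families"
proof -
  have "{\<alpha>} \<in> segments"
    unfolding segments_def by (auto intro!: exI[of _ \<alpha>])
  then show ?thesis by (simp add: segment_families_def)
qed

lemma abs_le_jt_norm:
  assumes "jt_finite a"
  shows "\<bar>a \<alpha>\<bar> \<le> jt_norm a"
  using family_norm_le_jt_norm[OF assms singleton_in_segment_families[of \<alpha>]]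
  by (simp add: family_norm_def)

lemma finite_segment:
  assumes "S \<in> segments"
  shows "finite S"
proof -
  obtain \<alpha> \<beta> where "S = {\<gamma>. prefix \<alpha> \<gamma> \<and> prefix \<gamma> \<beta>}"
    using assms by (auto simp: segments_def)
  then have "S \<subseteq> set (prefixes \<beta>)" by auto
  then show ?thesis using finite_subset by blast
qed

lemma jt_finite_indicator: "jt_finite (\<lambda>\<beta>. if \<beta> = \<alpha> then 1 else 0)"
proof (rule jt_finiteI[of _ 1])
  fix F assume F: "F \<in> segment_families"
  let ?f = "\<lambda>\<beta>. if \<beta> = \<alpha> then 1 else (0::real)"
  have fin: "finite F" and disj: "disjoint F" and seg: "\<And>S. S \<in> F \<Longrightarrow> finite S"
    using F finite_segment by (auto simp: segment_families_def)
  have "family_norm ?f F \<le> (\<Sum>S\<in>F. \<bar>sum ?f S\<bar>)"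
    unfolding family_norm_L2 by (rule L2_set_le_sum_abs)
  also have "\<dots> = (\<Sum>S\<in>F. if \<alpha> \<in> S then 1 else 0)"
    using seg by (intro sum.cong) auto
  also have "\<dots> = real (card {S\<in>F. \<alpha> \<in> S})"
    using fin by (simp add: sum.If_cases Int_def)
  also have "\<dots> \<le> 1"
  proof -
    have "card {S\<in>F. \<alpha> \<in> S} \<le> Suc 0"
      using disj fin by (auto simp: card_le_Suc0_iff_eq disjoint_def)
    then show ?thesis by simp
  qed
  finally show "family_norm ?f F \<le> 1" .
qed

typedef jt = "{a. jt_finite a}"
  morphisms jt_coeff Abs_jt
  using jt_finite_zero by blast

setup_lifting type_definition_jt

lemma jt_finite_coeff [simp]: "jt_finite (jt_coeff x)"
  using jt_coeff by simp

instantiation jt :: real_vector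
begin

lift_definition zero_jt :: jt is "\<lambda>_. 0" by (rule jt_finite_zero)
lift_definition plus_jt :: "jt \<Rightarrow> jt \<Rightarrow> jt" is "\<lambda>a b \<alpha>. a \<alpha> + b \<alpha>" by (rule jt_finite_add)
lift_definition minus_jt :: "jt \<Rightarrow> jt \<Rightarrow> jt" is "\<lambda>a b \<alpha>. a \<alpha> - b \<alpha>" by (rule jt_finite_minus)
lift_definition uminus_jt :: "jt \<Rightarrow> jt" is "\<lambda>a \<alpha>. - a \<alpha>" by (rule jt_finite_uminus)
lift_definition scaleR_jt :: "real \<Rightarrow> jt \<Rightarrow> jt" is "\<lambda>r a \<alpha>. r * a \<alpha>" by (rule jt_finite_scale)

instance
proof
  fix x y z :: jt and r s :: real
  show "x + y + z = x + (y + z)" by transfer (simp add: add.assoc)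
  show "x + y = y + x" by transfer (simp add: add.commute)
  show "0 + x = x" by transfer simp
  show "- x + x = 0" by transfer simp
  show "x - y = x + - y" by transfer simp
  show "r *\<^sub>R (x + y) = r *\<^sub>R x + r *\<^sub>R y" by transfer (simp add: distrib_left)
  show "(r + s) *\<^sub>R x = r *\<^sub>R x + s *\<^sub>R x" by transfer (simp add: distrib_right)
  show "r *\<^sub>R s *\<^sub>R x = (r * s) *\<^sub>R x" by transfer (simp add: mult.assoc)
  show "1 *\<^sub>R x = x" by transfer simp
qed

end

instantiation jt :: real_normed_vector
begin

lift_definition norm_jt :: "jt \<Rightarrow> real" is jt_norm .

definition dist_jt :: "jt \<Rightarrow> jt \<Rightarrow> real" where "dist_jt x y = norm (x - y)"
definition sgn_jt :: "jt \<Rightarrow> jt" where "sgn_jt x = x /\<^sub>R norm x"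
definition uniformity_jt :: "(jt \<times> jt) filter" where
  "uniformity_jt = (INF e\<in>{0<..}. principal {(x, y). dist x y < e})"
definition open_jt :: "jt set \<Rightarrow> bool" where
  "open_jt S = (\<forall>x\<in>S. \<forall>\<^sub>F (x', y) in uniformity. x' = x \<longrightarrow> y \<in> S)"

instance
proof
  fix x y :: jt and r :: real
  show "norm x = 0 \<longleftrightarrow> x = 0"
  proof transfer
    fix a :: "node \<Rightarrow> real" assume a: "jt_finite a"
    have "a = (\<lambda>_. 0)" if "jt_norm a = 0"
      using abs_le_jt_norm[OF a] that by fastforce
    moreover have "jt_norm (\<lambda>_. 0) = 0"
      using jt_norm_scale[OF jt_finite_zero, of 0] by simp
    ultimately show "jt_norm a = 0 \<longleftrightarrow> a = (\<lambda>_. 0)" by auto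
  qed
  show "norm (x + y) \<le> norm x + norm y" by transfer (rule jt_norm_add)
  show "norm (r *\<^sub>R x) = \<bar>r\<bar> * norm x" by transfer (rule jt_norm_scale)
qed (simp_all add: dist_jt_def sgn_jt_def uniformity_jt_def open_jt_def)

end

lemma abs_coeff_le_norm: "\<bar>jt_coeff x \<alpha>\<bar> \<le> norm x"
  by transfer (rule abs_le_jt_norm)

instance jt :: banach
proof
  fix X :: "nat \<Rightarrow> jt" assume X: "Cauchy X"
  have "Cauchy (\<lambda>n. jt_coeff (X n) \<alpha>)" for \<alpha>
  proof (rule metric_CauchyI)
    fix e :: real assume "e > 0"
    then obtain N where N: "\<And>m n. m \<ge> N \<Longrightarrow> n \<ge> N \<Longrightarrow> norm (X m - X n) < e"
      using X unfolding Cauchy_iff by blast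
    have "dist (jt_coeff (X m) \<alpha>) (jt_coeff (X n) \<alpha>) < e" if "m \<ge> N" "n \<ge> N" for m n
      using abs_coeff_le_norm[of "X m - X n" \<alpha>] N[OF that]
      by (simp add: dist_real_def minus_jt.rep_eq)
    then show "\<exists>N. \<forall>m\<ge>N. \<forall>n\<ge>N. dist (jt_coeff (X m) \<alpha>) (jt_coeff (X n) \<alpha>) < e" by blast
  qed
  then have "\<forall>\<alpha>. \<exists>l. (\<lambda>n. jt_coeff (X n) \<alpha>) \<longlonglongrightarrow> l"
    using Cauchy_convergent convergent_def by blast
  then obtain a where a: "\<And>\<alpha>. (\<lambda>n. jt_coeff (X n) \<alpha>) \<longlonglongrightarrow> a \<alpha>"
    by metis
  have key: "family_norm (\<lambda>\<alpha>. jt_coeff (X n) \<alpha> - a \<alpha>) F \<le> e"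
    if N: "\<And>m n. m \<ge> N \<Longrightarrow> n \<ge> N \<Longrightarrow> norm (X m - X n) < e"
      and n: "n \<ge> N" and F: "F \<in> segment_families" for e N n F
  proof -
    have "(\<lambda>m. family_norm (\<lambda>\<alpha>. jt_coeff (X n) \<alpha> - jt_coeff (X m) \<alpha>) F)
        \<longlonglongrightarrow> family_norm (\<lambda>\<alpha>. jt_coeff (X n) \<alpha> - a \<alpha>) F"
      unfolding family_norm_def by (intro tendsto_intros a)
    moreover have "\<forall>m\<ge>N. family_norm (\<lambda>\<alpha>. jt_coeff (X n) \<alpha> - jt_coeff (X m) \<alpha>) F \<le> e"
    proof (intro allI impI)
      fix m assume "m \<ge> N"
      have "family_norm (jt_coeff (X n - X m)) F \<le> norm (X n - X m)"
        unfolding norm_jt.rep_eq by (rule family_norm_le_jt_norm[OF jt_finite_coeff F])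
      also have "\<dots> \<le> e" using N[OF n \<open>m \<ge> N\<close>] by simp
      finally show "family_norm (\<lambda>\<alpha>. jt_coeff (X n) \<alpha> - jt_coeff (X m) \<alpha>) F \<le> e"
        by (simp add: minus_jt.rep_eq)
    qed
    ultimately show ?thesis by (rule LIMSEQ_le_const2[OF _ exI])
  qed
  obtain N1 where N1: "\<And>m n. m \<ge> N1 \<Longrightarrow> n \<ge> N1 \<Longrightarrow> norm (X m - X n) < 1"
    using X unfolding Cauchy_iff by (meson zero_less_one)
  have "jt_finite (\<lambda>\<alpha>. jt_coeff (X N1) \<alpha> - a \<alpha>)"
    by (rule jt_finiteI[of _ 1], rule key[OF N1]) auto
  from jt_finite_minus[OF jt_finite_coeff[of "X N1"] this] have fin: "jt_finite a" by simp
  define x where "x = Abs_jt a"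
  have x: "jt_coeff x = a" unfolding x_def using fin by (simp add: Abs_jt_inverse)
  have "X \<longlonglongrightarrow> x"
  proof (rule LIMSEQ_I)
    fix r :: real assume "r > 0"
    then have "r / 2 > 0" by simp
    then obtain N where N: "\<And>m n. m \<ge> N \<Longrightarrow> n \<ge> N \<Longrightarrow> norm (X m - X n) < r / 2"
      using X unfolding Cauchy_iff by blast
    have "norm (X n - x) < r" if "n \<ge> N" for n
    proof -
      have "norm (X n - x) \<le> r / 2"
        unfolding norm_jt.rep_eq minus_jt.rep_eq x
        by (rule jt_norm_le, rule key[OF N that])
      with \<open>r > 0\<close> show ?thesis by simp
    qed
    then show "\<exists>N. \<forall>n\<ge>N. norm (X n - x) < r" by blast
  qed
  then show "convergent X" unfolding convergent_def by blast
qed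

lift_definition node_vector :: "node \<Rightarrow> jt" is "\<lambda>\<alpha> \<beta>. if \<beta> = \<alpha> then 1 else 0"
  by (rule jt_finite_indicator)


section \<open>The subspaces \<open>X_n\<close> and their direct \<open>l^1\<close>-sum\<close>

definition nodes_few_ones :: "nat \<Rightarrow> node set" where
  "nodes_few_ones n = {\<alpha>. count_list \<alpha> True \<le> n}"

definition X_sub :: "nat \<Rightarrow> jt set" where
  "X_sub n = closure (span (node_vector ` nodes_few_ones n))"

lemma subspace_X_sub: "subspace (X_sub n)"
proof (rule subspaceI)
  let ?S = "span (node_vector ` nodes_few_ones n)"
  show "0 \<in> X_sub n"
    unfolding X_sub_def using closure_subset[of ?S] span_zero by blast
  fix x y assume x: "x \<in> X_sub n" and y: "y \<in> X_sub n"
  from x obtain f where f: "\<And>k. f k \<in> ?S" "f \<longlonglongrightarrow> x"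
    unfolding X_sub_def closure_sequential by blast
  from y obtain g where g: "\<And>k. g k \<in> ?S" "g \<longlonglongrightarrow> y"
    unfolding X_sub_def closure_sequential by blast
  show "x + y \<in> X_sub n"
    unfolding X_sub_def closure_sequential using f g
    by (intro exI[of _ "\<lambda>k. f k + g k"]) (auto intro: span_add tendsto_add)
next
  let ?S = "span (node_vector ` nodes_few_ones n)"
  fix c :: real and x assume x: "x \<in> X_sub n"
  then obtain f where f: "\<And>k. f k \<in> ?S" "f \<longlonglongrightarrow> x"
    unfolding X_sub_def closure_sequential by blast
  show "c *\<^sub>R x \<in> X_sub n"
    unfolding X_sub_def closure_sequential using f
    by (intro exI[of _ "\<lambda>k. c *\<^sub>R f k"]) (auto intro: span_scale tendsto_scaleR)
qed

lemma closed_X_sub: "closed (X_sub n)"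
  unfolding X_sub_def by simp

text \<open>The index set of the sum includes 0. Starting at 1 instead only drops the summand
  \<open>X_sub 0\<close>, which is complemented in \<open>X_sub 1\<close> by restriction to the branch of all-zero
  sequences, so neither approximation property is affected.\<close>

typedef Z = "{z :: nat \<Rightarrow> jt. (\<forall>n. z n \<in> X_sub n) \<and> summable (\<lambda>n. norm (z n))}"
  morphisms Z_coord Abs_Z
  by (rule exI[of _ "\<lambda>_. 0"]) (simp add: subspace_X_sub subspace_0)

setup_lifting type_definition_Z

lemma Z_coord_in [simp]: "Z_coord z n \<in> X_sub n"
  using Z_coord[of z] by simp

lemma summable_Z_coord [simp]: "summable (\<lambda>n. norm (Z_coord z n))"
  using Z_coord[of z] by simp

lemma summable_norm_add:
  fixes x y :: "nat \<Rightarrow> 'a::real_normed_vector"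
  assumes "summable (\<lambda>n. norm (x n))" "summable (\<lambda>n. norm (y n))"
  shows "summable (\<lambda>n. norm (x n + y n))"
  by (rule summable_comparison_test'[OF summable_add[OF assms], of 0])
    (simp add: norm_triangle_ineq)

lemma summable_norm_diff:
  fixes x y :: "nat \<Rightarrow> 'a::real_normed_vector"
  assumes "summable (\<lambda>n. norm (x n))" "summable (\<lambda>n. norm (y n))"
  shows "summable (\<lambda>n. norm (x n - y n))"
  using summable_norm_add[of x "\<lambda>n. - y n"] assms by simp

instantiation Z :: real_vector
begin

lift_definition zero_Z :: Z is "\<lambda>_. 0"
  by (simp add: subspace_X_sub subspace_0)
lift_definition plus_Z :: "Z \<Rightarrow> Z \<Rightarrow> Z" is "\<lambda>x y n. x n + y n"
  by (simp add: subspace_X_sub subspace_add summable_norm_add)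
lift_definition minus_Z :: "Z \<Rightarrow> Z \<Rightarrow> Z" is "\<lambda>x y n. x n - y n"
  by (simp add: subspace_X_sub subspace_diff summable_norm_diff)
lift_definition uminus_Z :: "Z \<Rightarrow> Z" is "\<lambda>x n. - x n"
  by (simp add: subspace_X_sub subspace_neg)
lift_definition scaleR_Z :: "real \<Rightarrow> Z \<Rightarrow> Z" is "\<lambda>r x n. r *\<^sub>R x n"
  by (simp add: subspace_X_sub subspace_scale summable_mult)

instance
proof
  fix x y z :: Z and r s :: real
  show "x + y + z = x + (y + z)" by transfer (simp add: add.assoc)
  show "x + y = y + x" by transfer (simp add: add.commute)
  show "0 + x = x" by transfer simp
  show "- x + x = 0" by transfer simp
  show "x - y = x + - y" by transfer simp
  show "r *\<^sub>R (x + y) = r *\<^sub>R x + r *\<^sub>R y" by transfer (simp add: scaleR_add_right)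
  show "(r + s) *\<^sub>R x = r *\<^sub>R x + s *\<^sub>R x" by transfer (simp add: scaleR_add_left)
  show "r *\<^sub>R s *\<^sub>R x = (r * s) *\<^sub>R x" by transfer simp
  show "1 *\<^sub>R x = x" by transfer simp
qed

end

instantiation Z :: real_normed_vector
begin

lift_definition norm_Z :: "Z \<Rightarrow> real" is "\<lambda>x. \<Sum>n. norm (x n)" .

definition dist_Z :: "Z \<Rightarrow> Z \<Rightarrow> real" where "dist_Z x y = norm (x - y)"
definition sgn_Z :: "Z \<Rightarrow> Z" where "sgn_Z x = x /\<^sub>R norm x"
definition uniformity_Z :: "(Z \<times> Z) filter" where
  "uniformity_Z = (INF e\<in>{0<..}. principal {(x, y). dist x y < e})"
definition open_Z :: "Z set \<Rightarrow> bool" where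
  "open_Z S = (\<forall>x\<in>S. \<forall>\<^sub>F (x', y) in uniformity. x' = x \<longrightarrow> y \<in> S)"

instance
proof
  fix x y :: Z and r :: real
  show "norm x = 0 \<longleftrightarrow> x = 0"
    by transfer (auto simp: suminf_eq_zero_iff)
  show "norm (x + y) \<le> norm x + norm y"
    by transfer (auto simp: suminf_add intro!: suminf_le norm_triangle_ineq summable_norm_add
        summable_add)
  show "norm (r *\<^sub>R x) = \<bar>r\<bar> * norm x"
    by transfer (simp add: suminf_mult)
qed (simp_all add: dist_Z_def sgn_Z_def uniformity_Z_def open_Z_def)

end

lemma norm_Z_coord_le: "norm (Z_coord z n) \<le> norm z"
  unfolding norm_Z.rep_eq
  using sum_le_suminf[OF summable_Z_coord[of z], of "{n}"] by simp

instance Z :: banach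
proof
  fix Y :: "nat \<Rightarrow> Z" assume Y: "Cauchy Y"
  have "Cauchy (\<lambda>k. Z_coord (Y k) n)" for n
  proof (rule metric_CauchyI)
    fix e :: real assume "e > 0"
    then obtain N where N: "\<And>k m. k \<ge> N \<Longrightarrow> m \<ge> N \<Longrightarrow> norm (Y k - Y m) < e"
      using Y unfolding Cauchy_iff by blast
    have "dist (Z_coord (Y k) n) (Z_coord (Y m) n) < e" if "k \<ge> N" "m \<ge> N" for k m
      using norm_Z_coord_le[of "Y k - Y m" n] N[OF that]
      by (simp add: dist_norm minus_Z.rep_eq)
    then show "\<exists>N. \<forall>k\<ge>N. \<forall>m\<ge>N. dist (Z_coord (Y k) n) (Z_coord (Y m) n) < e" by blast
  qed
  then have "\<forall>n. \<exists>l. (\<lambda>k. Z_coord (Y k) n) \<longlonglongrightarrow> l"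
    using Cauchy_convergent convergent_def by blast
  then obtain a where a: "\<And>n. (\<lambda>k. Z_coord (Y k) n) \<longlonglongrightarrow> a n"
    by metis
  have aX: "a n \<in> X_sub n" for n
    by (rule closed_sequentially[OF closed_X_sub _ a]) simp
  have key: "(\<Sum>n<M. norm (Z_coord (Y k) n - a n)) \<le> e"
    if N: "\<And>k m. k \<ge> N \<Longrightarrow> m \<ge> N \<Longrightarrow> norm (Y k - Y m) < e"
      and k: "k \<ge> N" for e N k M
  proof -
    have "(\<lambda>m. \<Sum>n<M. norm (Z_coord (Y k) n - Z_coord (Y m) n))
        \<longlonglongrightarrow> (\<Sum>n<M. norm (Z_coord (Y k) n - a n))"
      by (intro tendsto_intros a)
    moreover have "\<forall>m\<ge>N. (\<Sum>n<M. norm (Z_coord (Y k) n - Z_coord (Y m) n)) \<le> e"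
    proof (intro allI impI)
      fix m assume "m \<ge> N"
      have "(\<Sum>n<M. norm (Z_coord (Y k - Y m) n)) \<le> norm (Y k - Y m)"
        unfolding norm_Z.rep_eq by (rule sum_le_suminf) auto
      also have "\<dots> \<le> e" using N[OF k \<open>m \<ge> N\<close>] by simp
      finally show "(\<Sum>n<M. norm (Z_coord (Y k) n - Z_coord (Y m) n)) \<le> e"
        by (simp add: minus_Z.rep_eq)
    qed
    ultimately show ?thesis by (rule LIMSEQ_le_const2[OF _ exI])
  qed
  have sm: "summable (\<lambda>n. norm (Z_coord (Y k) n - a n))"
    if N: "\<And>k m. k \<ge> N \<Longrightarrow> m \<ge> N \<Longrightarrow> norm (Y k - Y m) < e"
      and k: "k \<ge> N" for e N k
    by (rule summableI_nonneg_bounded[of _ e]) (use key[OF N k] in auto)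
  obtain N1 where N1: "\<And>k m. k \<ge> N1 \<Longrightarrow> m \<ge> N1 \<Longrightarrow> norm (Y k - Y m) < 1"
    using Y unfolding Cauchy_iff by (meson zero_less_one)
  have "summable (\<lambda>n. norm (Z_coord (Y N1) n - (Z_coord (Y N1) n - a n)))"
    by (rule summable_norm_diff[OF summable_Z_coord sm[OF N1]]) auto
  then have fin: "summable (\<lambda>n. norm (a n))" by simp
  define z where "z = Abs_Z a"
  have z: "Z_coord z = a" unfolding z_def using fin aX by (simp add: Abs_Z_inverse)
  have "Y \<longlonglongrightarrow> z"
  proof (rule LIMSEQ_I)
    fix r :: real assume "r > 0"
    then have "r / 2 > 0" by simp
    then obtain N where N: "\<And>k m. k \<ge> N \<Longrightarrow> m \<ge> N \<Longrightarrow> norm (Y k - Y m) < r / 2"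
      using Y unfolding Cauchy_iff by blast
    have "norm (Y k - z) < r" if "k \<ge> N" for k
    proof -
      have "norm (Y k - z) \<le> r / 2"
        unfolding norm_Z.rep_eq minus_Z.rep_eq z
        by (rule suminf_le_const[OF sm[OF N that]]) (use key[OF N that] in auto)
      with \<open>r > 0\<close> show ?thesis by simp
    qed
    then show "\<exists>N. \<forall>k\<ge>N. norm (Y k - z) < r" by blast
  qed
  then show "convergent Y" unfolding convergent_def by blast
qed

end

theory Submission
  imports Defs
begin

text \<open>
  The upper estimate throughout is that the square of the norm of a finite sum in \<open>JT\<close> is at most
  \<open>k\<close> times the sum of the squared norms, if on every segment at most \<open>k\<close> summands have nonzero sum.

  Failure of the bounded property: the node vectors of the nodes with at most \<open>n\<close> ones that end in 1 form,
  together with 0, a weakly compact set. If \<open>A\<close> is weakly compact and almost the identity on this set, start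
  at such a node \<open>b\<close> and move along zeros. The images under \<open>A\<close> of a node close to \<open>b\<close> and of a node
  far away have nearly the same sum along a path that leaves the zero branch in between, by an entry 1.
  Repeating this at the exit gives a path meeting \<open>n\<close> such nodes. The sum of the vectors
  (near node) - (root) - (far node) has norm of order \<open>sqrt n\<close>, whereas its image has path sum of order \<open>n\<close>.

  The unbounded property: for a weakly compact \<open>D\<close> in \<open>X_n\<close>, averages of the tail sums along a zero branch are
  small on \<open>D\<close>. Subtracting differences of consecutive averages at sparse marks changes \<open>D\<close> little and
  leaves a sum of finite rank blocks with upper and lower \<open>\<ell>\<^sup>2\<close>-estimates, which is a weakly compact operator.
  Its norm depends on \<open>n\<close>, since a path meets up to \<open>n + 1\<close> zero branches. Weakly compact subsets of the
  \<open>\<ell>\<^sup>1\<close>-sum have uniformly small tails, so finitely many coordinates suffice.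
\<close>

section \<open>The weak topology\<close>

text \<open>An approximating operator has to remove the branch sum of nodes far up while hardly
  moving \<open>D\<close>. Subtracting from a node a convex combination of two marks does this: the
  coefficients add up to 0 (except possibly in the first block), a segment running through node and
  marks does not see the difference, and only the blocks at the ends of a segment count. The branch
  sums tend to 0 at each point of \<open>D\<close>, but not uniformly: compactness only supplies,
  for each point, some good position in a common window. This is why averages over many windows
  appear. A weak limit enters only as a cluster point tested against finitely many functionals at a
  time, so the order in which functionals and indices are chosen matters throughout.\<close>

lemma topspace_weak_topology [simp]: "topspace weak_topology = UNIV"
  by (simp add: weak_topology_def topspace_pullback_topology)

text \<open>Universal property of the initial topology: weak continuity of a map is from here on
  checked one functional at a time.\<close>

lemma continuous_map_weak_topology_iff:
  fixes g :: "'a \<Rightarrow> 'b::real_normed_vector"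
  shows "continuous_map X weak_topology g \<longleftrightarrow>
    (\<forall>f :: 'b \<Rightarrow>\<^sub>L real. continuous_map X euclideanreal (\<lambda>x. f (g x)))" (is "?L \<longleftrightarrow> ?R")
proof -
  have "?L \<longleftrightarrow> continuous_map X euclidean (\<lambda>x (f :: 'b \<Rightarrow>\<^sub>L real). f (g x))"
  proof
    assume "continuous_map X weak_topology g"
    then show "continuous_map X euclidean (\<lambda>x (f :: 'b \<Rightarrow>\<^sub>L real). f (g x))"
      unfolding weak_topology_def
      using continuous_map_compose[OF _ continuous_map_pullback[OF continuous_map_id]]
      by (fastforce simp: o_def)
  next
    assume "continuous_map X euclidean (\<lambda>x (f :: 'b \<Rightarrow>\<^sub>L real). f (g x))"
    then show "continuous_map X weak_topology g"
      unfolding weak_topology_def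
      by (intro continuous_map_pullback') (auto simp: o_def)
  qed
  also have "\<dots> \<longleftrightarrow> ?R"
    by (simp add: euclidean_product_topology[symmetric] continuous_map_componentwise_UNIV)
  finally show ?thesis .
qed

lemma continuous_map_weak_functional:
  "continuous_map weak_topology euclideanreal (blinfun_apply (f :: 'a::real_normed_vector \<Rightarrow>\<^sub>L real))"
proof -
  have "continuous_map weak_topology weak_topology (id :: 'a \<Rightarrow> 'a)"
    by (rule continuous_map_id)
  then show ?thesis
    by (simp only: continuous_map_weak_topology_iff id_apply)
qed

lemma openin_weak_functional:
  "open U \<Longrightarrow> openin weak_topology {x. blinfun_apply (f :: 'a::real_normed_vector \<Rightarrow>\<^sub>L real) x \<in> U}"
  using openin_continuous_map_preimage[OF continuous_map_weak_functional[of f], of U] by simp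

lemma weakly_compact_blinfun_image:
  assumes "weakly_compact D"
  shows "weakly_compact (blinfun_apply T ` D)"
proof -
  have "continuous_map weak_topology weak_topology (blinfun_apply T)"
    unfolding continuous_map_weak_topology_iff
  proof
    fix f :: "'b \<Rightarrow>\<^sub>L real"
    show "continuous_map weak_topology euclideanreal (\<lambda>x. f (T x))"
      by (rule continuous_map_eq[OF continuous_map_weak_functional[of "f o\<^sub>L T"]]) simp
  qed
  then show ?thesis
    using assms image_compactin unfolding weakly_compact_def by blast
qed

lemma weakly_compact_plus:
  assumes "weakly_compact A" "weakly_compact B"
  shows "weakly_compact ((\<lambda>(a, b). a + b) ` (A \<times> B))"
proof -
  have "continuous_map (prod_topology weak_topology weak_topology) weak_topology
      (\<lambda>p :: 'a \<times> 'a. fst p + snd p)"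
    unfolding continuous_map_weak_topology_iff blinfun.add_right
  proof
    fix f :: "'a \<Rightarrow>\<^sub>L real"
    have "continuous_map (prod_topology weak_topology weak_topology) euclideanreal (\<lambda>p. f (fst p))"
      using continuous_map_compose[OF continuous_map_fst continuous_map_weak_functional[of f]]
      by (simp add: o_def)
    moreover
    have "continuous_map (prod_topology weak_topology weak_topology) euclideanreal (\<lambda>p. f (snd p))"
      using continuous_map_compose[OF continuous_map_snd continuous_map_weak_functional[of f]]
      by (simp add: o_def)
    ultimately show "continuous_map (prod_topology weak_topology weak_topology) euclideanreal
        (\<lambda>p. f (fst p) + f (snd p))"
      by (rule continuous_map_add)
  qed
  moreover have "compactin (prod_topology weak_topology weak_topology) (A \<times> B)"
    using assms by (simp add: weakly_compact_def compactin_Times)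
  ultimately show ?thesis
    unfolding weakly_compact_def case_prod_unfold using image_compactin by blast
qed

text \<open>Once functionals separate points, the weak topology is Hausdorff and \<open>K\<close> is
  weakly closed, so the closure of the image stays inside \<open>K\<close>. Separation is a
  hypothesis because the coefficient functionals of \<open>Z\<close> provide it directly.\<close>

lemma weakly_compact_operatorI:
  fixes V :: "'a::real_normed_vector \<Rightarrow>\<^sub>L 'b::real_normed_vector"
  assumes separating: "\<And>x :: 'b. x \<noteq> 0 \<Longrightarrow> \<exists>f :: 'b \<Rightarrow>\<^sub>L real. f x \<noteq> 0"
    and K: "weakly_compact K" "V ` cball 0 1 \<subseteq> K"
  shows "weakly_compact_operator V"
proof -
  have "Hausdorff_space (weak_topology :: 'b topology)"
    unfolding Hausdorff_space_def
  proof (intro allI impI, elim conjE)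
    fix x y :: 'b assume "x \<noteq> y"
    then have "x - y \<noteq> 0" by simp
    then obtain f :: "'b \<Rightarrow>\<^sub>L real" where "f (x - y) \<noteq> 0"
      using separating[of "x - y"] by blast
    then have "f x \<noteq> f y" by (simp add: blinfun.diff_right)
    then obtain A B where AB: "open A" "open B" "f x \<in> A" "f y \<in> B" "A \<inter> B = {}"
      using hausdorff[of "f x" "f y"] by metis
    have "openin weak_topology {z. f z \<in> A}"
      using AB(1) by (rule openin_weak_functional)
    moreover have "openin weak_topology {z. f z \<in> B}"
      using AB(2) by (rule openin_weak_functional)
    moreover have "disjnt {z. f z \<in> A} {z. f z \<in> B}"
      using AB(5) by (auto simp: disjnt_def)
    ultimately show "\<exists>U V. openin weak_topology U \<and> openin weak_topology V \<and> x \<in> U \<and> y \<in> V \<and> disjnt U V"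
      using AB(3,4) by blast
  qed
  then have "closedin weak_topology K"
    using K(1) unfolding weakly_compact_def by (rule compactin_imp_closedin)
  then have "weak_topology closure_of (V ` cball 0 1) \<subseteq> K"
    using K(2) closure_of_minimal by metis
  with K(1) show ?thesis
    unfolding weakly_compact_operator_def weakly_compact_def
    by (rule closed_compactin[OF _ _ closedin_closure_of])
qed

section \<open>Covering arguments for weakly compact sets\<close>

lemma weakly_compact_finite_subcover:
  assumes "weakly_compact D" "\<And>i. i \<in> I \<Longrightarrow> openin weak_topology (U i)" "D \<subseteq> (\<Union>i\<in>I. U i)"
  obtains G where "finite G" "G \<subseteq> I" "D \<subseteq> (\<Union>i\<in>G. U i)"
proof -
  have "\<forall>A\<in>U ` I. openin weak_topology A" using assms(2) by simp
  then have "\<exists>F. finite F \<and> F \<subseteq> U ` I \<and> D \<subseteq> \<Union>F"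
    using assms(1,3) unfolding weakly_compact_def compactin_def by simp
  then obtain F where F: "finite F" "F \<subseteq> U ` I" "D \<subseteq> \<Union>F" by (elim exE conjE)
  from finite_subset_image[OF F(1,2)] obtain G where "G \<subseteq> I" "finite G" "F = U ` G"
    by (elim exE conjE)
  then show thesis using that[of G] F(3) by simp
qed

text \<open>If no point of \<open>K\<close> were a cluster point, each would have a basic weak
  neighbourhood that the sequence leaves for good, and finitely many of these would cover
  \<open>K\<close>. The explicit form with \<open>H\<close>, \<open>\<delta>\<close> and
  \<open>m\<close> serves in place of weakly convergent subsequences.\<close>

lemma weakly_compact_cluster_point:
  fixes x :: "nat \<Rightarrow> 'a::real_normed_vector"
  assumes "weakly_compact K" "\<And>j. x j \<in> K"
  shows "\<exists>g\<in>K. \<forall>(H :: ('a \<Rightarrow>\<^sub>L real) set) \<delta> m. finite H \<longrightarrow> \<delta> > 0 \<longrightarrow>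
      (\<exists>j\<ge>m. \<forall>h\<in>H. \<bar>blinfun_apply h (x j) - blinfun_apply h g\<bar> < \<delta>)"
proof (rule ccontr)
  assume "\<not> ?thesis"
  then have *: "\<forall>g\<in>K. \<exists>(H :: ('a \<Rightarrow>\<^sub>L real) set) \<delta> m. finite H \<and> \<delta> > 0 \<and>
      (\<forall>j\<ge>m. \<exists>h\<in>H. \<not> \<bar>blinfun_apply h (x j) - blinfun_apply h g\<bar> < \<delta>)"
    by simp
  have "\<exists>U m. openin weak_topology U \<and> g \<in> U \<and> (\<forall>j\<ge>m. x j \<notin> U)" if "g \<in> K" for g
  proof -
    from *[rule_format, OF that] obtain H :: "('a \<Rightarrow>\<^sub>L real) set" and \<delta> m where H: "finite H" "\<delta> > 0"
      "\<forall>j\<ge>m. \<exists>h\<in>H. \<not> \<bar>blinfun_apply h (x j) - blinfun_apply h g\<bar> < \<delta>"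
      by (elim exE conjE)
    define U where "U = (\<Inter>h\<in>H. {y. blinfun_apply h y \<in> ball (blinfun_apply h g) \<delta>})"
    have "H \<noteq> {}" using H(3) by auto
    then have "openin weak_topology U"
      unfolding U_def using H(1) by (intro openin_INT2 openin_weak_functional) auto
    moreover have "g \<in> U" using H(2) by (simp add: U_def)
    moreover have "\<forall>j\<ge>m. x j \<notin> U"
      using H(3) by (force simp: U_def dist_real_def abs_minus_commute)
    ultimately show ?thesis by blast
  qed
  then obtain U m where U: "\<And>g. g \<in> K \<Longrightarrow> openin weak_topology (U g) \<and> g \<in> U g \<and> (\<forall>j\<ge>m g. x j \<notin> U g)"
    by metis
  obtain G where G: "finite G" "G \<subseteq> K" "K \<subseteq> (\<Union>g\<in>G. U g)"
    by (rule weakly_compact_finite_subcover[OF assms(1), of K U]) (use U in auto)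
  define M where "M = Max (insert 0 (m ` G))"
  obtain g where g: "g \<in> G" "x M \<in> U g" using G(3) assms(2)[of M] by auto
  have "M \<ge> m g" unfolding M_def using G(1) g(1) by (intro Max_ge) auto
  then show False using U[of g] g G(2) by auto
qed

text \<open>A one-sided Dini argument: the open sets on which some \<open>s k\<close> with
  \<open>k \<ge> n\<close> is small cover \<open>D\<close>. The window is uniform, but the index
  inside it depends on the point.\<close>

lemma weakly_compact_eventually_small:
  fixes s :: "nat \<Rightarrow> 'a::real_normed_vector \<Rightarrow>\<^sub>L real"
  assumes D: "weakly_compact D" and "\<delta> > 0"
    and s: "\<And>x. x \<in> D \<Longrightarrow> (\<lambda>k. s k x) \<longlonglongrightarrow> 0"
  obtains m where "m > n" "\<And>x. x \<in> D \<Longrightarrow> \<exists>k\<in>{n..<m}. \<bar>s k x\<bar> < \<delta>"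
proof -
  define U where "U k = {x. s k x \<in> ball 0 \<delta>}" for k
  have "\<exists>k\<ge>n. x \<in> U k" if x: "x \<in> D" for x
  proof -
    obtain N where "\<And>k. k \<ge> N \<Longrightarrow> norm (s k x) < \<delta>"
      using LIMSEQ_D[OF s[OF x] \<open>\<delta> > 0\<close>] by auto
    then show ?thesis by (intro exI[of _ "max n N"]) (auto simp: U_def)
  qed
  then have "D \<subseteq> (\<Union>k\<in>{n..}. U k)" by force
  moreover have "openin weak_topology (U k)" for k
    unfolding U_def by (rule openin_weak_functional) simp
  ultimately obtain G where G: "finite G" "G \<subseteq> {n..}" "D \<subseteq> (\<Union>k\<in>G. U k)"
    using weakly_compact_finite_subcover[OF D, of "{n..}" U] by metis
  show thesis
  proof (rule that[of "Suc (Max (insert n G))"])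
    show "Suc (Max (insert n G)) > n" using G by (simp add: le_imp_less_Suc)
    fix x assume "x \<in> D"
    then obtain k where k: "k \<in> G" "x \<in> U k" using G(3) by auto
    moreover from this have "k \<le> Max (insert n G)" using G by (intro Max_ge) auto
    ultimately show "\<exists>k\<in>{n..<Suc (Max (insert n G))}. \<bar>s k x\<bar> < \<delta>"
      using G by (intro bexI[of _ k]) (auto simp: U_def less_Suc_eq_le)
  qed
qed

text \<open>Sokal's gliding hump proof of the uniform boundedness principle.\<close>

lemma uniform_boundedness:
  fixes T :: "'i \<Rightarrow> 'a::banach \<Rightarrow>\<^sub>L 'b::real_normed_vector"
  assumes bdd: "\<And>x. \<exists>c. \<forall>i\<in>I. norm (T i x) \<le> c"
  shows "\<exists>c. \<forall>i\<in>I. norm (T i) \<le> c"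
proof (rule ccontr)
  assume unbdd: "\<not> ?thesis"
  have step: "\<exists>y. norm (y - x) \<le> r \<and> norm (T i y) \<ge> 2 / 3 * r * norm (T i)"
    if "r > 0" for x r i
  proof (rule ccontr)
    assume "\<not> ?thesis"
    then have small: "norm (T i y) < 2 / 3 * r * norm (T i)" if "norm (y - x) \<le> r" for y
      using that by force
    define K where "K = 2 / 3 * r * norm (T i)"
    have main: "norm (T i h) \<le> (K / r) * norm h" for h
    proof (cases "h = 0")
      case False
      \<comment> \<open>Both \<open>x + u\<close> and \<open>x - u\<close> lie within distance
        \<open>r\<close> of \<open>x\<close>. Smallness at both bounds their difference
        \<open>2 * T i u\<close>, and so the norm of \<open>T i\<close> by 2/3 of itself.\<close>
      define u where "u = (r / norm h) *\<^sub>R h"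
      have nu: "norm u = r" using False \<open>r > 0\<close> by (simp add: u_def)
      have "2 *\<^sub>R T i u = T i (x + u) - T i (x - u)"
        by (simp add: blinfun.add_right blinfun.diff_right scaleR_2)
      then have "norm (2 *\<^sub>R T i u) \<le> norm (T i (x + u)) + norm (T i (x - u))"
        by (simp add: norm_triangle_ineq4)
      also have "\<dots> \<le> K + K"
        using small[of "x + u"] small[of "x - u"] nu by (intro add_mono) (auto simp: K_def)
      finally have "norm (T i u) \<le> K" by simp
      then have "r / norm h * norm (T i h) \<le> K"
        using \<open>r > 0\<close> by (simp add: u_def blinfun.scaleR_right)
      then show ?thesis using False \<open>r > 0\<close> by (simp add: field_simps)
    qed simp
    have "norm (T i) \<le> K / r"
      by (rule norm_blinfun_bound) (use main \<open>r > 0\<close> in \<open>auto simp: K_def\<close>)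
    then have "norm (T i) \<le> 0" using \<open>r > 0\<close> by (simp add: K_def field_simps)
    with small[of x] \<open>r > 0\<close> show False by simp
  qed
  \<comment> \<open>After the gain of 2/3 at scale \<open>(1/3) ^ n\<close>, all later moves
    together cost at most 1/2 at that scale. The surviving sixth explains the factor
    \<open>6 * 3 ^ n\<close>.\<close>
  have "\<exists>i. i \<in> I \<and> norm (T i) > 6 * 3 ^ n * n" for n :: nat
    using unbdd by (auto simp: not_le)
  then obtain j where j: "\<And>n. j n \<in> I" "\<And>n :: nat. norm (T (j n)) > 6 * 3 ^ n * n" by metis
  have "\<exists>x. \<forall>n. norm (x (Suc n) - x n) \<le> (1/3) ^ n
      \<and> norm (T (j n) (x (Suc n))) \<ge> 2 / 3 * (1/3) ^ n * norm (T (j n))"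
  proof -
    have "\<exists>y. norm (y - x) \<le> (1/3) ^ n \<and> norm (T (j n) y) \<ge> 2 / 3 * (1/3) ^ n * norm (T (j n))"
      for x n by (rule step) simp
    then show ?thesis
      using dependent_nat_choice[of "\<lambda>_ _. True" "\<lambda>n x y. norm (y - x) \<le> (1/3) ^ n
        \<and> norm (T (j n) y) \<ge> 2 / 3 * (1/3) ^ n * norm (T (j n))"] by auto
  qed
  then obtain x where x: "\<And>n. norm (x (Suc n) - x n) \<le> (1/3) ^ n"
      "\<And>n. norm (T (j n) (x (Suc n))) \<ge> 2 / 3 * (1/3) ^ n * norm (T (j n))" by blast
  have sm: "summable (\<lambda>n. norm (x (Suc n) - x n))"
    by (rule summable_comparison_test'[of "\<lambda>n. (1/3::real) ^ n" 0]) (use x in \<open>auto simp: summable_geometric\<close>)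
  then have "summable (\<lambda>n. x (Suc n) - x n)" by (rule summable_norm_cancel)
  then have "convergent (\<lambda>n. x n - x 0)"
    by (simp add: summable_iff_convergent sum_lessThan_telescope)
  then obtain l where l: "(\<lambda>n. x n - x 0) \<longlonglongrightarrow> l" by (auto simp: convergent_def)
  define y where "y = l + x 0"
  have y: "x \<longlonglongrightarrow> y" using tendsto_add[OF l tendsto_const[of "x 0"]] by (simp add: y_def)
  have dist: "norm (y - x (Suc n)) \<le> (1/3) ^ n / 2" for n
  proof -
    have "norm (x (Suc n + k) - x (Suc n)) \<le> (1/3) ^ n / 2 * (1 - (1/3) ^ k)" for k
    proof (induction k)
      case (Suc k)
      have "norm (x (Suc n + Suc k) - x (Suc n)) \<le>
          norm (x (Suc (Suc n + k)) - x (Suc n + k)) + norm (x (Suc n + k) - x (Suc n))"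
        using norm_triangle_ineq[of "x (Suc (Suc n + k)) - x (Suc n + k)" "x (Suc n + k) - x (Suc n)"] by simp
      also have "\<dots> \<le> (1/3) ^ (Suc n + k) + (1/3) ^ n / 2 * (1 - (1/3) ^ k)"
        by (intro add_mono x Suc)
      also have "\<dots> = (1/3) ^ n / 2 * (1 - (1/3) ^ Suc k)"
        by (simp add: power_add field_simps)
      finally show ?case .
    qed simp
    moreover have "(1/3::real) ^ n / 2 * (1 - (1/3) ^ k) \<le> (1/3) ^ n / 2 * 1" for k
      by (intro mult_left_mono) auto
    ultimately have "norm (x (Suc n + k) - x (Suc n)) \<le> (1/3) ^ n / 2 * 1" for k
      by (rule order_trans)
    then have "norm (x (k + Suc n) - x (Suc n)) \<le> (1/3) ^ n / 2" for k
      by (simp only: add.commute[of k] mult_1_right)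
    moreover have "(\<lambda>k. norm (x (k + Suc n) - x (Suc n))) \<longlonglongrightarrow> norm (y - x (Suc n))"
      by (intro tendsto_intros LIMSEQ_ignore_initial_segment y)
    ultimately show ?thesis
      by (intro LIMSEQ_le_const2) auto
  qed
  have big: "norm (T (j n) y) \<ge> n" for n
  proof -
    have "norm (T (j n) (x (Suc n))) \<le> norm (T (j n) y) + norm (T (j n) (y - x (Suc n)))"
      using norm_triangle_ineq4[of "T (j n) y" "T (j n) (y - x (Suc n))"]
      by (simp add: blinfun.diff_right)
    moreover have "norm (T (j n) (y - x (Suc n))) \<le> norm (T (j n)) * ((1/3) ^ n / 2)"
      by (rule order_trans[OF norm_blinfun mult_left_mono[OF dist]]) simp
    moreover have "2 / 3 * (1/3) ^ n * norm (T (j n)) = (1/3) ^ n / 6 * norm (T (j n)) + norm (T (j n)) * ((1/3) ^ n / 2)"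
      by (simp add: algebra_simps)
    ultimately have "(1/3) ^ n / 6 * norm (T (j n)) \<le> norm (T (j n) y)"
      using x(2)[of n] by linarith
    moreover have "(1/3) ^ n / 6 * (6 * 3 ^ n * real n) \<le> (1/3) ^ n / 6 * norm (T (j n))"
      using j(2)[of n] by (intro mult_left_mono) auto
    moreover have "(1/3) ^ n / 6 * (6 * 3 ^ n * real n) = real n"
      by (simp add: power_divide)
    ultimately show ?thesis by linarith
  qed
  obtain c where c: "\<And>i. i \<in> I \<Longrightarrow> norm (T i y) \<le> c" using bdd by blast
  obtain n where "real n > c" using reals_Archimedean2 by blast
  with big[of n] c[OF j(1)[of n]] show False by linarith
qed

section \<open>Norm estimates in James' tree space\<close>

lemma jt_coeff_add [simp]: "jt_coeff (x + y) \<alpha> = jt_coeff x \<alpha> + jt_coeff y \<alpha>"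
  by (simp add: plus_jt.rep_eq)

lemma jt_coeff_diff [simp]: "jt_coeff (x - y) \<alpha> = jt_coeff x \<alpha> - jt_coeff y \<alpha>"
  by (simp add: minus_jt.rep_eq)

lemma jt_coeff_scaleR [simp]: "jt_coeff (r *\<^sub>R x) \<alpha> = r * jt_coeff x \<alpha>"
  by (simp add: scaleR_jt.rep_eq)

lemma jt_coeff_zero [simp]: "jt_coeff 0 \<alpha> = 0"
  by (simp add: zero_jt.rep_eq)

lemma jt_coeff_sum [simp]: "jt_coeff (sum y G) \<alpha> = (\<Sum>i\<in>G. jt_coeff (y i) \<alpha>)"
  by (induction G rule: infinite_finite_induct) auto

lemma jt_coeff_node_vector: "jt_coeff (node_vector \<beta>) \<alpha> = (if \<alpha> = \<beta> then 1 else 0)"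
  by (simp add: node_vector.rep_eq)

lemma jt_eqI: "(\<And>\<alpha>. jt_coeff x \<alpha> = jt_coeff y \<alpha>) \<Longrightarrow> x = y"
  by (rule jt_coeff_inject[THEN iffD1, OF ext])

lemma segment_nonempty: "S \<in> segments \<Longrightarrow> S \<noteq> {}"
  by (auto simp: segments_def)

lemma family_norm_squared: "(family_norm a F)\<^sup>2 = (\<Sum>S\<in>F. (sum a S)\<^sup>2)"
  by (simp add: family_norm_def sum_nonneg)

lemma family_squares_le_norm:
  assumes "F \<in> segment_families"
  shows "(\<Sum>S\<in>F. (sum (jt_coeff x) S)\<^sup>2) \<le> (norm x)\<^sup>2"
proof -
  have "family_norm (jt_coeff x) F \<le> norm x"
    unfolding norm_jt.rep_eq by (rule family_norm_le_jt_norm[OF jt_finite_coeff assms])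
  from power_mono[OF this family_norm_nonneg, of 2] show ?thesis
    by (simp add: family_norm_squared)
qed

lemma norm_jt_le:
  assumes "c \<ge> 0" "\<And>F. F \<in> segment_families \<Longrightarrow> (\<Sum>S\<in>F. (sum (jt_coeff x) S)\<^sup>2) \<le> c\<^sup>2"
  shows "norm x \<le> c"
  unfolding norm_jt.rep_eq
proof (rule jt_norm_le)
  fix F assume "F \<in> segment_families"
  from assms(2)[OF this] show "family_norm (jt_coeff x) F \<le> c"
    unfolding family_norm_squared[symmetric] by (rule power2_le_imp_le[OF _ assms(1)])
qed

lemma norm_jt_squared_approx:
  assumes "e > 0"
  obtains F where "F \<in> segment_families" "(norm x)\<^sup>2 - e \<le> (\<Sum>S\<in>F. (sum (jt_coeff x) S)\<^sup>2)"
proof (rule ccontr)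
  assume "\<not> thesis"
  with that have *: "(\<Sum>S\<in>F. (sum (jt_coeff x) S)\<^sup>2) < (norm x)\<^sup>2 - e" if "F \<in> segment_families" for F
    using \<open>F \<in> segment_families\<close> by force
  from *[OF empty_in_segment_families] have pos: "(norm x)\<^sup>2 - e > 0" by simp
  have "norm x \<le> sqrt ((norm x)\<^sup>2 - e)"
    by (rule norm_jt_le) (use * pos in \<open>auto intro: less_imp_le\<close>)
  then have "(norm x)\<^sup>2 \<le> (norm x)\<^sup>2 - e"
    using pos by (metis norm_ge_zero power_mono real_sqrt_pow2 less_imp_le)
  with \<open>e > 0\<close> show False by simp
qed

lemma abs_segment_sum_le_norm:
  assumes "S \<in> segments"
  shows "\<bar>sum (jt_coeff x) S\<bar> \<le> norm x"
proof -
  have "{S} \<in> segment_families" using assms by (simp add: segment_families_def)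
  from family_squares_le_norm[OF this, of x] show ?thesis
    by (simp add: abs_le_square_iff[symmetric])
qed

text \<open>On one segment at most \<open>k\<close> summands survive, so Cauchy-Schwarz costs the
  factor \<open>k\<close>. Adding up over a disjoint family and exchanging the sums leaves the
  squared norm of each summand.\<close>

lemma norm_sum_le_multiplicity:
  fixes y :: "'i \<Rightarrow> jt"
  assumes G: "finite G"
    and mult: "\<And>S. S \<in> segments \<Longrightarrow> card {i\<in>G. sum (jt_coeff (y i)) S \<noteq> 0} \<le> k"
  shows "(norm (sum y G))\<^sup>2 \<le> k * (\<Sum>i\<in>G. (norm (y i))\<^sup>2)"
proof -
  define c where "c = k * (\<Sum>i\<in>G. (norm (y i))\<^sup>2)"
  have "c \<ge> 0" by (simp add: c_def sum_nonneg)
  have "norm (sum y G) \<le> sqrt c"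
  proof (rule norm_jt_le)
    fix F assume F: "F \<in> segment_families"
    have "(\<Sum>S\<in>F. (sum (jt_coeff (sum y G)) S)\<^sup>2) \<le>
        (\<Sum>S\<in>F. k * (\<Sum>i\<in>G. (sum (jt_coeff (y i)) S)\<^sup>2))"
    proof (rule sum_mono)
      fix S assume "S \<in> F"
      then have S: "S \<in> segments" using F by (auto simp: segment_families_def)
      let ?G = "{i\<in>G. sum (jt_coeff (y i)) S \<noteq> 0}"
      have "sum (jt_coeff (sum y G)) S = (\<Sum>i\<in>G. sum (jt_coeff (y i)) S)"
        unfolding jt_coeff_sum by (rule sum.swap)
      also have "\<dots> = (\<Sum>i\<in>?G. sum (jt_coeff (y i)) S)"
        using G by (intro sum.mono_neutral_right) auto
      finally have "(sum (jt_coeff (sum y G)) S)\<^sup>2 \<le>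
          card ?G * (\<Sum>i\<in>?G. (sum (jt_coeff (y i)) S)\<^sup>2)"
        using sum_squared_le_sum_of_squares[of "\<lambda>i. sum (jt_coeff (y i)) S" ?G]
        by (simp add: mult.commute)
      also have "\<dots> \<le> k * (\<Sum>i\<in>G. (sum (jt_coeff (y i)) S)\<^sup>2)"
        using G mult[OF S] by (intro mult_mono sum_mono2) (auto intro: sum_nonneg)
      finally show "(sum (jt_coeff (sum y G)) S)\<^sup>2 \<le> k * (\<Sum>i\<in>G. (sum (jt_coeff (y i)) S)\<^sup>2)" .
    qed
    also have "\<dots> = k * (\<Sum>i\<in>G. \<Sum>S\<in>F. (sum (jt_coeff (y i)) S)\<^sup>2)"
      unfolding sum_distrib_left[symmetric] by (subst sum.swap) simp
    also have "\<dots> \<le> c"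
      unfolding c_def by (intro mult_left_mono sum_mono family_squares_le_norm F) simp
    finally show "(\<Sum>S\<in>F. (sum (jt_coeff (sum y G)) S)\<^sup>2) \<le> (sqrt c)\<^sup>2"
      using \<open>c \<ge> 0\<close> by simp
  qed (use \<open>c \<ge> 0\<close> in simp)
  then have "(norm (sum y G))\<^sup>2 \<le> (sqrt c)\<^sup>2" by (intro power_mono) auto
  with \<open>c \<ge> 0\<close> show ?thesis by (simp add: c_def)
qed

lemma norm_jt_le_sum_abs:
  assumes "\<And>\<Gamma>. finite \<Gamma> \<Longrightarrow> (\<Sum>\<alpha>\<in>\<Gamma>. \<bar>jt_coeff x \<alpha>\<bar>) \<le> c"
  shows "norm x \<le> c"
  unfolding norm_jt.rep_eq
proof (rule jt_norm_le)
  fix F assume F: "F \<in> segment_families"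
  then have fin: "finite F" "\<And>S. S \<in> F \<Longrightarrow> finite S"
    using finite_segment by (auto simp: segment_families_def)
  have "family_norm (jt_coeff x) F \<le> (\<Sum>S\<in>F. \<bar>sum (jt_coeff x) S\<bar>)"
    unfolding family_norm_L2 by (rule L2_set_le_sum_abs)
  also have "\<dots> \<le> (\<Sum>S\<in>F. \<Sum>\<alpha>\<in>S. \<bar>jt_coeff x \<alpha>\<bar>)"
    by (intro sum_mono sum_abs)
  also have "\<dots> = (\<Sum>\<alpha>\<in>\<Union>F. \<bar>jt_coeff x \<alpha>\<bar>)"
    using F fin by (subst sum.Union_disjoint)
      (auto simp: segment_families_def disjoint_def)
  also have "\<dots> \<le> c" using fin by (intro assms) auto
  finally show "family_norm (jt_coeff x) F \<le> c" .
qed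

lemma norm_node_vector_le: "norm (node_vector \<alpha>) \<le> 1"
proof (rule norm_jt_le_sum_abs)
  fix \<Gamma> :: "node set" assume "finite \<Gamma>"
  then show "(\<Sum>\<beta>\<in>\<Gamma>. \<bar>jt_coeff (node_vector \<alpha>) \<beta>\<bar>) \<le> 1"
    by (simp add: jt_coeff_node_vector if_distrib cong: if_cong)
qed

section \<open>Restriction to order-convex sets of nodes\<close>

definition tree_convex :: "node set \<Rightarrow> bool" where
  "tree_convex T \<longleftrightarrow> (\<forall>\<alpha> \<beta> \<gamma>. \<alpha> \<in> T \<longrightarrow> \<beta> \<in> T \<longrightarrow> prefix \<alpha> \<gamma> \<longrightarrow> prefix \<gamma> \<beta> \<longrightarrow> \<gamma> \<in> T)"

lemma tree_convexD:
  "tree_convex T \<Longrightarrow> \<alpha> \<in> T \<Longrightarrow> \<beta> \<in> T \<Longrightarrow> prefix \<alpha> \<gamma> \<Longrightarrow> prefix \<gamma> \<beta> \<Longrightarrow> \<gamma> \<in> T"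
  unfolding tree_convex_def by blast

lemma segment_tree_convex: "S \<in> segments \<Longrightarrow> tree_convex S"
  unfolding segments_def tree_convex_def using prefix_order.trans by blast

text \<open>A segment is a chain, so the shortest and the longest node of the intersection are its
  endpoints. This makes restriction to an order-convex set an operator of norm at most 1.\<close>

lemma segment_Int_tree_convex:
  assumes S: "S \<in> segments" and T: "tree_convex T" and "S \<inter> T \<noteq> {}"
  shows "S \<inter> T \<in> segments"
proof -
  obtain \<alpha> \<beta> where ab: "prefix \<alpha> \<beta>" "S = {\<gamma>. prefix \<alpha> \<gamma> \<and> prefix \<gamma> \<beta>}"
    using S by (auto simp: segments_def)
  have chain: "prefix \<gamma> \<delta> \<longleftrightarrow> length \<gamma> \<le> length \<delta>" if "\<gamma> \<in> S" "\<delta> \<in> S" for \<gamma> \<delta>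
    using that ab(2) prefix_length_le prefix_length_prefix by blast
  have fin: "finite (S \<inter> T)" using finite_segment[OF S] by simp
  have "\<exists>\<mu>\<in>S \<inter> T. \<forall>\<gamma>\<in>S \<inter> T. length \<mu> \<le> length \<gamma>"
  proof -
    have "Min (length ` (S \<inter> T)) \<in> length ` (S \<inter> T)"
      using fin assms(3) by (intro Min_in) auto
    then obtain \<mu> where "\<mu> \<in> S \<inter> T" "length \<mu> = Min (length ` (S \<inter> T))" by (metis imageE)
    then show ?thesis using fin by (intro bexI[of _ \<mu>]) auto
  qed
  then obtain \<mu> where \<mu>: "\<mu> \<in> S \<inter> T" "\<And>\<gamma>. \<gamma> \<in> S \<inter> T \<Longrightarrow> length \<mu> \<le> length \<gamma>" by blast
  have "\<exists>\<nu>\<in>S \<inter> T. \<forall>\<gamma>\<in>S \<inter> T. length \<gamma> \<le> length \<nu>"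
  proof -
    have "Max (length ` (S \<inter> T)) \<in> length ` (S \<inter> T)"
      using fin assms(3) by (intro Max_in) auto
    then obtain \<nu> where "\<nu> \<in> S \<inter> T" "length \<nu> = Max (length ` (S \<inter> T))" by (metis imageE)
    then show ?thesis using fin by (intro bexI[of _ \<nu>]) auto
  qed
  then obtain \<nu> where \<nu>: "\<nu> \<in> S \<inter> T" "\<And>\<gamma>. \<gamma> \<in> S \<inter> T \<Longrightarrow> length \<gamma> \<le> length \<nu>" by blast
  have "S \<inter> T = {\<gamma>. prefix \<mu> \<gamma> \<and> prefix \<gamma> \<nu>}"
  proof (intro equalityI subsetI CollectI)
    fix \<gamma> assume "\<gamma> \<in> S \<inter> T"
    with chain \<mu> \<nu> show "prefix \<mu> \<gamma> \<and> prefix \<gamma> \<nu>" by blast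
  next
    fix \<gamma> assume "\<gamma> \<in> {\<gamma>. prefix \<mu> \<gamma> \<and> prefix \<gamma> \<nu>}"
    then show "\<gamma> \<in> S \<inter> T"
      using \<mu>(1) \<nu>(1) tree_convexD[OF T] tree_convexD[OF segment_tree_convex[OF S]] by blast
  qed
  moreover have "prefix \<mu> \<nu>" using chain \<mu> \<nu> by blast
  ultimately show ?thesis unfolding segments_def by blast
qed

lemma segment_family_restrict:
  fixes a :: "node \<Rightarrow> real"
  assumes F: "F \<in> segment_families" and T: "tree_convex T"
  defines "F' \<equiv> (\<lambda>S. S \<inter> T) ` F - {{}}"
  shows "F' \<in> segment_families"
    and "(\<Sum>S\<in>F. (sum (\<lambda>\<alpha>. if \<alpha> \<in> T then a \<alpha> else 0) S)\<^sup>2) = (\<Sum>S\<in>F'. (sum a S)\<^sup>2)"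
proof -
  have F1: "finite F" "F \<subseteq> segments" "disjoint F" using F by (auto simp: segment_families_def)
  show "F' \<in> segment_families"
    unfolding segment_families_def
  proof (intro CollectI conjI subsetI)
    show "finite F'" using F1 by (simp add: F'_def)
    show "S \<in> segments" if "S \<in> F'" for S
      using that F1(2) segment_Int_tree_convex[OF _ T] by (auto simp: F'_def)
    show "disjoint F'" using F1(3) by (fastforce simp: F'_def disjoint_def)
  qed
  let ?G = "{S\<in>F. S \<inter> T \<noteq> {}}"
  have "(\<Sum>S\<in>F. (sum (\<lambda>\<alpha>. if \<alpha> \<in> T then a \<alpha> else 0) S)\<^sup>2) = (\<Sum>S\<in>F. (sum a (S \<inter> T))\<^sup>2)"
  proof (rule sum.cong[OF refl])
    fix S assume "S \<in> F"
    then have "finite S" using F1(2) finite_segment by blast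
    then show "(sum (\<lambda>\<alpha>. if \<alpha> \<in> T then a \<alpha> else 0) S)\<^sup>2 = (sum a (S \<inter> T))\<^sup>2"
      by (simp add: sum.inter_restrict)
  qed
  also have "\<dots> = (\<Sum>S\<in>?G. (sum a (S \<inter> T))\<^sup>2)"
    using F1 by (intro sum.mono_neutral_right) auto
  also have "\<dots> = (\<Sum>S\<in>(\<lambda>S. S \<inter> T) ` ?G. (sum a S)\<^sup>2)"
  proof (subst sum.reindex)
    \<comment> \<open>Disjoint members with the same nonempty trace on \<open>T\<close> coincide, so
      no trace is counted twice.\<close>
    show "inj_on (\<lambda>S. S \<inter> T) ?G"
    proof (rule inj_onI)
      fix R S assume RS: "R \<in> ?G" "S \<in> ?G" "R \<inter> T = S \<inter> T"
      then have "R \<inter> S \<noteq> {}" by blast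
      with RS F1(3) show "R = S" by (auto simp: disjoint_def)
    qed
  qed simp
  also have "(\<lambda>S. S \<inter> T) ` ?G = F'" by (auto simp: F'_def)
  finally show "(\<Sum>S\<in>F. (sum (\<lambda>\<alpha>. if \<alpha> \<in> T then a \<alpha> else 0) S)\<^sup>2) = (\<Sum>S\<in>F'. (sum a S)\<^sup>2)" .
qed

lemma jt_finite_restrict:
  assumes "tree_convex T"
  shows "jt_finite (\<lambda>\<alpha>. if \<alpha> \<in> T then jt_coeff x \<alpha> else 0)"
proof (rule jt_finiteI[of _ "norm x"])
  fix F assume F: "F \<in> segment_families"
  show "family_norm (\<lambda>\<alpha>. if \<alpha> \<in> T then jt_coeff x \<alpha> else 0) F \<le> norm x"
    by (rule power2_le_imp_le)
      (simp_all add: family_norm_squared segment_family_restrict[OF F assms] family_squares_le_norm)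
qed

definition restrict_jt :: "node set \<Rightarrow> jt \<Rightarrow> jt" where
  "restrict_jt T x = Abs_jt (\<lambda>\<alpha>. if \<alpha> \<in> T then jt_coeff x \<alpha> else 0)"

lemma jt_coeff_restrict:
  "tree_convex T \<Longrightarrow> jt_coeff (restrict_jt T x) \<alpha> = (if \<alpha> \<in> T then jt_coeff x \<alpha> else 0)"
  by (simp add: restrict_jt_def Abs_jt_inverse jt_finite_restrict)

lemma norm_restrict_le:
  assumes "tree_convex T"
  shows "norm (restrict_jt T x) \<le> norm x"
proof (rule norm_jt_le)
  fix F assume F: "F \<in> segment_families"
  show "(\<Sum>S\<in>F. (sum (jt_coeff (restrict_jt T x)) S)\<^sup>2) \<le> (norm x)\<^sup>2"
    by (simp add: jt_coeff_restrict[OF assms] segment_family_restrict[OF F assms] family_squares_le_norm)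
qed simp

lemma bounded_linear_restrict:
  assumes "tree_convex T"
  shows "bounded_linear (restrict_jt T)"
  by (rule bounded_linear_intro[of _ 1])
    (auto intro!: jt_eqI simp: jt_coeff_restrict assms norm_restrict_le)

text \<open>Nearly norming families of the parts can be taken inside the sets \<open>T i\<close>.
  Their union is then disjoint, hence admissible for \<open>x\<close> itself.\<close>

lemma sum_norm_restrict_le:
  assumes G: "finite G" and T: "\<And>i. i \<in> G \<Longrightarrow> tree_convex (T i)"
    and disj: "disjoint_family_on T G"
  shows "(\<Sum>i\<in>G. (norm (restrict_jt (T i) x))\<^sup>2) \<le> (norm x)\<^sup>2"
proof (rule field_le_epsilon)
  fix e :: real assume "e > 0"
  define \<eta> where "\<eta> = e / (card G + 1)"
  have "\<eta> > 0" using \<open>e > 0\<close> by (simp add: \<eta>_def)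
  have "\<exists>F. F \<in> segment_families \<and> (\<forall>S\<in>F. S \<subseteq> T i) \<and>
      (norm (restrict_jt (T i) x))\<^sup>2 - \<eta> \<le> (\<Sum>S\<in>F. (sum (jt_coeff x) S)\<^sup>2)" if i: "i \<in> G" for i
  proof -
    obtain F where F: "F \<in> segment_families"
      "(norm (restrict_jt (T i) x))\<^sup>2 - \<eta> \<le> (\<Sum>S\<in>F. (sum (jt_coeff (restrict_jt (T i) x)) S)\<^sup>2)"
      using norm_jt_squared_approx[OF \<open>\<eta> > 0\<close>] by blast
    then show ?thesis
      using segment_family_restrict(1)[OF F(1) T[OF i]]
        segment_family_restrict(2)[OF F(1) T[OF i], of "jt_coeff x"]
      by (intro exI[of _ "(\<lambda>S. S \<inter> T i) ` F - {{}}"]) (auto simp: jt_coeff_restrict[OF T[OF i]])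
  qed
  then obtain F where F: "\<And>i. i \<in> G \<Longrightarrow> F i \<in> segment_families"
      "\<And>i S. i \<in> G \<Longrightarrow> S \<in> F i \<Longrightarrow> S \<subseteq> T i"
      "\<And>i. i \<in> G \<Longrightarrow> (norm (restrict_jt (T i) x))\<^sup>2 - \<eta> \<le> (\<Sum>S\<in>F i. (sum (jt_coeff x) S)\<^sup>2)"
    by metis
  have F1: "finite (F i)" "F i \<subseteq> segments" "disjoint (F i)" if "i \<in> G" for i
    using F(1)[OF that] by (auto simp: segment_families_def)
  have cross: "R \<inter> S = {}" if "i \<in> G" "j \<in> G" "i \<noteq> j" "R \<in> F i" "S \<in> F j" for i j R S
  proof -
    have "T i \<inter> T j = {}" using disj that by (auto simp: disjoint_family_on_def)
    then show ?thesis using F(2)[OF that(1,4)] F(2)[OF that(2,5)] by blast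
  qed
  have "(\<Union>i\<in>G. F i) \<in> segment_families"
    unfolding segment_families_def
  proof (intro CollectI conjI)
    show "finite (\<Union>i\<in>G. F i)" using G F1(1) by simp
    show "(\<Union>i\<in>G. F i) \<subseteq> segments" using F1(2) by blast
    show "disjoint (\<Union>i\<in>G. F i)"
      unfolding disjoint_def
    proof (intro ballI impI)
      fix R S assume "R \<in> (\<Union>i\<in>G. F i)" "S \<in> (\<Union>i\<in>G. F i)" "R \<noteq> S"
      then obtain i j where "i \<in> G" "j \<in> G" "R \<in> F i" "S \<in> F j" by blast
      then show "R \<inter> S = {}"
        using cross[of i j R S] F1(3)[of i] \<open>R \<noteq> S\<close> by (cases "i = j") (auto simp: disjoint_def)
    qed
  qed
  have "(\<Sum>i\<in>G. (norm (restrict_jt (T i) x))\<^sup>2) - \<eta> * card G =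
      (\<Sum>i\<in>G. (norm (restrict_jt (T i) x))\<^sup>2 - \<eta>)"
    by (simp add: sum_subtractf mult.commute)
  also have "\<dots> \<le> (\<Sum>i\<in>G. \<Sum>S\<in>F i. (sum (jt_coeff x) S)\<^sup>2)"
    by (intro sum_mono F(3))
  also have "\<dots> = (\<Sum>S\<in>(\<Union>i\<in>G. F i). (sum (jt_coeff x) S)\<^sup>2)"
  proof (rule sum.UNION_disjoint[symmetric])
    show "\<forall>i\<in>G. \<forall>j\<in>G. i \<noteq> j \<longrightarrow> F i \<inter> F j = {}"
    proof (intro ballI impI equals0I)
      fix i j S assume "i \<in> G" "j \<in> G" "i \<noteq> j" "S \<in> F i \<inter> F j"
      then show False using cross[of i j S S] F1(2)[of i] segment_nonempty by blast
    qed
  qed (use G F1 in auto)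
  also have "\<dots> \<le> (norm x)\<^sup>2" by (rule family_squares_le_norm) fact
  finally have "(\<Sum>i\<in>G. (norm (restrict_jt (T i) x))\<^sup>2) \<le> (norm x)\<^sup>2 + \<eta> * card G" by simp
  also have "\<eta> * card G \<le> e"
    using \<open>e > 0\<close> by (simp add: \<eta>_def field_simps)
  finally show "(\<Sum>i\<in>G. (norm (restrict_jt (T i) x))\<^sup>2) \<le> (norm x)\<^sup>2 + e" by simp
qed

lemma tree_convex_levels: "tree_convex {\<alpha>. length \<alpha> < m}" "tree_convex {\<alpha>. m \<le> length \<alpha>}"
  unfolding tree_convex_def using prefix_length_le by (fastforce, fastforce)

text \<open>A nearly norming family involves finitely many nodes, hence lives below some level
  \<open>m\<close>. The part of \<open>x\<close> below \<open>m\<close> then carries almost the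
  whole squared norm, and the splitting estimate leaves little for the rest.\<close>

lemma norm_restrict_levels_tendsto_0: "(\<lambda>m. norm (restrict_jt {\<alpha>. m \<le> length \<alpha>} x)) \<longlonglongrightarrow> 0"
proof (rule LIMSEQ_I)
  fix r :: real assume "r > 0"
  then have "r\<^sup>2 / 2 > 0" by simp
  then obtain F where F: "F \<in> segment_families"
    "(norm x)\<^sup>2 - r\<^sup>2 / 2 \<le> (\<Sum>S\<in>F. (sum (jt_coeff x) S)\<^sup>2)"
    using norm_jt_squared_approx by blast
  have fin: "finite (\<Union>F)" using F(1) finite_segment by (auto simp: segment_families_def)
  define M where "M = Suc (Max (insert 0 (length ` \<Union>F)))"
  have M: "length \<alpha> < M" if "\<alpha> \<in> \<Union>F" for \<alpha>
    unfolding M_def using that fin by (intro le_imp_less_Suc Max_ge) auto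
  have "norm (restrict_jt {\<alpha>. m \<le> length \<alpha>} x) < r" if "m \<ge> M" for m
  proof -
    let ?T = "\<lambda>b. if b then {\<alpha> :: node. length \<alpha> < m} else {\<alpha>. m \<le> length \<alpha>}"
    have "(\<Sum>b\<in>UNIV. (norm (restrict_jt (?T b) x))\<^sup>2) \<le> (norm x)\<^sup>2"
      by (rule sum_norm_restrict_le) (auto simp: tree_convex_levels disjoint_family_on_def)
    then have "(norm (restrict_jt {\<alpha>. length \<alpha> < m} x))\<^sup>2 + (norm (restrict_jt {\<alpha>. m \<le> length \<alpha>} x))\<^sup>2
        \<le> (norm x)\<^sup>2"
      by (simp add: UNIV_bool)
    moreover have "(\<Sum>S\<in>F. (sum (jt_coeff x) S)\<^sup>2) =
        (\<Sum>S\<in>F. (sum (jt_coeff (restrict_jt {\<alpha>. length \<alpha> < m} x)) S)\<^sup>2)"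
    proof (rule sum.cong[OF refl])
      fix S assume "S \<in> F"
      have "sum (jt_coeff x) S = sum (jt_coeff (restrict_jt {\<alpha>. length \<alpha> < m} x)) S"
      proof (rule sum.cong[OF refl])
        fix \<alpha> assume "\<alpha> \<in> S"
        then have "length \<alpha> < m" using M[of \<alpha>] \<open>m \<ge> M\<close> \<open>S \<in> F\<close> by fastforce
        then show "jt_coeff x \<alpha> = jt_coeff (restrict_jt {\<alpha>. length \<alpha> < m} x) \<alpha>"
          by (simp add: jt_coeff_restrict tree_convex_levels)
      qed
      then show "(sum (jt_coeff x) S)\<^sup>2 = (sum (jt_coeff (restrict_jt {\<alpha>. length \<alpha> < m} x)) S)\<^sup>2"
        by simp
    qed
    ultimately have "(norm (restrict_jt {\<alpha>. m \<le> length \<alpha>} x))\<^sup>2 \<le> r\<^sup>2 / 2"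
      using F(2) family_squares_le_norm[OF F(1), of "restrict_jt {\<alpha>. length \<alpha> < m} x"] by linarith
    also have "\<dots> < r\<^sup>2" using \<open>r > 0\<close> by simp
    finally show ?thesis by (rule power2_less_imp_less) (use \<open>r > 0\<close> in simp)
  qed
  then show "\<exists>M. \<forall>m\<ge>M. norm (norm (restrict_jt {\<alpha>. m \<le> length \<alpha>} x) - 0) < r" by auto
qed

section \<open>Functionals on James' tree space\<close>

lemma bounded_linear_coeff: "bounded_linear (\<lambda>x. jt_coeff x \<alpha>)"
  by (rule bounded_linear_intro[of _ 1]) (auto simp: abs_coeff_le_norm)

lift_definition node_sum :: "node set \<Rightarrow> jt \<Rightarrow>\<^sub>L real" is "\<lambda>S x. sum (jt_coeff x) S"
  by (intro bounded_linear_sum bounded_linear_coeff)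

lemma abs_node_sum_le: "S \<in> segments \<Longrightarrow> \<bar>node_sum S x\<bar> \<le> norm x"
  by (simp add: node_sum.rep_eq abs_segment_sum_le_norm)

text \<open>The functional is explicit: the segment sums over a nearly norming family form a
  Euclidean vector, and pairing with its normalization has norm at most 1 by Cauchy-Schwarz.\<close>

lemma norming_functional_jt:
  assumes "e > 0"
  obtains f :: "jt \<Rightarrow>\<^sub>L real" where "norm f \<le> 1" "f x \<ge> norm x - e"
proof (cases "norm x \<le> e")
  case True
  then show ?thesis using that[of 0] by simp
next
  case False
  define \<eta> where "\<eta> = (norm x)\<^sup>2 - (norm x - e)\<^sup>2"
  have "(norm x - e)\<^sup>2 < (norm x)\<^sup>2"
    using False \<open>e > 0\<close> by (intro power_strict_mono) auto
  then have "\<eta> > 0" by (simp add: \<eta>_def)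
  then obtain F where F: "F \<in> segment_families" "(norm x)\<^sup>2 - \<eta> \<le> (\<Sum>S\<in>F. (sum (jt_coeff x) S)\<^sup>2)"
    using norm_jt_squared_approx by blast
  define q where "q = family_norm (jt_coeff x) F"
  have q2: "q\<^sup>2 = (\<Sum>S\<in>F. (sum (jt_coeff x) S)\<^sup>2)" by (simp add: q_def family_norm_squared)
  have q: "q \<ge> norm x - e"
    by (rule power2_le_imp_le) (use F(2) q2 in \<open>auto simp: \<eta>_def q_def family_norm_nonneg\<close>)
  with False have "q > 0" by linarith
  define f where "f = (\<Sum>S\<in>F. (sum (jt_coeff x) S / q) *\<^sub>R node_sum S)"
  have f: "f y = (\<Sum>S\<in>F. (sum (jt_coeff x) S / q) * sum (jt_coeff y) S)" for y
    by (simp add: f_def blinfun.sum_left blinfun.scaleR_left node_sum.rep_eq)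
  have "norm f \<le> 1"
  proof (rule norm_blinfun_bound)
    fix y
    have "\<bar>f y\<bar> \<le> (\<Sum>S\<in>F. \<bar>sum (jt_coeff x) S / q * sum (jt_coeff y) S\<bar>)"
      unfolding f by (rule sum_abs)
    also have "\<dots> = (\<Sum>S\<in>F. \<bar>sum (jt_coeff x) S / q\<bar> * \<bar>sum (jt_coeff y) S\<bar>)"
      by (simp only: abs_mult)
    also have "\<dots> \<le> L2_set (\<lambda>S. sum (jt_coeff x) S / q) F * L2_set (\<lambda>S. sum (jt_coeff y) S) F"
      by (rule L2_set_mult_ineq)
    also have "L2_set (\<lambda>S. sum (jt_coeff x) S / q) F = 1"
      using \<open>q > 0\<close> by (simp add: L2_set_def power_divide flip: sum_divide_distrib q2)
    also have "L2_set (\<lambda>S. sum (jt_coeff y) S) F \<le> norm y"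
      unfolding norm_jt.rep_eq family_norm_L2[symmetric]
      by (rule family_norm_le_jt_norm[OF jt_finite_coeff F(1)])
    finally show "norm (f y) \<le> 1 * norm y" by simp
  qed simp
  moreover have "f x = q"
    unfolding f using q2 \<open>q > 0\<close> by (simp add: power2_eq_square field_simps flip: sum_divide_distrib)
  ultimately show ?thesis using that[of f] q by simp
qed

text \<open>The points of \<open>D\<close> act on the dual by evaluation. They are pointwise bounded
  there by compactness, so uniform boundedness applies, and norming functionals bring the bound back
  to \<open>D\<close>.\<close>

lemma weakly_compact_jt_bounded:
  fixes D :: "jt set"
  assumes "weakly_compact D"
  obtains M where "M > 0" "\<And>x. x \<in> D \<Longrightarrow> norm x \<le> M"
proof -
  define T :: "jt \<Rightarrow> (jt \<Rightarrow>\<^sub>L real) \<Rightarrow>\<^sub>L real" where "T x = Blinfun (\<lambda>f. blinfun_apply f x)" for x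
  have T: "T x f = f x" for x f
    unfolding T_def by (subst bounded_linear_Blinfun_apply) (auto intro: bounded_linear_intros)
  have "\<exists>c. \<forall>x\<in>D. norm (T x f) \<le> c" for f
  proof -
    have "compact (blinfun_apply f ` D)"
      using image_compactin[OF assms[unfolded weakly_compact_def] continuous_map_weak_functional[of f]]
      by simp
    then have "bounded (blinfun_apply f ` D)" by (rule compact_imp_bounded)
    then show ?thesis by (simp add: bounded_iff T)
  qed
  then obtain c where c: "\<And>x. x \<in> D \<Longrightarrow> norm (T x) \<le> c" using uniform_boundedness[of D T] by blast
  have "norm x \<le> max 1 c" if "x \<in> D" for x
  proof (rule field_le_epsilon)
    fix e :: real assume "e > 0"
    then obtain f :: "jt \<Rightarrow>\<^sub>L real" where f: "norm f \<le> 1" "f x \<ge> norm x - e"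
      by (rule norming_functional_jt)
    have "f x \<le> norm (T x f)" by (simp add: T)
    also have "\<dots> \<le> norm (T x) * norm f" by (rule norm_blinfun)
    also have "\<dots> \<le> norm (T x) * 1" using f by (intro mult_left_mono) auto
    also have "\<dots> \<le> max 1 c" using c[OF that] by simp
    finally show "norm x \<le> max 1 c + e" using f by simp
  qed
  then show thesis using that[of "max 1 c"] by simp
qed

section \<open>Coordinates of the direct sum\<close>

lemma blinfun_pointwise_limit:
  fixes f :: "nat \<Rightarrow> 'a::real_normed_vector \<Rightarrow>\<^sub>L real"
  assumes bound: "\<And>k y. \<bar>f k y\<bar> \<le> C * norm y" and conv: "\<And>y. convergent (\<lambda>k. f k y)"
  obtains g :: "'a \<Rightarrow>\<^sub>L real" where "\<And>y. (\<lambda>k. f k y) \<longlonglongrightarrow> g y"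
proof -
  define l where "l y = lim (\<lambda>k. f k y)" for y
  have l: "(\<lambda>k. f k y) \<longlonglongrightarrow> l y" for y
    using conv[of y] by (simp add: l_def convergent_LIMSEQ_iff)
  have "bounded_linear l"
  proof (rule bounded_linear_intro[of _ C])
    fix x y r
    show "l (x + y) = l x + l y"
      using tendsto_add[OF l[of x] l[of y]] l[of "x + y"]
      by (simp add: blinfun.add_right LIMSEQ_unique)
    show "l (r *\<^sub>R x) = r *\<^sub>R l x"
      using tendsto_mult_left[OF l[of x], of r] l[of "r *\<^sub>R x"]
      by (simp add: blinfun.scaleR_right LIMSEQ_unique)
    have "\<bar>l x\<bar> \<le> C * norm x"
      by (rule LIMSEQ_le_const2[OF tendsto_rabs[OF l[of x]]]) (use bound in auto)
    then show "norm (l x) \<le> norm x * C" by (simp add: mult.commute)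
  qed
  then show thesis using that[of "Blinfun l"] l by (simp add: bounded_linear_Blinfun_apply)
qed

lemma count_list_prefix_le: "prefix \<alpha> \<beta> \<Longrightarrow> count_list \<alpha> True \<le> count_list \<beta> True"
  by (auto simp: prefix_def)

lemma tree_convex_nodes_few_ones: "tree_convex (nodes_few_ones n)"
  unfolding tree_convex_def nodes_few_ones_def
  using count_list_prefix_le order_trans by blast

lemma X_sub_coeff_eq_0:
  assumes "x \<in> X_sub n" "\<alpha> \<notin> nodes_few_ones n"
  shows "jt_coeff x \<alpha> = 0"
proof -
  let ?S = "{x. jt_coeff x \<alpha> = 0}"
  have "continuous_on UNIV (\<lambda>x. jt_coeff x \<alpha>)"
    using bounded_linear_coeff linear_continuous_on by blast
  then have "closed ?S" using closed_Collect_eq[OF _ continuous_on_const] by blast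
  moreover have "subspace ?S" by (rule subspaceI) auto
  then have "span (node_vector ` nodes_few_ones n) \<subseteq> ?S"
    using assms(2) by (intro span_minimal) (auto simp: jt_coeff_node_vector)
  ultimately have "X_sub n \<subseteq> ?S" unfolding X_sub_def by (intro closure_minimal)
  with assms(1) show ?thesis by blast
qed

lemma finite_levels: "finite {\<alpha> :: node. length \<alpha> < m}"
  using finite_lists_length_le[of "UNIV :: bool set" m]
  by (rule rev_finite_subset) auto

text \<open>Truncations to finitely many levels are finite combinations of node vectors and converge
  because the level tails vanish. With \<open>X_sub_coeff_eq_0\<close> this identifies
  \<open>X_sub n\<close> as the vectors supported on \<open>nodes_few_ones n\<close>.\<close>

lemma restrict_in_X_sub: "restrict_jt (nodes_few_ones n) x \<in> X_sub n"
proof -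
  define y where "y = restrict_jt (nodes_few_ones n) x"
  define u where "u m = restrict_jt {\<alpha>. length \<alpha> < m} y" for m
  have "u m \<in> span (node_vector ` nodes_few_ones n)" for m
  proof -
    let ?G = "{\<alpha>. length \<alpha> < m} \<inter> nodes_few_ones n"
    have fin: "finite ?G" using finite_levels by blast
    have "u m = (\<Sum>\<alpha>\<in>?G. jt_coeff x \<alpha> *\<^sub>R node_vector \<alpha>)"
    proof (rule jt_eqI)
      fix \<beta>
      have "(\<Sum>\<alpha>\<in>?G. jt_coeff x \<alpha> * jt_coeff (node_vector \<alpha>) \<beta>) =
          (\<Sum>\<alpha>\<in>?G. if \<alpha> = \<beta> then jt_coeff x \<alpha> else 0)"
        by (intro sum.cong refl) (auto simp: jt_coeff_node_vector)
      also have "\<dots> = (if \<beta> \<in> ?G then jt_coeff x \<beta> else 0)" using fin by simp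
      also have "\<dots> = jt_coeff (u m) \<beta>"
        by (simp add: u_def y_def jt_coeff_restrict tree_convex_levels tree_convex_nodes_few_ones)
      finally show "jt_coeff (u m) \<beta> = jt_coeff (\<Sum>\<alpha>\<in>?G. jt_coeff x \<alpha> *\<^sub>R node_vector \<alpha>) \<beta>"
        by simp
    qed
    moreover have "\<dots> \<in> span (node_vector ` nodes_few_ones n)"
      by (intro span_sum span_scale span_base imageI) simp
    ultimately show ?thesis by simp
  qed
  moreover have "u \<longlonglongrightarrow> y"
  proof (rule LIM_zero_cancel, rule tendsto_norm_zero_cancel)
    have "u m - y = - restrict_jt {\<alpha>. m \<le> length \<alpha>} y" for m
      by (rule jt_eqI) (auto simp: u_def jt_coeff_restrict tree_convex_levels uminus_jt.rep_eq)
    then show "(\<lambda>m. norm (u m - y)) \<longlonglongrightarrow> 0"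
      using norm_restrict_levels_tendsto_0[of y] by simp
  qed
  ultimately show ?thesis unfolding X_sub_def closure_sequential y_def[symmetric] by blast
qed

section \<open>Projections onto and embeddings of the summands\<close>

lift_definition Z_proj :: "nat \<Rightarrow> Z \<Rightarrow>\<^sub>L jt" is "\<lambda>n z. Z_coord z n"
  by (rule bounded_linear_intro[of _ 1])
    (auto simp: plus_Z.rep_eq scaleR_Z.rep_eq norm_Z_coord_le)

lemma Z_proj_apply [simp]: "Z_proj n z = Z_coord z n"
  by (simp add: Z_proj.rep_eq)

text \<open>Restricting first makes the embedding total on \<open>jt\<close>; vectors of
  \<open>X_sub n\<close> are not changed by it.\<close>

lift_definition Z_single :: "nat \<Rightarrow> jt \<Rightarrow> Z" is
  "\<lambda>n x k. if k = n then restrict_jt (nodes_few_ones n) x else 0"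
proof (intro conjI allI)
  fix n k x
  show "(if k = n then restrict_jt (nodes_few_ones n) x else 0) \<in> X_sub k"
    by (simp add: restrict_in_X_sub subspace_0 subspace_X_sub)
  show "summable (\<lambda>k. norm (if k = n then restrict_jt (nodes_few_ones n) x else 0))"
    by (rule summable_finite[of "{n}"]) auto
qed

lemma norm_Z_single_le: "norm (Z_single n x) \<le> norm x"
proof -
  have "norm (Z_single n x) = norm (restrict_jt (nodes_few_ones n) x)"
    unfolding norm_Z.rep_eq Z_single.rep_eq by (subst suminf_finite[of "{n}"]) auto
  then show ?thesis by (simp add: norm_restrict_le tree_convex_nodes_few_ones)
qed

lift_definition Z_inj :: "nat \<Rightarrow> jt \<Rightarrow>\<^sub>L Z" is Z_single
proof (rule bounded_linear_intro[of _ 1])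
  fix n x y r
  interpret bounded_linear "restrict_jt (nodes_few_ones n)"
    by (rule bounded_linear_restrict[OF tree_convex_nodes_few_ones])
  show "Z_single n (x + y) = Z_single n x + Z_single n y"
    by (rule Z_coord_inject[THEN iffD1]) (auto simp: Z_single.rep_eq plus_Z.rep_eq add)
  show "Z_single n (r *\<^sub>R x) = r *\<^sub>R Z_single n x"
    by (rule Z_coord_inject[THEN iffD1]) (auto simp: Z_single.rep_eq scaleR_Z.rep_eq scaleR)
qed (simp add: norm_Z_single_le)

lemma norm_Z_inj_le: "norm (Z_inj n x) \<le> norm x"
  by (simp add: Z_inj.rep_eq norm_Z_single_le)

lemma Z_coord_inj: "Z_coord (Z_inj n x) k = (if k = n then restrict_jt (nodes_few_ones n) x else 0)"
  by (simp add: Z_inj.rep_eq Z_single.rep_eq)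

lemma Z_coord_sum: "Z_coord (sum y G) n = (\<Sum>i\<in>G. Z_coord (y i) n)"
  using blinfun.sum_right[of "Z_proj n" y G] by simp

lemma separating_functional_Z:
  fixes z :: Z
  assumes "z \<noteq> 0"
  shows "\<exists>f :: Z \<Rightarrow>\<^sub>L real. f z \<noteq> 0"
proof -
  have "Z_coord z \<noteq> Z_coord 0" using assms by (simp add: Z_coord_inject)
  then obtain n where "Z_coord z n \<noteq> 0" by (auto simp: zero_Z.rep_eq)
  then obtain \<alpha> where "jt_coeff (Z_coord z n) \<alpha> \<noteq> 0" using jt_eqI[of "Z_coord z n" 0] by auto
  then show ?thesis
    by (intro exI[of _ "node_sum {\<alpha>} o\<^sub>L Z_proj n"]) (simp add: node_sum.rep_eq)
qed


section \<open>Weakly compact sets in the direct sum have uniformly small tails\<close>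

definition Z_tail :: "nat \<Rightarrow> Z \<Rightarrow> real" where
  "Z_tail N z = (\<Sum>n. norm (Z_coord z (n + N)))"

lemma Z_tail_split:
  assumes "N \<le> M"
  shows "Z_tail N z = (\<Sum>n\<in>{N..<M}. norm (Z_coord z n)) + Z_tail M z"
proof -
  have "Z_tail N z = (\<Sum>n. norm (Z_coord z (n + (M - N) + N))) + (\<Sum>i<M - N. norm (Z_coord z (i + N)))"
    unfolding Z_tail_def
    by (rule suminf_split_initial_segment) (rule summable_ignore_initial_segment, simp)
  also have "(\<Sum>n. norm (Z_coord z (n + (M - N) + N))) = Z_tail M z"
    using assms by (simp add: Z_tail_def add.assoc)
  also have "(\<Sum>i<M - N. norm (Z_coord z (i + N))) = (\<Sum>n\<in>{N..<M}. norm (Z_coord z n))"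
    using assms sum.shift_bounds_nat_ivl[of "\<lambda>n. norm (Z_coord z n)" 0 N "M - N"]
    by (simp add: atLeast0LessThan)
  finally show ?thesis by simp
qed

lemma Z_tail_nonneg: "Z_tail N z \<ge> 0"
  unfolding Z_tail_def
  by (rule suminf_nonneg) (auto intro: summable_ignore_initial_segment)

lemma Z_tail_0: "Z_tail 0 z = norm z"
  by (simp add: Z_tail_def norm_Z.rep_eq)

lemma sum_norm_Z_coord_le_tail: "(\<Sum>n\<in>{N..<M}. norm (Z_coord z n)) \<le> Z_tail N z"
proof (cases "N \<le> M")
  case True
  then show ?thesis using Z_tail_split[OF True, of z] Z_tail_nonneg[of M z] by simp
qed (simp add: Z_tail_nonneg)

lemma Z_tail_antimono: "N \<le> M \<Longrightarrow> Z_tail M z \<le> Z_tail N z"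
  using Z_tail_split[of N M z] by (simp add: sum_nonneg)

lemma Z_tail_eventually_le:
  assumes "e > 0"
  obtains N where "\<And>M. M \<ge> N \<Longrightarrow> Z_tail M z \<le> e"
proof -
  obtain N where "\<forall>n\<ge>N. norm (\<Sum>i. norm (Z_coord z (i + n))) < e"
    using suminf_exist_split[OF assms summable_Z_coord[of z]] by blast
  then show thesis using that[of N] by (force simp: Z_tail_def)
qed

text \<open>One hump: norming functionals of the single coordinates are added over a finite window.
  Half of \<open>\<eta>\<close> pays for what lies beyond the window, the other half is spread over
  the coordinates inside.\<close>

lemma Z_tail_functional:
  assumes "\<eta> > 0"
  obtains N' and h :: "Z \<Rightarrow>\<^sub>L real" where "N' > N" "N' \<ge> M"
    "\<And>y. \<bar>h y\<bar> \<le> (\<Sum>n\<in>{N..<N'}. norm (Z_coord y n))"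
    "h z \<ge> Z_tail N z - \<eta>" "Z_tail N' z \<le> \<eta>"
proof -
  have "\<eta> / 2 > 0" using assms by simp
  then obtain N1 where N1: "\<And>M. M \<ge> N1 \<Longrightarrow> Z_tail M z \<le> \<eta> / 2"
    using Z_tail_eventually_le by blast
  define N' where "N' = Suc (max N (max M N1))"
  have N': "N' > N" "N' \<ge> M" "Z_tail N' z \<le> \<eta> / 2"
    using N1[of N'] by (auto simp: N'_def)
  define \<delta> where "\<delta> = \<eta> / 2 / real (N' - N)"
  have "\<delta> > 0" using N' assms by (simp add: \<delta>_def)
  then have "\<exists>f :: jt \<Rightarrow>\<^sub>L real. norm f \<le> 1 \<and> blinfun_apply f (Z_coord z n) \<ge> norm (Z_coord z n) - \<delta>" for n
    using norming_functional_jt[of \<delta> "Z_coord z n"] by metis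
  then obtain f :: "nat \<Rightarrow> jt \<Rightarrow>\<^sub>L real" where f: "\<And>n. norm (f n) \<le> 1"
      "\<And>n. f n (Z_coord z n) \<ge> norm (Z_coord z n) - \<delta>"
    by metis
  define h where "h = (\<Sum>n\<in>{N..<N'}. f n o\<^sub>L Z_proj n)"
  have h: "h y = (\<Sum>n\<in>{N..<N'}. f n (Z_coord y n))" for y
    by (simp add: h_def blinfun.sum_left)
  have "\<bar>h y\<bar> \<le> (\<Sum>n\<in>{N..<N'}. norm (Z_coord y n))" for y
  proof -
    have "\<bar>f n (Z_coord y n)\<bar> \<le> norm (Z_coord y n)" for n
      using norm_blinfun[of "f n" "Z_coord y n"] f(1)[of n] mult_right_mono[of "norm (f n)" 1 "norm (Z_coord y n)"]
      by simp
    then show ?thesis unfolding h by (intro order_trans[OF sum_abs sum_mono]) auto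
  qed
  moreover have "h z \<ge> Z_tail N z - \<eta>"
  proof -
    have "(\<Sum>n\<in>{N..<N'}. norm (Z_coord z n) - \<delta>) \<le> h z"
      unfolding h by (intro sum_mono f)
    moreover have "real (N' - N) * \<delta> = \<eta> / 2"
    proof -
      have "real (N' - N) \<noteq> 0" using N'(1) by simp
      then show ?thesis unfolding \<delta>_def by (metis nonzero_mult_div_cancel_left times_divide_eq_right)
    qed
    then have "(\<Sum>n\<in>{N..<N'}. norm (Z_coord z n) - \<delta>) = (\<Sum>n\<in>{N..<N'}. norm (Z_coord z n)) - \<eta> / 2"
      by (simp only: sum_subtractf sum_constant card_atLeastLessThan)
    ultimately show ?thesis using Z_tail_split[of N N' z] N' by linarith
  qed
  ultimately show thesis using that[of N' h] N' \<open>\<eta> / 2 > 0\<close> by simp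
qed

text \<open>Gliding hump. A state \<open>(N, f, H, u)\<close> holds a functional \<open>f\<close> on the coordinates below \<open>N\<close>, the
  set \<open>H\<close> of all functionals built so far, and the last chosen point \<open>u\<close> of \<open>D\<close>. Since \<open>H\<close> is kept,
  a cluster point of the chosen points agrees with \<open>g\<close> on every functional of the construction, which
  replaces the passage to weakly convergent subsequences.\<close>

lemma weakly_compact_Z_tails:
  fixes D :: "Z set"
  assumes D: "weakly_compact D" and "e > 0"
  obtains N where "\<And>x. x \<in> D \<Longrightarrow> Z_tail N x \<le> e"
proof (rule ccontr)
  assume "\<not> thesis"
  with that have "\<exists>x. x \<in> D \<and> Z_tail i x > e" for i
    by (metis not_le)
  then obtain x where x: "\<And>i. x i \<in> D" "\<And>i. Z_tail i (x i) > e" by metis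
  obtain g where g: "g \<in> D" "\<forall>(H :: (Z \<Rightarrow>\<^sub>L real) set) \<delta> m. finite H \<longrightarrow> \<delta> > 0 \<longrightarrow>
      (\<exists>j\<ge>m. \<forall>h\<in>H. \<bar>blinfun_apply h (x j) - blinfun_apply h g\<bar> < \<delta>)"
    using weakly_compact_cluster_point[where x = x, OF D x(1)] by (elim bexE)
  \<comment> \<open>The hump has height \<open>16 * \<eta>\<close>. Four errors of size
    \<open>\<eta>\<close> leave \<open>12 * \<eta>\<close> in \<open>big\<close>, and the final
    comparison allows only \<open>5 * \<eta>\<close>.\<close>
  define \<eta> where "\<eta> = e / 16"
  have "\<eta> > 0" using \<open>e > 0\<close> by (simp add: \<eta>_def)
  define P :: "nat \<Rightarrow> nat \<times> (Z \<Rightarrow>\<^sub>L real) \<times> (Z \<Rightarrow>\<^sub>L real) set \<times> Z \<Rightarrow> bool" where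
    "P = (\<lambda>_ (N, f, H, u). finite H \<and> f \<in> H \<and> Z_tail N g \<le> \<eta> \<and>
        (\<forall>y. \<bar>blinfun_apply f y\<bar> \<le> (\<Sum>n\<in>{0..<N}. norm (Z_coord y n))) \<and> u \<in> D)"
  define Q :: "nat \<Rightarrow> nat \<times> (Z \<Rightarrow>\<^sub>L real) \<times> (Z \<Rightarrow>\<^sub>L real) set \<times> Z \<Rightarrow>
      nat \<times> (Z \<Rightarrow>\<^sub>L real) \<times> (Z \<Rightarrow>\<^sub>L real) set \<times> Z \<Rightarrow> bool" where
    "Q = (\<lambda>_ (N, f, H, u) (N', f', H', u'). N < N' \<and> H \<subseteq> H' \<and>
        (\<forall>h\<in>H. \<bar>blinfun_apply h u' - blinfun_apply h g\<bar> < \<eta>) \<and>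
        (\<forall>y. \<bar>blinfun_apply f' y - blinfun_apply f y\<bar> \<le> (\<Sum>n\<in>{N..<N'}. norm (Z_coord y n))) \<and>
        blinfun_apply f' u' - blinfun_apply f u' \<ge> e - \<eta> \<and> Z_tail N' u' \<le> \<eta>)"
  obtain N0 where N0: "Z_tail N0 g \<le> \<eta>" using Z_tail_eventually_le[OF \<open>\<eta> > 0\<close>] by blast
  have base: "\<exists>s. P 0 s"
    by (rule exI[of _ "(N0, 0, {0}, g)"]) (simp add: P_def N0 g(1) sum_nonneg)
  have step: "\<exists>s'. P (Suc k) s' \<and> Q k s s'" if "P k s" for s k
  proof -
    obtain N f H u where s: "s = (N, f, H, u)" by (cases s)
    from that have inv: "finite H" "f \<in> H" "Z_tail N g \<le> \<eta>"
      "\<And>y. \<bar>f y\<bar> \<le> (\<Sum>n\<in>{0..<N}. norm (Z_coord y n))" by (auto simp: P_def s)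
    obtain i where i: "i \<ge> N" "\<And>h. h \<in> H \<Longrightarrow> \<bar>blinfun_apply h (x i) - blinfun_apply h g\<bar> < \<eta>"
      using g(2)[rule_format, OF inv(1) \<open>\<eta> > 0\<close>, of N] by blast
    obtain N' and h :: "Z \<Rightarrow>\<^sub>L real" where h: "N' > N"
      "\<And>y. \<bar>h y\<bar> \<le> (\<Sum>n\<in>{N..<N'}. norm (Z_coord y n))"
      "h (x i) \<ge> Z_tail N (x i) - \<eta>" "Z_tail N' (x i) \<le> \<eta>"
      using Z_tail_functional[OF \<open>\<eta> > 0\<close>, of N N "x i"] by metis
    have big: "Z_tail N (x i) > e" using x(2)[of i] Z_tail_antimono[OF i(1), of "x i"] by linarith
    have "\<bar>(f + h) y\<bar> \<le> (\<Sum>n\<in>{0..<N'}. norm (Z_coord y n))" for y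
    proof -
      have "\<bar>(f + h) y\<bar> \<le> (\<Sum>n\<in>{0..<N}. norm (Z_coord y n)) + (\<Sum>n\<in>{N..<N'}. norm (Z_coord y n))"
        using inv(4)[of y] h(2)[of y] by (simp add: blinfun.add_left)
      also have "\<dots> = (\<Sum>n\<in>{0..<N'}. norm (Z_coord y n))"
        using h(1) by (simp add: sum.atLeastLessThan_concat)
      finally show ?thesis .
    qed
    moreover have "Z_tail N' g \<le> \<eta>" using Z_tail_antimono[of N N' g] h(1) inv(3) by simp
    ultimately have "P (Suc k) (N', f + h, insert (f + h) H, x i)"
      using inv x(1) by (simp add: P_def)
    moreover have "Q k s (N', f + h, insert (f + h) H, x i)"
      unfolding Q_def s using h i(2) big by (auto simp: blinfun.add_left)
    ultimately show ?thesis by blast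
  qed
  obtain s where s: "\<And>k. P k (s k)" "\<And>k. Q k (s k) (s (Suc k))"
    using dependent_nat_choice[of P Q, OF base step] by blast
  define N where "N k = fst (s k)" for k
  define f where "f k = fst (snd (s k))" for k
  define H where "H k = fst (snd (snd (s k)))" for k
  define u where "u k = snd (snd (snd (s k)))" for k
  have sk: "s k = (N k, f k, H k, u k)" for k by (simp add: N_def f_def H_def u_def)
  have P: "f k \<in> H k" "Z_tail (N k) g \<le> \<eta>" "\<bar>f k y\<bar> \<le> (\<Sum>n\<in>{0..<N k}. norm (Z_coord y n))" "u k \<in> D" for k y
    using s(1)[of k] by (auto simp: P_def sk)
  have Q: "N k < N (Suc k)" "H k \<subseteq> H (Suc k)" "\<And>h. h \<in> H k \<Longrightarrow> \<bar>blinfun_apply h (u (Suc k)) - blinfun_apply h g\<bar> < \<eta>"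
    "\<bar>f (Suc k) y - f k y\<bar> \<le> (\<Sum>n\<in>{N k..<N (Suc k)}. norm (Z_coord y n))"
    "f (Suc k) (u (Suc k)) - f k (u (Suc k)) \<ge> e - \<eta>" "Z_tail (N (Suc k)) (u (Suc k)) \<le> \<eta>" for k y
    using s(2)[of k] by (auto simp: Q_def sk)
  have mono: "strict_mono N" using Q(1) by (simp add: strict_mono_Suc_iff)
  have Hmono: "H j \<subseteq> H k" if "j \<le> k" for j k using lift_Suc_mono_le[of H, OF Q(2) that] .
  have diff: "\<bar>f m y - f k y\<bar> \<le> Z_tail (N k) y - Z_tail (N m) y" if "k \<le> m" for k m y
    using that
  proof (induction m rule: dec_induct)
    case (step m)
    have "\<bar>f (Suc m) y - f m y\<bar> \<le> Z_tail (N m) y - Z_tail (N (Suc m)) y"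
      using Q(4)[of m y] Z_tail_split[of "N m" "N (Suc m)" y] Q(1)[of m] by linarith
    with step.IH show ?case by linarith
  qed simp
  have "convergent (\<lambda>k. f k y)" for y
  proof (rule Cauchy_convergent, rule CauchyI')
    fix r :: real assume "r > 0"
    then have "r / 2 > 0" by simp
    then obtain M where M: "\<And>n. n \<ge> M \<Longrightarrow> Z_tail n y \<le> r / 2"
      using Z_tail_eventually_le by blast
    show "\<exists>M. \<forall>m\<ge>M. \<forall>n>m. dist (f m y) (f n y) < r"
    proof (intro exI[of _ M] allI impI)
      fix m n assume mn: "m \<ge> M" "n > m"
      have "N m \<ge> M" using mn strict_mono_imp_increasing[OF mono, of m] by linarith
      then have "\<bar>f n y - f m y\<bar> \<le> r / 2"
        using diff[of m n y] mn M[of "N m"] Z_tail_nonneg[of "N n" y] by linarith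
      then show "dist (f m y) (f n y) < r" using \<open>r > 0\<close> by (simp add: dist_real_def abs_minus_commute)
    qed
  qed
  moreover have "\<bar>f k y\<bar> \<le> 1 * norm y" for k y
    using P(3)[of k y] sum_norm_Z_coord_le_tail[of y 0 "N k"] by (simp add: Z_tail_0)
  ultimately obtain F :: "Z \<Rightarrow>\<^sub>L real" where F: "\<And>y. (\<lambda>k. f k y) \<longlonglongrightarrow> F y"
    using blinfun_pointwise_limit[of f 1] by blast
  have Ff: "\<bar>F y - f k y\<bar> \<le> Z_tail (N k) y" for y k
  proof (rule LIMSEQ_le_const2)
    show "(\<lambda>m. \<bar>f m y - f k y\<bar>) \<longlonglongrightarrow> \<bar>F y - f k y\<bar>" by (intro tendsto_intros F)
    show "\<exists>M. \<forall>m\<ge>M. \<bar>f m y - f k y\<bar> \<le> Z_tail (N k) y"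
    proof (intro exI[of _ k] allI impI)
      fix m assume "k \<le> m"
      from diff[OF this, of y] Z_tail_nonneg[of "N m" y] show "\<bar>f m y - f k y\<bar> \<le> Z_tail (N k) y" by linarith
    qed
  qed
  have big: "F (u (Suc k)) \<ge> F g + 12 * \<eta>" for k
    using Ff[of "u (Suc k)" "Suc k"] Q(6)[of k] Q(5)[of k] Q(3)[OF P(1)[of k]] Ff[of g k] P(2)[of k]
      \<eta>_def by linarith
  \<comment> \<open>The limit \<open>F\<close> lifts all chosen points above its value at
    \<open>g\<close>, while a stored \<open>f j\<close> hardly distinguishes later points from
    \<open>g\<close>. At the cluster point \<open>y\<close> these conflict: the tail of
    \<open>y\<close> beyond \<open>N j\<close> is small, so \<open>F\<close> and \<open>f j\<close>
    nearly agree there.\<close>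
  obtain y where y: "y \<in> D" "\<forall>(H :: (Z \<Rightarrow>\<^sub>L real) set) \<delta> m. finite H \<longrightarrow> \<delta> > 0 \<longrightarrow>
      (\<exists>k\<ge>m. \<forall>h\<in>H. \<bar>blinfun_apply h (u (Suc k)) - blinfun_apply h y\<bar> < \<delta>)"
    using weakly_compact_cluster_point[where x = "\<lambda>k. u (Suc k)", OF D P(4)] by (elim bexE)
  obtain j where j: "\<And>n. n \<ge> j \<Longrightarrow> Z_tail n y \<le> \<eta>" using Z_tail_eventually_le[OF \<open>\<eta> > 0\<close>] by blast
  have "N j \<ge> j" by (rule strict_mono_imp_increasing[OF mono])
  then have "\<bar>F y - f j y\<bar> \<le> \<eta>" using Ff[of y j] j[of "N j"] by linarith
  moreover obtain k where k: "k \<ge> j" "\<bar>F (u (Suc k)) - F y\<bar> < \<eta>" "\<bar>f j (u (Suc k)) - f j y\<bar> < \<eta>"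
    using y(2)[rule_format, of "{F, f j}" \<eta> j] \<open>\<eta> > 0\<close> by auto
  moreover have "\<bar>f j (u (Suc k)) - f j g\<bar> < \<eta>"
    using Q(3)[of "f j" k] P(1)[of j] Hmono[OF k(1)] by blast
  ultimately show False using big[of k] Ff[of g j] P(2)[of j] \<open>\<eta> > 0\<close> by linarith
qed

section \<open>Branches and nodes ending in 1\<close>

definition zero_ext :: "node \<Rightarrow> nat \<Rightarrow> node" where
  "zero_ext \<beta> i = \<beta> @ replicate i False"

text \<open>Stripping the trailing zeros of a node in \<open>nodes_few_ones n\<close> leaves exactly
  one of these, so they index a partition of that set into zero branches.\<close>

definition branch_roots :: "nat \<Rightarrow> node set" where
  "branch_roots n = {\<beta> \<in> nodes_few_ones n. \<beta> = [] \<or> last \<beta>}"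

lemma length_zero_ext [simp]: "length (zero_ext \<beta> i) = length \<beta> + i"
  by (simp add: zero_ext_def)

lemma zero_ext_0 [simp]: "zero_ext \<beta> 0 = \<beta>"
  by (simp add: zero_ext_def)

lemma zero_ext_eq_iff [simp]: "zero_ext \<beta> i = zero_ext \<beta> j \<longleftrightarrow> i = j"
  by (simp add: zero_ext_def)

lemma zero_ext_add: "zero_ext \<beta> (i + j) = zero_ext \<beta> i @ replicate j False"
  by (simp add: zero_ext_def replicate_add)

lemma prefix_zero_ext_iff [simp]: "prefix (zero_ext \<beta> i) (zero_ext \<beta> j) \<longleftrightarrow> i \<le> j"
proof
  assume "prefix (zero_ext \<beta> i) (zero_ext \<beta> j)"
  from prefix_length_le[OF this] show "i \<le> j" by simp
next
  assume "i \<le> j"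
  then show "prefix (zero_ext \<beta> i) (zero_ext \<beta> j)"
    using zero_ext_add[of \<beta> i "j - i"] by simp
qed

lemma inj_zero_ext: "inj_on (zero_ext \<beta>) I"
  by (rule inj_onI) simp

lemma count_list_zero_ext: "count_list (zero_ext \<beta> i) True = count_list \<beta> True"
proof -
  have "count_list (replicate i False) True = 0" by (induction i) auto
  then show ?thesis by (simp add: zero_ext_def)
qed

lemma zero_ext_interval:
  "zero_ext \<beta> ` {a..<Suc b} = {\<gamma>. prefix (zero_ext \<beta> a) \<gamma> \<and> prefix \<gamma> (zero_ext \<beta> b)}"
proof (intro equalityI subsetI)
  fix \<gamma> assume "\<gamma> \<in> {\<gamma>. prefix (zero_ext \<beta> a) \<gamma> \<and> prefix \<gamma> (zero_ext \<beta> b)}"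
  then have \<gamma>: "prefix (zero_ext \<beta> a) \<gamma>" "prefix \<gamma> (zero_ext \<beta> b)" by auto
  define i where "i = length \<gamma> - length \<beta>"
  have i: "a \<le> i" "i \<le> b" "length \<gamma> = length \<beta> + i"
    using prefix_length_le[OF \<gamma>(1)] prefix_length_le[OF \<gamma>(2)] by (auto simp: i_def)
  have "prefix (zero_ext \<beta> i) (zero_ext \<beta> b)" using i by simp
  with \<gamma>(2) have "prefix \<gamma> (zero_ext \<beta> i)" using i(3) by (auto intro: prefix_length_prefix)
  then obtain t where t: "zero_ext \<beta> i = \<gamma> @ t" by (auto simp: prefix_def)
  from arg_cong[OF this, of length] have "t = []" using i(3) by simp
  with t have "\<gamma> = zero_ext \<beta> i" by simp
  then show "\<gamma> \<in> zero_ext \<beta> ` {a..<Suc b}" using i by auto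
qed auto

lemma zero_ext_segment:
  assumes "a \<le> b"
  shows "zero_ext \<beta> ` {a..<Suc b} \<in> segments"
  using assms unfolding zero_ext_interval segments_def by (intro CollectI exI conjI) auto

lemma zero_ext_interval_cases: "zero_ext \<beta> ` {a..<b} = {} \<or> zero_ext \<beta> ` {a..<b} \<in> segments"
  using zero_ext_segment[of a "b - 1" \<beta>] by (cases "a < b") auto

text \<open>Comparable roots with equally many ones coincide, since they could differ only by zeros
  and a nonempty root ends in 1. The possible counts are 0 to \<open>n\<close>, the count 0
  belonging to the empty node.\<close>

lemma card_branch_roots_below: "card {\<beta> \<in> branch_roots n. prefix \<beta> \<gamma>} \<le> n + 1"
proof -
  have eq: "\<beta> = \<beta>'" if r: "\<beta> \<in> branch_roots n" "\<beta>' \<in> branch_roots n" "prefix \<beta> \<beta>'"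
    "count_list \<beta> True = count_list \<beta>' True" for \<beta> \<beta>'
  proof -
    obtain t where t: "\<beta>' = \<beta> @ t" using r(3) by (auto simp: prefix_def)
    then have "count_list t True = 0" using r(4) by simp
    then have "True \<notin> set t" by (simp add: count_list_0_iff)
    have "t = []"
    proof (rule ccontr)
      assume "t \<noteq> []"
      then have "last t" using r(2) t by (simp add: branch_roots_def)
      with last_in_set[OF \<open>t \<noteq> []\<close>] \<open>True \<notin> set t\<close> show False by simp
    qed
    with t show ?thesis by simp
  qed
  have "inj_on (\<lambda>\<beta>. count_list \<beta> True) {\<beta> \<in> branch_roots n. prefix \<beta> \<gamma>}"
  proof (rule inj_onI)
    fix \<beta> \<beta>' assume *: "\<beta> \<in> {\<beta> \<in> branch_roots n. prefix \<beta> \<gamma>}" "\<beta>' \<in> {\<beta> \<in> branch_roots n. prefix \<beta> \<gamma>}"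
      "count_list \<beta> True = count_list \<beta>' True"
    then have "prefix \<beta> \<beta>' \<or> prefix \<beta>' \<beta>" using prefix_same_cases[of \<beta> \<gamma> \<beta>'] by simp
    then show "\<beta> = \<beta>'" using eq[of \<beta> \<beta>'] eq[of \<beta>' \<beta>] * by auto
  qed
  then have "card {\<beta> \<in> branch_roots n. prefix \<beta> \<gamma>} \<le> card {..n}"
    by (rule card_inj_on_le) (auto simp: branch_roots_def nodes_few_ones_def)
  then show ?thesis by simp
qed

lemma finite_prefixes: "finite {\<beta>. prefix \<beta> \<gamma> \<and> P \<beta>}"
  by (rule finite_subset[of _ "set (prefixes \<gamma>)"]) auto

section \<open>Sums along zero branches\<close>

lemma abs_node_sum_levels_le:
  assumes S: "S \<in> segments" "\<And>\<alpha>. \<alpha> \<in> S \<Longrightarrow> m \<le> length \<alpha>"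
  shows "\<bar>node_sum S x\<bar> \<le> norm (restrict_jt {\<alpha>. m \<le> length \<alpha>} x)"
proof -
  have "node_sum S x = node_sum S (restrict_jt {\<alpha>. m \<le> length \<alpha>} x)"
    unfolding node_sum.rep_eq
    by (intro sum.cong refl) (simp add: jt_coeff_restrict tree_convex_levels S(2))
  then show ?thesis using abs_node_sum_le[OF S(1)] by simp
qed

lemma abs_zero_ext_sum_le:
  "\<bar>node_sum (zero_ext \<beta> ` {a..<b}) x\<bar> \<le> norm (restrict_jt {\<alpha>. length \<beta> + a \<le> length \<alpha>} x)"
proof (cases "zero_ext \<beta> ` {a..<b} = {}")
  case False
  then have "zero_ext \<beta> ` {a..<b} \<in> segments" using zero_ext_interval_cases by blast
  then show ?thesis by (rule abs_node_sum_levels_le) auto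
qed (simp add: node_sum.rep_eq)

lemma node_sum_zero_ext: "node_sum (zero_ext \<beta> ` I) x = (\<Sum>i\<in>I. jt_coeff x (zero_ext \<beta> i))"
  by (simp add: node_sum.rep_eq sum.reindex inj_zero_ext)

text \<open>A finite piece of the branch is a segment, so its sum is at most the norm of the part of
  \<open>x\<close> from its starting level on. This makes the partial sums Cauchy.\<close>

lemma branch_sum_exists:
  "\<exists>g :: jt \<Rightarrow>\<^sub>L real. \<forall>x. (\<lambda>n. \<Sum>i\<in>{k..<n}. jt_coeff x (zero_ext \<beta> i)) \<longlonglongrightarrow> blinfun_apply g x"
proof -
  have "\<bar>node_sum (zero_ext \<beta> ` {k..<n}) x\<bar> \<le> 1 * norm x" for n x
    using order_trans[OF abs_zero_ext_sum_le norm_restrict_le[OF tree_convex_levels(2)]] by simp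
  moreover have "convergent (\<lambda>n. node_sum (zero_ext \<beta> ` {k..<n}) x)" for x
  proof (rule Cauchy_convergent, rule CauchyI')
    fix r :: real assume "r > 0"
    then obtain M where M: "\<And>m. m \<ge> M \<Longrightarrow> norm (restrict_jt {\<alpha>. m \<le> length \<alpha>} x) < r"
      using LIMSEQ_D[OF norm_restrict_levels_tendsto_0[of x]] by auto
    show "\<exists>M. \<forall>m\<ge>M. \<forall>n>m. dist (node_sum (zero_ext \<beta> ` {k..<m}) x) (node_sum (zero_ext \<beta> ` {k..<n}) x) < r"
    proof (intro exI[of _ "max M k"] allI impI)
      fix m n assume mn: "m \<ge> max M k" "n > m"
      have "node_sum (zero_ext \<beta> ` {k..<n}) x =
          node_sum (zero_ext \<beta> ` {k..<m}) x + node_sum (zero_ext \<beta> ` {m..<n}) x"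
        unfolding node_sum_zero_ext using mn by (simp add: sum.atLeastLessThan_concat)
      moreover have "\<bar>node_sum (zero_ext \<beta> ` {m..<n}) x\<bar> < r"
        using abs_zero_ext_sum_le[of \<beta> m n x] M[of "length \<beta> + m"] mn by simp
      ultimately show "dist (node_sum (zero_ext \<beta> ` {k..<m}) x) (node_sum (zero_ext \<beta> ` {k..<n}) x) < r"
        by (simp add: dist_real_def)
    qed
  qed
  ultimately obtain g :: "jt \<Rightarrow>\<^sub>L real" where "\<And>x. (\<lambda>n. node_sum (zero_ext \<beta> ` {k..<n}) x) \<longlonglongrightarrow> g x"
    using blinfun_pointwise_limit[of "\<lambda>n. node_sum (zero_ext \<beta> ` {k..<n})" 1] by blast
  then show ?thesis unfolding node_sum_zero_ext by blast
qed

definition branch_sum :: "node \<Rightarrow> nat \<Rightarrow> jt \<Rightarrow>\<^sub>L real" where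
  "branch_sum \<beta> k = (SOME g. \<forall>x. (\<lambda>n. \<Sum>i\<in>{k..<n}. jt_coeff x (zero_ext \<beta> i)) \<longlonglongrightarrow> blinfun_apply g x)"

lemma branch_sum_tendsto:
  "(\<lambda>n. \<Sum>i\<in>{k..<n}. jt_coeff x (zero_ext \<beta> i)) \<longlonglongrightarrow> branch_sum \<beta> k x"
  using someI_ex[OF branch_sum_exists[of \<beta> k]] unfolding branch_sum_def by blast

lemma branch_sum_split:
  assumes "k \<le> n"
  shows "branch_sum \<beta> k x = (\<Sum>i\<in>{k..<n}. jt_coeff x (zero_ext \<beta> i)) + branch_sum \<beta> n x"
proof (rule LIMSEQ_unique[OF branch_sum_tendsto])
  have "(\<lambda>m. (\<Sum>i\<in>{k..<n}. jt_coeff x (zero_ext \<beta> i)) + (\<Sum>i\<in>{n..<m}. jt_coeff x (zero_ext \<beta> i)))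
      \<longlonglongrightarrow> (\<Sum>i\<in>{k..<n}. jt_coeff x (zero_ext \<beta> i)) + branch_sum \<beta> n x"
    by (intro tendsto_intros branch_sum_tendsto)
  moreover have "\<forall>\<^sub>F m in sequentially. (\<Sum>i\<in>{k..<n}. jt_coeff x (zero_ext \<beta> i)) +
      (\<Sum>i\<in>{n..<m}. jt_coeff x (zero_ext \<beta> i)) = (\<Sum>i\<in>{k..<m}. jt_coeff x (zero_ext \<beta> i))"
    using eventually_ge_at_top[of n]
    by eventually_elim (use assms in \<open>simp add: sum.atLeastLessThan_concat\<close>)
  ultimately show "(\<lambda>m. \<Sum>i\<in>{k..<m}. jt_coeff x (zero_ext \<beta> i))
      \<longlonglongrightarrow> (\<Sum>i\<in>{k..<n}. jt_coeff x (zero_ext \<beta> i)) + branch_sum \<beta> n x"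
    using tendsto_cong by force
qed

lemma abs_branch_sum_le:
  "\<bar>branch_sum \<beta> k x\<bar> \<le> norm (restrict_jt {\<alpha>. length \<beta> + k \<le> length \<alpha>} x)"
proof (rule LIMSEQ_le_const2[OF tendsto_rabs[OF branch_sum_tendsto]])
  show "\<exists>N. \<forall>n\<ge>N. \<bar>\<Sum>i\<in>{k..<n}. jt_coeff x (zero_ext \<beta> i)\<bar> \<le>
      norm (restrict_jt {\<alpha>. length \<beta> + k \<le> length \<alpha>} x)"
    using abs_zero_ext_sum_le[of \<beta> k _ x] unfolding node_sum_zero_ext by blast
qed

lemma abs_branch_sum_le_norm: "\<bar>branch_sum \<beta> k x\<bar> \<le> norm x"
  using abs_branch_sum_le norm_restrict_le[OF tree_convex_levels(2)] order_trans by blast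

lemma branch_sum_tendsto_0: "(\<lambda>k. branch_sum \<beta> k x) \<longlonglongrightarrow> 0"
proof (rule Lim_null_comparison)
  show "\<forall>\<^sub>F k in sequentially. norm (branch_sum \<beta> k x) \<le> norm (restrict_jt {\<alpha>. k + length \<beta> \<le> length \<alpha>} x)"
    using abs_branch_sum_le[of \<beta> _ x] by (simp add: add.commute)
  show "(\<lambda>k. norm (restrict_jt {\<alpha>. k + length \<beta> \<le> length \<alpha>} x)) \<longlonglongrightarrow> 0"
    by (rule LIMSEQ_ignore_initial_segment[OF norm_restrict_levels_tendsto_0])
qed

section \<open>Failure of the bounded approximation property\<close>

lemma limitin_weak_topology:
  fixes s :: "nat \<Rightarrow> 'a::real_normed_vector"
  assumes "\<And>f :: 'a \<Rightarrow>\<^sub>L real. (\<lambda>k. f (s k)) \<longlonglongrightarrow> f l"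
  shows "limitin weak_topology s l sequentially"
  unfolding limitin_def
proof (intro conjI allI impI)
  fix U assume "openin weak_topology U \<and> l \<in> U"
  then have U: "openin weak_topology U" "l \<in> U" by auto
  from U(1) obtain A where A: "open A" "U = (\<lambda>x (f :: 'a \<Rightarrow>\<^sub>L real). blinfun_apply f x) -` A"
    by (auto simp: weak_topology_def openin_pullback_topology)
  have "((\<lambda>k (f :: 'a \<Rightarrow>\<^sub>L real). blinfun_apply f (s k)) \<longlongrightarrow> (\<lambda>f. blinfun_apply f l)) sequentially"
  proof -
    have "limitin (product_topology (\<lambda>_. euclideanreal) UNIV)
        (\<lambda>k (f :: 'a \<Rightarrow>\<^sub>L real). blinfun_apply f (s k)) (\<lambda>f. blinfun_apply f l) sequentially"
      using assms by (simp add: limitin_componentwise)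
    then show ?thesis by (simp add: euclidean_product_topology)
  qed
  from topological_tendstoD[OF this A(1)] U(2) show "\<forall>\<^sub>F k in sequentially. s k \<in> U"
    by (simp add: A(2))
qed simp

text \<open>For \<open>N\<close> roots with large value, the sum with matching signs has norm at
  most \<open>sqrt ((n + 1) * N)\<close>, since a segment meets at most \<open>n + 1\<close> roots,
  but \<open>f\<close> is at least \<open>N * \<delta>\<close> on it. This bounds
  \<open>N\<close>.\<close>

lemma finite_large_on_branch_roots:
  fixes f :: "jt \<Rightarrow>\<^sub>L real"
  assumes "\<delta> > 0"
  shows "finite {\<beta> \<in> branch_roots n. \<bar>f (node_vector \<beta>)\<bar> \<ge> \<delta>}" (is "finite ?B")
proof (rule ccontr)
  assume inf: "infinite ?B"
  obtain N :: nat where N: "real N > (norm f)\<^sup>2 * real (n + 1) / \<delta>\<^sup>2"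
    using reals_Archimedean2 by blast
  obtain G where G: "finite G" "card G = N" "G \<subseteq> ?B"
    using infinite_arbitrarily_large[OF inf] by blast
  define y where "y = (\<Sum>\<beta>\<in>G. sgn (f (node_vector \<beta>)) *\<^sub>R node_vector \<beta>)"
  have "(norm y)\<^sup>2 \<le> real (n + 1) * (\<Sum>\<beta>\<in>G. (norm (sgn (f (node_vector \<beta>)) *\<^sub>R node_vector \<beta>))\<^sup>2)"
    unfolding y_def
  proof (rule norm_sum_le_multiplicity[OF G(1)])
    fix S assume "S \<in> segments"
    then obtain \<alpha> \<gamma> where S: "S = {\<beta>. prefix \<alpha> \<beta> \<and> prefix \<beta> \<gamma>}" by (auto simp: segments_def)
    have "\<beta> \<in> S" if "sum (jt_coeff (sgn (f (node_vector \<beta>)) *\<^sub>R node_vector \<beta>)) S \<noteq> 0" for \<beta>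
    proof (rule ccontr)
      assume "\<beta> \<notin> S"
      then have "sum (jt_coeff (sgn (f (node_vector \<beta>)) *\<^sub>R node_vector \<beta>)) S = 0"
        by (intro sum.neutral) (auto simp: jt_coeff_node_vector)
      with that show False by simp
    qed
    then have "{\<beta> \<in> G. sum (jt_coeff (sgn (f (node_vector \<beta>)) *\<^sub>R node_vector \<beta>)) S \<noteq> 0}
        \<subseteq> {\<beta> \<in> branch_roots n. prefix \<beta> \<gamma>}"
      using G(3) S by blast
    moreover have "finite {\<beta> \<in> branch_roots n. prefix \<beta> \<gamma>}"
      using finite_prefixes[of \<gamma> "\<lambda>\<beta>. \<beta> \<in> branch_roots n"] by (simp add: conj_commute)
    ultimately show "card {\<beta> \<in> G. sum (jt_coeff (sgn (f (node_vector \<beta>)) *\<^sub>R node_vector \<beta>)) S \<noteq> 0} \<le> n + 1"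
      using card_mono card_branch_roots_below order_trans by meson
  qed
  also have "\<dots> \<le> real (n + 1) * (\<Sum>\<beta>\<in>G. 1)"
  proof (intro mult_left_mono sum_mono)
    fix \<beta>
    have "norm (sgn (f (node_vector \<beta>)) *\<^sub>R node_vector \<beta>) \<le> 1"
      using norm_node_vector_le[of \<beta>] by (simp add: abs_sgn_eq)
    then show "(norm (sgn (f (node_vector \<beta>)) *\<^sub>R node_vector \<beta>))\<^sup>2 \<le> 1"
      by (simp add: power_le_one)
  qed simp
  finally have y: "(norm y)\<^sup>2 \<le> real (n + 1) * real N" using G(2) by simp
  have "real N * \<delta> = (\<Sum>\<beta>\<in>G. \<delta>)" using G(2) by simp
  also have "\<dots> \<le> (\<Sum>\<beta>\<in>G. \<bar>f (node_vector \<beta>)\<bar>)" using G(3) by (intro sum_mono) auto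
  also have "\<dots> = f y"
    unfolding y_def blinfun.sum_right blinfun.scaleR_right by (intro sum.cong refl) (simp add: abs_sgn mult.commute)
  also have "\<dots> \<le> norm f * norm y" using norm_blinfun[of f y] by simp
  finally have "(real N * \<delta>)\<^sup>2 \<le> (norm f * norm y)\<^sup>2"
    using \<open>\<delta> > 0\<close> by (intro power_mono) auto
  also have "\<dots> \<le> (norm f)\<^sup>2 * (real (n + 1) * real N)"
    unfolding power_mult_distrib by (intro mult_left_mono y) simp
  finally have "real N * (real N * \<delta>\<^sup>2) \<le> real N * ((norm f)\<^sup>2 * real (n + 1))"
    by (simp add: power2_eq_square algebra_simps)
  moreover have "(norm f)\<^sup>2 * real (n + 1) < real N * \<delta>\<^sup>2" using N \<open>\<delta> > 0\<close> by (simp add: field_simps)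
  moreover have "real N > 0"
    using N by (rule le_less_trans[rotated]) simp
  ultimately show False by (simp add: mult_le_cancel_left)
qed

text \<open>Listed by their codes, with 0 at the indices that code no root, the node vectors form a
  weakly null sequence: each functional is large on finitely many roots only.\<close>

lemma weakly_compact_branch_roots: "weakly_compact (insert 0 (node_vector ` branch_roots n))"
proof -
  define s where "s k = (if k \<in> to_nat ` branch_roots n then node_vector (from_nat k) else 0)" for k
  have "limitin weak_topology s 0 sequentially"
  proof (rule limitin_weak_topology)
    fix f :: "jt \<Rightarrow>\<^sub>L real"
    show "(\<lambda>k. f (s k)) \<longlonglongrightarrow> f 0"
    proof (rule LIMSEQ_I)
      fix r :: real assume "r > 0"
      let ?B = "{\<beta> \<in> branch_roots n. \<bar>f (node_vector \<beta>)\<bar> \<ge> r}"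
      have fin: "finite (to_nat ` ?B)" using finite_large_on_branch_roots[OF \<open>r > 0\<close>] by simp
      have "norm (f (s k) - f 0) < r" if "k \<ge> Suc (Max (insert 0 (to_nat ` ?B)))" for k
      proof (rule ccontr)
        assume "\<not> norm (f (s k) - f 0) < r"
        then have "k \<in> to_nat ` ?B" using \<open>r > 0\<close> by (auto simp: s_def split: if_splits)
        then have "k \<le> Max (insert 0 (to_nat ` ?B))" using fin by (intro Max_ge) auto
        with that show False by simp
      qed
      then show "\<exists>M. \<forall>k\<ge>M. norm (f (s k) - f 0) < r" by blast
    qed
  qed
  moreover have "node_vector ` branch_roots n \<subseteq> range s"
  proof
    fix x assume "x \<in> node_vector ` branch_roots n"
    then obtain \<beta> where "\<beta> \<in> branch_roots n" "x = node_vector \<beta>" by blast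
    then show "x \<in> range s" by (intro range_eqI[of _ _ "to_nat \<beta>"]) (simp add: s_def)
  qed
  ultimately show ?thesis
    unfolding weakly_compact_def by (intro compactin_sequence_with_limit) auto
qed

section \<open>Paths leaving a zero branch\<close>

definition path_to :: "node \<Rightarrow> node set" where
  "path_to \<delta> = {\<gamma>. prefix \<gamma> \<delta>}"

lemma path_to_segment: "path_to \<delta> \<in> segments"
  unfolding segments_def path_to_def by (intro CollectI exI[of _ "[]"] exI[of _ \<delta>]) auto

lemma finite_path_to: "finite (path_to \<delta>)"
  by (rule finite_segment[OF path_to_segment])

text \<open>The comparison functional does not depend on \<open>\<delta>\<close>. Path and branch
  agree up to the exit at position \<open>l\<close>; the rest of the path and the rest of the branch
  both lie above level \<open>l\<close> and cost one tail norm each.\<close>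

lemma path_exits_branch:
  assumes "prefix (zero_ext \<beta> l @ [True]) \<delta>"
  shows "\<bar>node_sum (path_to \<delta>) x - (node_sum (path_to \<beta> - {\<beta>}) x + branch_sum \<beta> 0 x)\<bar> \<le>
    2 * norm (restrict_jt {\<alpha>. l \<le> length \<alpha>} x)"
proof -
  let ?R = "{\<gamma>. prefix (zero_ext \<beta> l @ [True]) \<gamma> \<and> prefix \<gamma> \<delta>}"
  have p1: "prefix (zero_ext \<beta> l) \<delta>"
    using assms append_prefixD by blast
  have p0: "prefix \<beta> (zero_ext \<beta> i)" for i by (simp add: zero_ext_def)
  have disj1: "(path_to \<beta> - {\<beta>}) \<inter> zero_ext \<beta> ` {0..<Suc l} = {}"
    using prefix_order.antisym p0 unfolding path_to_def by blast
  have longer: "\<not> prefix (zero_ext \<beta> l @ [True]) \<gamma>" if "prefix \<gamma> (zero_ext \<beta> l)" for \<gamma>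
    using prefix_length_le[OF that] prefix_length_le[of "zero_ext \<beta> l @ [True]" \<gamma>] by auto
  have "path_to \<delta> = (path_to \<beta> - {\<beta>}) \<union> zero_ext \<beta> ` {0..<Suc l} \<union> ?R"
  proof (intro equalityI subsetI)
    fix \<gamma> assume "\<gamma> \<in> path_to \<delta>"
    then have \<gamma>: "prefix \<gamma> \<delta>" by (simp add: path_to_def)
    then have "prefix \<gamma> (zero_ext \<beta> l @ [True]) \<or> prefix (zero_ext \<beta> l @ [True]) \<gamma>"
      using assms prefix_same_cases[of \<gamma> \<delta>] by blast
    then consider "prefix \<gamma> (zero_ext \<beta> l)" | "prefix (zero_ext \<beta> l @ [True]) \<gamma>" by (auto simp: prefix_snoc)
    then show "\<gamma> \<in> (path_to \<beta> - {\<beta>}) \<union> zero_ext \<beta> ` {0..<Suc l} \<union> ?R"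
    proof cases
      case 1
      show ?thesis
      proof (cases "prefix \<beta> \<gamma>")
        case True
        with 1 have "\<gamma> \<in> zero_ext \<beta> ` {0..<Suc l}" unfolding zero_ext_interval by simp
        then show ?thesis by blast
      next
        case False
        then have "prefix \<gamma> \<beta> \<and> \<gamma> \<noteq> \<beta>" using prefix_same_cases[OF 1 p0] by auto
        then show ?thesis by (simp add: path_to_def)
      qed
    qed (use \<gamma> in simp)
  next
    fix \<gamma> assume "\<gamma> \<in> (path_to \<beta> - {\<beta>}) \<union> zero_ext \<beta> ` {0..<Suc l} \<union> ?R"
    then have "prefix \<gamma> (zero_ext \<beta> l) \<or> prefix \<gamma> \<delta>"
      using p0 prefix_order.trans by (auto simp: path_to_def)
    then show "\<gamma> \<in> path_to \<delta>" using p1 prefix_order.trans unfolding path_to_def by blast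
  qed
  moreover have "((path_to \<beta> - {\<beta>}) \<union> zero_ext \<beta> ` {0..<Suc l}) \<inter> ?R = {}"
  proof -
    have "prefix \<gamma> (zero_ext \<beta> l)" if "\<gamma> \<in> (path_to \<beta> - {\<beta>}) \<union> zero_ext \<beta> ` {0..<Suc l}" for \<gamma>
      using that p0 prefix_order.trans by (auto simp: path_to_def)
    with longer show ?thesis by blast
  qed
  moreover have R: "?R \<in> segments"
    using assms unfolding segments_def by blast
  ultimately have "node_sum (path_to \<delta>) x = node_sum (path_to \<beta> - {\<beta>}) x
      + (\<Sum>i\<in>{0..<Suc l}. jt_coeff x (zero_ext \<beta> i)) + node_sum ?R x"
    using disj1 finite_path_to[of \<beta>] finite_segment[OF R]
    unfolding node_sum_zero_ext[symmetric] by (simp add: node_sum.rep_eq sum.union_disjoint)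
  moreover have "branch_sum \<beta> 0 x = (\<Sum>i\<in>{0..<Suc l}. jt_coeff x (zero_ext \<beta> i)) + branch_sum \<beta> (Suc l) x"
    by (rule branch_sum_split) simp
  moreover have "\<bar>node_sum ?R x\<bar> \<le> norm (restrict_jt {\<alpha>. l \<le> length \<alpha>} x)"
  proof (rule abs_node_sum_levels_le[OF R])
    fix \<alpha> assume "\<alpha> \<in> ?R"
    then show "l \<le> length \<alpha>" using prefix_length_le[of "zero_ext \<beta> l @ [True]" \<alpha>] by simp
  qed
  moreover have "\<bar>branch_sum \<beta> (Suc l) x\<bar> \<le> norm (restrict_jt {\<alpha>. l \<le> length \<alpha>} x)"
  proof -
    have "restrict_jt {\<alpha>. length \<beta> + Suc l \<le> length \<alpha>} x =
        restrict_jt {\<alpha>. length \<beta> + Suc l \<le> length \<alpha>} (restrict_jt {\<alpha>. l \<le> length \<alpha>} x)"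
      by (rule jt_eqI) (simp add: jt_coeff_restrict tree_convex_levels)
    then have "norm (restrict_jt {\<alpha>. length \<beta> + Suc l \<le> length \<alpha>} x) \<le> norm (restrict_jt {\<alpha>. l \<le> length \<alpha>} x)"
      by (metis norm_restrict_le tree_convex_levels(2))
    with abs_branch_sum_le show ?thesis by (rule order_trans)
  qed
  ultimately show ?thesis by linarith
qed

text \<open>The images \<open>A e\<^sub>j\<close> of the nodes \<open>e\<^sub>j\<close> along the all-zero branch above \<open>\<beta>\<close> cluster weakly at a vector \<open>g\<close>.
  Some \<open>A e\<^sub>j\<close> and \<open>g\<close> are essentially supported below a level \<open>l\<close>, so a path leaving the branch
  there cannot tell them apart, although \<open>j < l\<close>.\<close>

lemma branch_cluster_exit:
  assumes K: "weakly_compact K" "\<And>x. norm x \<le> 1 \<Longrightarrow> blinfun_apply A x \<in> K"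
  obtains g j l where "1 \<le> j" "j < l"
    "\<forall>(h :: jt \<Rightarrow>\<^sub>L real) \<delta> m. \<delta> > 0 \<longrightarrow>
      (\<exists>i\<ge>m. \<bar>blinfun_apply h (A (node_vector (zero_ext \<beta> i))) - blinfun_apply h g\<bar> < \<delta>)"
    "\<And>\<delta>. prefix (zero_ext \<beta> l @ [True]) \<delta> \<Longrightarrow>
      \<bar>node_sum (path_to \<delta>) (A (node_vector (zero_ext \<beta> j))) - node_sum (path_to \<delta>) g\<bar> \<le> 1 / 8"
proof -
  let ?a = "\<lambda>i. A (node_vector (zero_ext \<beta> i))"
  let ?b = "\<lambda>x. node_sum (path_to \<beta> - {\<beta>}) x + branch_sum \<beta> 0 x"
  have "?a i \<in> K" for i by (rule K(2)[OF norm_node_vector_le])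
  from weakly_compact_cluster_point[where x = ?a, OF K(1) this]
  obtain g where g: "\<forall>(H :: (jt \<Rightarrow>\<^sub>L real) set) \<delta> m. finite H \<longrightarrow> \<delta> > 0 \<longrightarrow>
      (\<exists>j\<ge>m. \<forall>h\<in>H. \<bar>blinfun_apply h (?a j) - blinfun_apply h g\<bar> < \<delta>)"
    by (elim bexE)
  have g1: "\<forall>(h :: jt \<Rightarrow>\<^sub>L real) \<delta> m. \<delta> > 0 \<longrightarrow> (\<exists>i\<ge>m. \<bar>blinfun_apply h (?a i) - blinfun_apply h g\<bar> < \<delta>)"
  proof (intro allI impI)
    fix h :: "jt \<Rightarrow>\<^sub>L real" and \<delta> :: real and m assume "\<delta> > 0"
    then show "\<exists>i\<ge>m. \<bar>blinfun_apply h (?a i) - blinfun_apply h g\<bar> < \<delta>"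
      using g[rule_format, of "{h}" \<delta> m] by simp
  qed
  have "\<exists>j\<ge>1. \<bar>(node_sum (path_to \<beta> - {\<beta>}) + branch_sum \<beta> 0) (?a j)
      - (node_sum (path_to \<beta> - {\<beta>}) + branch_sum \<beta> 0) g\<bar> < 1 / 16"
    using g1[rule_format, of "1 / 16" 1 "node_sum (path_to \<beta> - {\<beta>}) + branch_sum \<beta> 0"] by simp
  then obtain j where j: "j \<ge> 1" "\<bar>?b (?a j) - ?b g\<bar> < 1 / 16" by (auto simp: blinfun.add_left)
  \<comment> \<open>For \<open>?a j\<close> and for \<open>g\<close> the exit estimate costs twice
    1/64 each; with the 1/16 from the choice of \<open>j\<close> this gives 1/8.\<close>
  have small: "\<exists>M. \<forall>m\<ge>M. norm (restrict_jt {\<alpha>. m \<le> length \<alpha>} x) < 1 / 64" for x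
    using LIMSEQ_D[OF norm_restrict_levels_tendsto_0[of x], of "1 / 64"] by simp
  obtain M1 where M1: "\<And>m. m \<ge> M1 \<Longrightarrow> norm (restrict_jt {\<alpha>. m \<le> length \<alpha>} (?a j)) < 1 / 64"
    using small by blast
  obtain M2 where M2: "\<And>m. m \<ge> M2 \<Longrightarrow> norm (restrict_jt {\<alpha>. m \<le> length \<alpha>} g) < 1 / 64"
    using small by blast
  define l where "l = Suc (max j (max M1 M2))"
  have "\<bar>node_sum (path_to \<delta>) (?a j) - node_sum (path_to \<delta>) g\<bar> \<le> 1 / 8"
    if \<delta>: "prefix (zero_ext \<beta> l @ [True]) \<delta>" for \<delta>
  proof -
    have "M1 \<le> l" "M2 \<le> l" by (simp_all add: l_def)
    then show ?thesis
      using path_exits_branch[OF \<delta>, of "?a j"] path_exits_branch[OF \<delta>, of g] j(2) M1[of l] M2[of l]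
      by linarith
  qed
  then show thesis using that[of j l g] j(1) g1 by (simp add: l_def)
qed

text \<open>Only the minimum and the maximum can occur. In both counts of blocks met by a segment it
  is the middle one of three that leads to a contradiction.\<close>

lemma card_le_2_if_no_three:
  fixes I :: "nat set"
  assumes "finite I" "\<And>a b c. a \<in> I \<Longrightarrow> b \<in> I \<Longrightarrow> c \<in> I \<Longrightarrow> a < b \<Longrightarrow> b < c \<Longrightarrow> False"
  shows "card I \<le> 2"
proof (cases "I = {}")
  case False
  have "I \<subseteq> {Min I, Max I}"
  proof
    fix b assume b: "b \<in> I"
    have "Min I \<le> b" "b \<le> Max I" using assms(1) b by auto
    then show "b \<in> {Min I, Max I}"
      using assms(2)[of "Min I" b "Max I"] b Min_in[OF assms(1) False] Max_in[OF assms(1) False]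
      by (metis insertI1 insertI2 le_neq_implies_less)
  qed
  then have "card I \<le> card {Min I, Max I}" by (intro card_mono) auto
  also have "\<dots> \<le> 2" by (simp add: card_insert_if)
  finally show ?thesis .
qed simp

text \<open>Any such \<open>A\<close> has norm at least \<open>sqrt m / 8\<close>, which is what
  rules out a common bound for all summands.\<close>

lemma identity_on_branch_roots_obstruction:
  fixes A :: "jt \<Rightarrow>\<^sub>L jt"
  assumes K: "weakly_compact K" "\<And>x. norm x \<le> 1 \<Longrightarrow> A x \<in> K"
    and near: "\<And>\<beta>. \<beta> \<in> branch_roots m \<Longrightarrow> norm (A (node_vector \<beta>) - node_vector \<beta>) \<le> 1 / 8"
    and C: "\<And>x. norm (A x) \<le> C * norm x"
  shows "real m \<le> 8 * C * sqrt m"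
proof -
  have "\<exists>g j l. 1 \<le> j \<and> j < l \<and>
    (\<forall>(h :: jt \<Rightarrow>\<^sub>L real) \<delta> m. \<delta> > 0 \<longrightarrow>
      (\<exists>i\<ge>m. \<bar>blinfun_apply h (A (node_vector (zero_ext \<beta> i))) - blinfun_apply h g\<bar> < \<delta>)) \<and>
    (\<forall>\<delta>. prefix (zero_ext \<beta> l @ [True]) \<delta> \<longrightarrow>
      \<bar>node_sum (path_to \<delta>) (A (node_vector (zero_ext \<beta> j))) - node_sum (path_to \<delta>) g\<bar> \<le> 1 / 8)" for \<beta>
    by (rule branch_cluster_exit[OF K, of \<beta>]) blast+
  then obtain g j l where gjl: "\<And>\<beta>. 1 \<le> j \<beta> \<and> j \<beta> < l \<beta> \<and>
    (\<forall>(h :: jt \<Rightarrow>\<^sub>L real) \<delta> m. \<delta> > 0 \<longrightarrow>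
      (\<exists>i\<ge>m. \<bar>blinfun_apply h (A (node_vector (zero_ext \<beta> i))) - blinfun_apply h (g \<beta>)\<bar> < \<delta>)) \<and>
    (\<forall>\<delta>. prefix (zero_ext \<beta> (l \<beta>) @ [True]) \<delta> \<longrightarrow>
      \<bar>node_sum (path_to \<delta>) (A (node_vector (zero_ext \<beta> (j \<beta>)))) - node_sum (path_to \<delta>) (g \<beta>)\<bar> \<le> 1 / 8)"
    by metis
  \<comment> \<open>Starting with one 1, \<open>b i\<close> has \<open>i + 1\<close> ones, so
    exactly \<open>b 0\<close> to \<open>b (m - 1)\<close> are guaranteed to be roots for
    \<open>m\<close>; \<open>b m\<close> only serves as the end of the path.\<close>
  define b where "b = rec_nat [True] (\<lambda>_ \<beta>. zero_ext \<beta> (l \<beta>) @ [True])"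
  have b0: "b 0 = [True]" and bS: "b (Suc i) = zero_ext (b i) (l (b i)) @ [True]" for i
    by (simp_all add: b_def)
  have jl: "1 \<le> j (b i)" "j (b i) < l (b i)" for i using gjl[of "b i"] by auto
  have count: "count_list (b i) True = Suc i" for i
    by (induction i) (simp_all add: b0 bS count_list_zero_ext)
  have "last (b i)" for i by (cases i) (simp_all add: b0 bS)
  then have roots: "b i \<in> branch_roots m" if "i < m" for i
    using that by (simp add: branch_roots_def nodes_few_ones_def count)
  have next_node: "prefix (zero_ext (b i) (l (b i)) @ [True]) (b k)" if "i < k" for i k
    using that
  proof (induction k)
    case (Suc k)
    have "prefix (b k) (b (Suc k))" by (simp add: bS zero_ext_def)
    moreover have "prefix (zero_ext (b i) (l (b i)) @ [True]) (b k)" if "i \<noteq> k"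
      using Suc that by simp
    ultimately show ?case
      by (cases "i = k") (simp add: bS, metis prefix_order.trans)
  qed simp
  have chain: "prefix (zero_ext (b i) (l (b i))) (b k)" if "i < k" for i k
    using next_node[OF that] append_prefixD by blast
  define p where "p = node_sum (path_to (b m))"
  have p_le: "\<bar>p x\<bar> \<le> norm x" for x
    unfolding p_def by (rule abs_node_sum_le[OF path_to_segment])
  \<comment> \<open>The far node is chosen last, since the cluster point has to be tested on
    \<open>p\<close>, which is known only after all exits are fixed. Beyond \<open>l (b k)\<close>
    it lies off the path.\<close>
  have "\<exists>i. l (b k) < i \<and> \<bar>p (A (node_vector (zero_ext (b k) i))) - p (g (b k))\<bar> < 1 / 8" for k
  proof -
    have "\<exists>i\<ge>Suc (l (b k)). \<bar>p (A (node_vector (zero_ext (b k) i))) - p (g (b k))\<bar> < 1 / 8"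
      using gjl[of "b k"] by (elim conjE) (drule spec[of _ p], drule spec[of _ "1/8"], auto)
    then show ?thesis by (auto simp: Suc_le_eq)
  qed
  then obtain j' where j': "\<And>k. l (b k) < j' k"
    "\<And>k. \<bar>p (A (node_vector (zero_ext (b k) (j' k)))) - p (g (b k))\<bar> < 1 / 8" by metis
  define u where "u i = node_vector (zero_ext (b i) (j (b i))) - node_vector (b i)" for i
  define w where "w i = node_vector (zero_ext (b i) (j' i))" for i
  \<comment> \<open>Near and far images differ from \<open>p (g (b i))\<close> by at most 1/8 each,
    and the image of the root has path sum at least 7/8, so the value is at most -5/8.\<close>
  have gap: "p (A (u i)) - p (A (w i)) \<le> - 1 / 2" if "i < m" for i
  proof -
    have "\<bar>p (A (node_vector (zero_ext (b i) (j (b i))))) - p (g (b i))\<bar> \<le> 1 / 8"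
      using gjl[of "b i"] next_node[OF that] unfolding p_def by blast
    moreover have "\<bar>p (A (node_vector (b i)) - node_vector (b i))\<bar> \<le> 1 / 8"
      using order_trans[OF p_le near[OF roots[OF that]]] .
    moreover have "p (node_vector (b i)) = 1"
    proof -
      have "b i \<in> path_to (b m)"
        using chain[OF that] prefix_order.trans[of "b i" "zero_ext (b i) (l (b i))" "b m"]
        by (simp add: path_to_def zero_ext_def)
      then show ?thesis
        by (simp add: p_def node_sum.rep_eq jt_coeff_node_vector finite_path_to)
    qed
    ultimately show ?thesis
      using j'(2)[of i] unfolding u_def w_def blinfun.diff_right by linarith
  qed
  \<comment> \<open>A segment containing a root and its near node sees 0 of their difference. If it
    meets three differences, convexity puts both nodes of the middle one into it, so at most two
    count. With norms at most 2 this gives \<open>8 * m\<close>, rounded up to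
    \<open>9 * m\<close>.\<close>
  have "(norm (sum u {..<m}))\<^sup>2 \<le> real 2 * (\<Sum>i<m. (norm (u i))\<^sup>2)"
  proof (rule norm_sum_le_multiplicity)
    fix S assume S: "S \<in> segments"
    have u: "sum (jt_coeff (u i)) S =
        (if zero_ext (b i) (j (b i)) \<in> S then 1 else 0) - (if b i \<in> S then 1 else 0)" for i
      using finite_segment[OF S] by (simp add: u_def jt_coeff_node_vector sum_subtractf)
    show "card {i \<in> {..<m}. sum (jt_coeff (u i)) S \<noteq> 0} \<le> 2"
    proof (rule card_le_2_if_no_three)
      fix i1 i2 i3
      assume i: "i1 \<in> {i \<in> {..<m}. sum (jt_coeff (u i)) S \<noteq> 0}" "i2 \<in> {i \<in> {..<m}. sum (jt_coeff (u i)) S \<noteq> 0}"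
        "i3 \<in> {i \<in> {..<m}. sum (jt_coeff (u i)) S \<noteq> 0}" "i1 < i2" "i2 < i3"
      have 1: "zero_ext (b i1) (j (b i1)) \<in> S \<or> b i1 \<in> S" using i(1) u[of i1] by (auto split: if_splits)
      have 3: "zero_ext (b i3) (j (b i3)) \<in> S \<or> b i3 \<in> S" using i(3) u[of i3] by (auto split: if_splits)
      have up: "prefix (b i) (zero_ext (b i) k)" for i k by (simp add: zero_ext_def)
      have "prefix (zero_ext (b i1) (j (b i1))) (zero_ext (b i1) (l (b i1)))" using jl(2)[of i1] by simp
      then have "prefix (zero_ext (b i1) (j (b i1))) (b i2)"
        using chain[OF i(4)] prefix_order.trans by blast
      moreover from this have "prefix (b i1) (b i2)" using up prefix_order.trans by blast
      ultimately obtain \<alpha> where \<alpha>: "\<alpha> \<in> S" "prefix \<alpha> (b i2)" using 1 by blast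
      have "prefix (zero_ext (b i2) (j (b i2))) (zero_ext (b i2) (l (b i2)))" using jl(2)[of i2] by simp
      then have "prefix (zero_ext (b i2) (j (b i2))) (b i3)"
        using chain[OF i(5)] prefix_order.trans by blast
      then obtain \<gamma> where \<gamma>: "\<gamma> \<in> S" "prefix (zero_ext (b i2) (j (b i2))) \<gamma>"
        using 3 up prefix_order.trans by blast
      have "b i2 \<in> S" "zero_ext (b i2) (j (b i2)) \<in> S"
        using tree_convexD[OF segment_tree_convex[OF S] \<alpha>(1) \<gamma>(1)] \<alpha>(2) \<gamma>(2) up prefix_order.trans by blast+
      then show False using i(2) u[of i2] by simp
    qed simp
  qed simp
  also have "\<dots> \<le> real 2 * (\<Sum>i<m. 4)"
  proof (intro mult_left_mono sum_mono)
    fix i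
    have "norm (u i) \<le> 2"
      unfolding u_def
      using norm_triangle_ineq4[of "node_vector (zero_ext (b i) (j (b i)))" "node_vector (b i)"]
        norm_node_vector_le[of "zero_ext (b i) (j (b i))"] norm_node_vector_le[of "b i"] by linarith
    then show "(norm (u i))\<^sup>2 \<le> 4" using power_mono[of "norm (u i)" 2 2] by simp
  qed simp
  also have "\<dots> \<le> (3 * sqrt m)\<^sup>2" by (simp add: power_mult_distrib)
  finally have nu: "norm (sum u {..<m}) \<le> 3 * sqrt m" by (rule power2_le_imp_le) simp
  have "(norm (sum w {..<m}))\<^sup>2 \<le> real 1 * (\<Sum>i<m. (norm (w i))\<^sup>2)"
  proof (rule norm_sum_le_multiplicity)
    fix S assume S: "S \<in> segments"
    then obtain \<alpha> \<gamma> where S': "S = {\<beta>. prefix \<alpha> \<beta> \<and> prefix \<beta> \<gamma>}" by (auto simp: segments_def)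
    have w: "sum (jt_coeff (w i)) S = (if zero_ext (b i) (j' i) \<in> S then 1 else 0)" for i
      using finite_segment[OF S] by (simp add: w_def jt_coeff_node_vector)
    \<comment> \<open>All nodes of a segment are prefixes of its top. The far node of
      \<open>i\<close> requires an entry 0 after the exit at \<open>l (b i)\<close>, while
      everything above \<open>b k\<close> has a 1 there.\<close>
    have no: False if ii: "i < k" "zero_ext (b i) (j' i) \<in> S" "zero_ext (b k) (j' k) \<in> S" for i k
    proof -
      have "prefix (zero_ext (b i) (Suc (l (b i)))) (zero_ext (b i) (j' i))" using j'(1)[of i] by simp
      then have 1: "prefix (zero_ext (b i) (Suc (l (b i)))) \<gamma>"
        using ii(2) S' prefix_order.trans by blast
      have "prefix (b k) (zero_ext (b k) (j' k))" by (simp add: zero_ext_def)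
      then have 2: "prefix (zero_ext (b i) (l (b i)) @ [True]) \<gamma>"
        using next_node[OF ii(1)] ii(3) S' prefix_order.trans by blast
      have "zero_ext (b i) (Suc (l (b i))) = zero_ext (b i) (l (b i)) @ [False]"
        using zero_ext_add[of "b i" "l (b i)" 1] by simp
      with 1 2 show False by (auto simp: prefix_def)
    qed
    have "card {i \<in> {..<m}. sum (jt_coeff (w i)) S \<noteq> 0} \<le> Suc 0"
    proof (subst card_le_Suc0_iff_eq)
      show "\<forall>i\<in>{i \<in> {..<m}. sum (jt_coeff (w i)) S \<noteq> 0}. \<forall>k\<in>{i \<in> {..<m}. sum (jt_coeff (w i)) S \<noteq> 0}. i = k"
      proof (intro ballI)
        fix i k assume "i \<in> {i \<in> {..<m}. sum (jt_coeff (w i)) S \<noteq> 0}" "k \<in> {i \<in> {..<m}. sum (jt_coeff (w i)) S \<noteq> 0}"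
        then have "zero_ext (b i) (j' i) \<in> S" "zero_ext (b k) (j' k) \<in> S" by (auto simp: w split: if_splits)
        then show "i = k" using no[of i k] no[of k i] by (cases i k rule: linorder_cases) auto
      qed
    qed simp
    then show "card {i \<in> {..<m}. sum (jt_coeff (w i)) S \<noteq> 0} \<le> 1" by simp
  qed simp
  also have "\<dots> \<le> real 1 * (\<Sum>i<m. 1)"
    unfolding w_def by (intro mult_left_mono sum_mono power_le_one norm_node_vector_le) auto
  also have "\<dots> \<le> (sqrt m)\<^sup>2" by simp
  finally have nw: "norm (sum w {..<m}) \<le> sqrt m" by (rule power2_le_imp_le) simp
  define x where "x = sum u {..<m} - sum w {..<m}"
  have nx: "norm x \<le> 4 * sqrt m"
    unfolding x_def using norm_triangle_ineq4[of "sum u {..<m}" "sum w {..<m}"] nu nw by linarith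
  have "p (A x) = (\<Sum>i<m. p (A (u i)) - p (A (w i)))"
    by (simp add: x_def blinfun.diff_right blinfun.sum_right sum_subtractf)
  also have "\<dots> \<le> (\<Sum>i<m. - 1 / 2)" by (intro sum_mono gap) simp
  finally have "real m / 2 \<le> \<bar>p (A x)\<bar>" by simp
  also have "\<dots> \<le> C * norm x" using order_trans[OF p_le C] .
  also have "\<dots> \<le> C * (4 * sqrt m)"
  proof (rule mult_left_mono[OF nx])
    show "C \<ge> 0"
    proof (rule ccontr)
      assume "\<not> C \<ge> 0"
      moreover have "1 \<le> norm (node_vector [])"
        using abs_coeff_le_norm[of "node_vector []" "[]"] by (simp add: jt_coeff_node_vector)
      ultimately have "C * norm (node_vector []) < 0" by (intro mult_neg_pos) linarith+
      with C[of "node_vector []"] show False using norm_ge_zero[of "A (node_vector [])"] by linarith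
    qed
  qed
  finally show ?thesis by simp
qed

lemma not_WAP_Z: "\<not> WAP TYPE(Z)"
proof
  assume "WAP TYPE(Z)"
  then obtain C :: real where C: "\<And>(D :: Z set) (\<epsilon> :: real). weakly_compact D \<Longrightarrow> \<epsilon> > 0 \<Longrightarrow>
      \<exists>V :: Z \<Rightarrow>\<^sub>L Z. weakly_compact_operator V \<and>
        (SUP x\<in>D. ennreal (norm (x - blinfun_apply V x))) < ennreal \<epsilon> \<and> norm V \<le> C"
    unfolding WAP_def by blast
  \<comment> \<open>The obstruction will give \<open>sqrt m \<le> 8 * C\<close>, which this choice
    excludes.\<close>
  obtain m :: nat where m: "real m > (8 * C)\<^sup>2" using reals_Archimedean2 by blast
  define D where "D = Z_inj m ` insert 0 (node_vector ` branch_roots m)"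
  have "weakly_compact D"
    unfolding D_def by (rule weakly_compact_blinfun_image[OF weakly_compact_branch_roots])
  from C[OF this, of "1 / 8"] obtain V :: "Z \<Rightarrow>\<^sub>L Z" where V: "weakly_compact_operator V"
    "(SUP x\<in>D. ennreal (norm (x - V x))) < ennreal (1 / 8)" "norm V \<le> C" by auto
  \<comment> \<open>Compression to the summand \<open>m\<close> keeps the norm bound and the
    closeness on the roots, and weak continuity of \<open>Z_proj m\<close> keeps the image of the
    ball in a weakly compact set.\<close>
  define A where "A = Z_proj m o\<^sub>L V o\<^sub>L Z_inj m"
  have A: "A x = Z_coord (V (Z_inj m x)) m" for x by (simp add: A_def)
  have "real m \<le> 8 * C * sqrt m"
  proof (rule identity_on_branch_roots_obstruction)
    show "weakly_compact (Z_proj m ` (weak_topology closure_of (V ` cball 0 1)))"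
      using V(1) unfolding weakly_compact_operator_def by (rule weakly_compact_blinfun_image)
    show "A x \<in> Z_proj m ` (weak_topology closure_of (V ` cball 0 1))" if "norm x \<le> 1" for x
    proof -
      have "V (Z_inj m x) \<in> V ` cball 0 1"
        using order_trans[OF norm_Z_inj_le that] by auto
      moreover have "V ` cball 0 1 \<subseteq> weak_topology closure_of (V ` cball 0 1)"
        by (rule closure_of_subset) simp
      ultimately have "V (Z_inj m x) \<in> weak_topology closure_of (V ` cball 0 1)" by blast
      then show ?thesis unfolding A Z_proj_apply[symmetric] by (rule imageI)
    qed
    show "norm (A (node_vector \<beta>) - node_vector \<beta>) \<le> 1 / 8" if \<beta>: "\<beta> \<in> branch_roots m" for \<beta>
    proof -
      let ?z = "Z_inj m (node_vector \<beta>)"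
      have "ennreal (norm (?z - V ?z)) \<le> (SUP x\<in>D. ennreal (norm (x - V x)))"
        using \<beta> by (intro SUP_upper) (simp add: D_def)
      then have "ennreal (norm (?z - V ?z)) < ennreal (1 / 8)" using V(2) by (rule le_less_trans)
      then have "norm (?z - V ?z) \<le> 1 / 8" by (simp add: ennreal_less_iff)
      moreover have "Z_coord (?z - V ?z) m = node_vector \<beta> - A (node_vector \<beta>)"
      proof -
        have "restrict_jt (nodes_few_ones m) (node_vector \<beta>) = node_vector \<beta>"
          by (rule jt_eqI) (use \<beta> in \<open>auto simp: jt_coeff_restrict tree_convex_nodes_few_ones
              jt_coeff_node_vector branch_roots_def\<close>)
        then show ?thesis by (simp add: minus_Z.rep_eq Z_coord_inj A)
      qed
      ultimately show ?thesis
        using norm_Z_coord_le[of "?z - V ?z" m] by (simp add: norm_minus_commute)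
    qed
    show "norm (A x) \<le> C * norm x" for x
    proof -
      have "norm (A x) \<le> norm (V (Z_inj m x))" unfolding A by (rule norm_Z_coord_le)
      also have "\<dots> \<le> norm V * norm (Z_inj m x)" by (rule norm_blinfun)
      also have "\<dots> \<le> C * norm x"
        using V(3) norm_Z_inj_le[of m x] order_trans[OF norm_ge_zero V(3)] by (intro mult_mono) auto
      finally show ?thesis .
    qed
  qed
  then have "sqrt m * sqrt m \<le> (8 * C) * sqrt m" by simp
  moreover have "sqrt m > 0"
    using m by (metis le_less_trans real_sqrt_gt_0_iff zero_le_power2)
  ultimately have "sqrt m \<le> 8 * C" by (rule mult_right_le_imp_le)
  then have "real m \<le> (8 * C)\<^sup>2"
    using power_mono[of "sqrt m" "8 * C" 2] by simp
  with m show False by simp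
qed

section \<open>Weakly compact operators from finite rank blocks\<close>

definition jt_ball_coeffs :: "(node \<Rightarrow> real) set" where
  "jt_ball_coeffs = {a. \<forall>F\<in>segment_families. family_norm a F \<le> 1}"

text \<open>A closed part of a cube, compact by the Tychonoff theorem: each constraint involves only
  finitely many coefficients. Coefficientwise convergence plays the role of a weak-star topology on
  the ball.\<close>

lemma compact_jt_ball_coeffs: "compact jt_ball_coeffs"
proof -
  let ?P = "PiE UNIV (\<lambda>_ :: node. {-1..1 :: real})"
  have "compactin (product_topology (\<lambda>_. euclideanreal) UNIV) ?P"
    by (simp add: compactin_PiE)
  then have "compact ?P" by (simp add: euclidean_product_topology)
  moreover have "closed jt_ball_coeffs"
  proof -
    have coord: "continuous_on UNIV (\<lambda>a :: node \<Rightarrow> real. a \<alpha>)" for \<alpha> by simp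
    have "continuous_on UNIV (\<lambda>a. family_norm a F)" for F
      unfolding family_norm_def by (intro continuous_intros coord)
    then have *: "closed {a. family_norm a F \<le> 1}" for F
      by (intro closed_Collect_le continuous_on_const)
    have "jt_ball_coeffs = (\<Inter>F\<in>segment_families. {a. family_norm a F \<le> 1})"
      by (auto simp: jt_ball_coeffs_def)
    with * show ?thesis using closed_INT[of segment_families "\<lambda>F. {a. family_norm a F \<le> 1}"] by metis
  qed
  moreover have "jt_ball_coeffs \<subseteq> ?P"
  proof
    fix a assume a: "a \<in> jt_ball_coeffs"
    have "\<bar>a \<alpha>\<bar> \<le> 1" for \<alpha>
    proof -
      have "family_norm a {{\<alpha>}} \<le> 1"
        using a singleton_in_segment_families by (simp add: jt_ball_coeffs_def)
      then show ?thesis by (simp add: family_norm_def)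
    qed
    then show "a \<in> ?P" by (auto simp: abs_le_iff minus_le_iff)
  qed
  ultimately show ?thesis using closed_Int_compact by (metis inf.absorb1)
qed

lemma jt_ball_coeffs_jt:
  assumes "a \<in> jt_ball_coeffs"
  shows "jt_coeff (Abs_jt a) = a" "norm (Abs_jt a) \<le> 1"
proof -
  have bound: "\<And>F. F \<in> segment_families \<Longrightarrow> family_norm a F \<le> 1"
    using assms by (simp add: jt_ball_coeffs_def)
  show *: "jt_coeff (Abs_jt a) = a"
    using jt_finiteI[OF bound] by (simp add: Abs_jt_inverse)
  show "norm (Abs_jt a) \<le> 1" unfolding norm_jt.rep_eq * by (rule jt_norm_le[OF bound])
qed

lemma cball_eq_jt_ball_coeffs: "cball 0 1 = Abs_jt ` jt_ball_coeffs"
proof (intro equalityI subsetI)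
  fix x :: jt assume "x \<in> cball 0 1"
  then have "norm x \<le> 1" by simp
  then have "jt_coeff x \<in> jt_ball_coeffs"
    using family_norm_le_jt_norm[OF jt_finite_coeff[of x]]
    by (force simp: jt_ball_coeffs_def norm_jt.rep_eq)
  then show "x \<in> Abs_jt ` jt_ball_coeffs" by (metis image_eqI jt_coeff_inverse)
qed (auto simp: jt_ball_coeffs_jt)

section \<open>Sums of finite rank blocks\<close>

definition finite_rank_op :: "node set \<Rightarrow> (node \<Rightarrow> jt) \<Rightarrow> jt \<Rightarrow> jt" where
  "finite_rank_op R v x = (\<Sum>\<gamma>\<in>R. jt_coeff x \<gamma> *\<^sub>R v \<gamma>)"

lemma bounded_linear_finite_rank_op: "bounded_linear (finite_rank_op R v)"
  unfolding finite_rank_op_def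
  by (intro bounded_linear_sum bounded_linear_scaleR_const bounded_linear_coeff)

lemma finite_rank_op_add: "finite_rank_op R v (x + y) = finite_rank_op R v x + finite_rank_op R v y"
  by (rule linear_add[OF bounded_linear.linear[OF bounded_linear_finite_rank_op]])

lemma finite_rank_op_scaleR: "finite_rank_op R v (r *\<^sub>R x) = r *\<^sub>R finite_rank_op R v x"
  by (rule linear_scale[OF bounded_linear.linear[OF bounded_linear_finite_rank_op]])

lemma finite_rank_op_zero [simp]: "finite_rank_op R v 0 = 0"
  by (simp add: finite_rank_op_def)

lemma summable_tail_sum_small:
  fixes a :: "nat \<Rightarrow> real"
  assumes a: "\<And>k. a k \<ge> 0" "\<And>G. finite G \<Longrightarrow> sum a G \<le> c" and "e > 0"
  obtains N where "\<And>m n. N \<le> m \<Longrightarrow> (\<Sum>k\<in>{m..<n}. a k) < e"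
proof -
  have "summable a"
    by (rule summableI_nonneg_bounded[of _ c]) (use a in auto)
  then obtain N where "\<And>m n. N \<le> m \<Longrightarrow> norm (sum a {m..<n}) < e"
    using \<open>e > 0\<close> unfolding summable_Cauchy by blast
  then show thesis using that[of N] by (metis abs_ge_self le_less_trans real_norm_def)
qed

text \<open>The blocks satisfy an upper and a lower \<open>\<ell>\<^sup>2\<close>-estimate. By duality the norms \<open>c k\<close> of a
  functional on the ranges of the blocks are square summable, so that the functional composed with
  the sum of the blocks is, uniformly on the unit ball, a limit of functions of finitely many
  coefficients, and the unit ball is compact for coefficientwise convergence.\<close>

lemma l2_block_operator:
  fixes R :: "nat \<Rightarrow> node set" and v :: "nat \<Rightarrow> node \<Rightarrow> jt"
  defines "y \<equiv> \<lambda>k. finite_rank_op (R k) (v k)"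
  assumes upper: "\<And>G X. finite G \<Longrightarrow> (norm (\<Sum>k\<in>G. y k (X k)))\<^sup>2 \<le> c1 * (\<Sum>k\<in>G. (norm (y k (X k)))\<^sup>2)"
    and lower: "\<And>G x. finite G \<Longrightarrow> (\<Sum>k\<in>G. (norm (y k x))\<^sup>2) \<le> c2 * (norm x)\<^sup>2"
    and pos: "c1 \<ge> 0" "c2 \<ge> 0"
  obtains W :: "jt \<Rightarrow>\<^sub>L jt" where "\<And>x. (\<lambda>k. y k x) sums W x" "weakly_compact (W ` cball 0 1)"
proof -
  have y_add: "y k (x + z) = y k x + y k z" and y_scaleR: "y k (r *\<^sub>R x) = r *\<^sub>R y k x"
    and y_zero: "y k 0 = 0" for k x z r
    by (simp_all add: y_def finite_rank_op_add finite_rank_op_scaleR)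
  have "summable (\<lambda>k. y k x)" for x
    unfolding summable_Cauchy
  proof (intro allI impI)
    fix e :: real assume "e > 0"
    then have "e\<^sup>2 / (c1 + 1) > 0" using pos by simp
    then obtain N where N: "\<And>m n. N \<le> m \<Longrightarrow> (\<Sum>k\<in>{m..<n}. (norm (y k x))\<^sup>2) < e\<^sup>2 / (c1 + 1)"
      using summable_tail_sum_small[of "\<lambda>k. (norm (y k x))\<^sup>2" "c2 * (norm x)\<^sup>2"] lower by (metis zero_le_power2)
    have "norm (\<Sum>k\<in>{m..<n}. y k x) < e" if "N \<le> m" for m n
    proof -
      have "(norm (\<Sum>k\<in>{m..<n}. y k x))\<^sup>2 \<le> c1 * (\<Sum>k\<in>{m..<n}. (norm (y k x))\<^sup>2)"
        using upper[of "{m..<n}" "\<lambda>_. x"] by simp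
      also have "\<dots> \<le> (c1 + 1) * (\<Sum>k\<in>{m..<n}. (norm (y k x))\<^sup>2)"
        by (intro mult_right_mono sum_nonneg) auto
      also have "\<dots> < e\<^sup>2" using N[OF that, of n] pos by (simp add: field_simps)
      finally show ?thesis by (rule power2_less_imp_less) (use \<open>e > 0\<close> in simp)
    qed
    then show "\<exists>N. \<forall>m\<ge>N. \<forall>n. norm (\<Sum>k\<in>{m..<n}. y k x) < e" by blast
  qed
  then have sums: "(\<lambda>k. y k x) sums (\<Sum>k. y k x)" for x by (rule summable_sums)
  define C where "C = sqrt (c1 * c2)"
  have partial: "norm (\<Sum>k\<in>{..<n}. y k x) \<le> norm x * C" for n x
  proof (rule power2_le_imp_le)
    have "(norm (\<Sum>k\<in>{..<n}. y k x))\<^sup>2 \<le> c1 * (\<Sum>k\<in>{..<n}. (norm (y k x))\<^sup>2)"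
      using upper[of "{..<n}" "\<lambda>_. x"] by simp
    also have "\<dots> \<le> c1 * (c2 * (norm x)\<^sup>2)" by (intro mult_left_mono lower pos) simp
    also have "\<dots> = (norm x * C)\<^sup>2" using pos by (simp add: C_def power_mult_distrib)
    finally show "(norm (\<Sum>k\<in>{..<n}. y k x))\<^sup>2 \<le> (norm x * C)\<^sup>2" .
  qed (use pos in \<open>simp add: C_def\<close>)
  have "bounded_linear (\<lambda>x. \<Sum>k. y k x)"
  proof (rule bounded_linear_intro[of _ C])
    fix x z r
    show "(\<Sum>k. y k (x + z)) = (\<Sum>k. y k x) + (\<Sum>k. y k z)"
      using sums_unique[OF sums_add[OF sums[of x] sums[of z]]] by (simp add: y_add)
    show "(\<Sum>k. y k (r *\<^sub>R x)) = r *\<^sub>R (\<Sum>k. y k x)"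
      using sums_unique[OF sums_scaleR_right[OF sums[of x], of r]] by (simp add: y_scaleR)
    show "norm (\<Sum>k. y k x) \<le> norm x * C"
      by (rule LIMSEQ_le_const2[OF tendsto_norm[OF sums[of x, unfolded sums_def]]]) (use partial in auto)
  qed
  then obtain W :: "jt \<Rightarrow>\<^sub>L jt" where W: "\<And>x. W x = (\<Sum>k. y k x)"
    using bounded_linear_Blinfun_apply by metis
  have "continuous_map (top_of_set jt_ball_coeffs) weak_topology (\<lambda>a. W (Abs_jt a))"
    unfolding continuous_map_weak_topology_iff
  proof
    fix f :: "jt \<Rightarrow>\<^sub>L real"
    \<comment> \<open>The number \<open>c k\<close> will be the norm of \<open>f\<close> on the
      range of block \<open>k\<close>; range vectors are represented by their preimages.\<close>
    define E where "E k = {x. norm (y k x) \<le> 1}" for k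
    define c where "c k = (SUP x\<in>E k. f (y k x))" for k
    have E0: "0 \<in> E k" for k by (simp add: E_def y_zero)
    have f_le: "\<bar>f u\<bar> \<le> norm f * norm u" for u using norm_blinfun[of f u] by simp
    have "f (y k x) \<le> norm f" if "x \<in> E k" for k x
      using f_le[of "y k x"] that mult_left_mono[of "norm (y k x)" 1 "norm f"] by (simp add: E_def)
    then have bdd: "bdd_above ((\<lambda>x. f (y k x)) ` E k)" for k by (intro bdd_aboveI2) blast
    have c_ge: "f (y k x) \<le> c k" if "x \<in> E k" for k x
      unfolding c_def by (rule cSUP_upper[OF that bdd])
    have c_nonneg: "c k \<ge> 0" for k using c_ge[OF E0, of k] by (simp add: y_zero)
    have f_y: "\<bar>f (y k x)\<bar> \<le> c k * norm (y k x)" for k x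
    proof (cases "y k x = 0")
      case False
      define t where "t = sgn (f (y k x)) / norm (y k x)"
      have "norm (y k (t *\<^sub>R x)) \<le> 1"
        using False by (simp add: y_scaleR t_def abs_sgn_eq)
      then have "f (y k (t *\<^sub>R x)) \<le> c k" by (intro c_ge) (simp add: E_def)
      moreover have "f (y k (t *\<^sub>R x)) = \<bar>f (y k x)\<bar> / norm (y k x)"
        by (simp add: y_scaleR blinfun.scaleR_right t_def abs_sgn mult.commute)
      ultimately show ?thesis using False by (simp add: field_simps)
    qed simp
    have c_sq: "(\<Sum>k\<in>G. (c k)\<^sup>2) \<le> 4 * c1 * (norm f)\<^sup>2" if G: "finite G" for G
    proof -
      have "\<exists>x\<in>E k. f (y k x) \<ge> c k / 2" for k
      proof (cases "c k = 0")
        case True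
        then show ?thesis using E0[of k] by (intro bexI[of _ 0]) (simp_all add: y_zero)
      next
        case False
        then have "c k / 2 < (SUP x\<in>E k. f (y k x))" using c_nonneg[of k] by (simp flip: c_def)
        then obtain x where "x \<in> E k" "c k / 2 < f (y k x)"
          using less_cSUP_iff[OF _ bdd] E0 by (metis empty_iff)
        then show ?thesis by (intro bexI[of _ x]) auto
      qed
      then obtain X where X: "\<And>k. X k \<in> E k" "\<And>k. f (y k (X k)) \<ge> c k / 2" by metis
      define s where "s = (\<Sum>k\<in>G. (c k)\<^sup>2)"
      \<comment> \<open>Test vector of the duality argument: \<open>f u\<close> is at least
        \<open>s / 2\<close>, as each \<open>X k\<close> attains \<open>c k\<close> up to a factor
        2, whereas \<open>upper\<close> bounds its norm by \<open>sqrt (c1 * s)\<close>. Cancelling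
        \<open>s\<close> gives the constant \<open>4 * c1\<close>.\<close>
      define u where "u = (\<Sum>k\<in>G. y k (c k *\<^sub>R X k))"
      have "s \<ge> 0" by (simp add: s_def sum_nonneg)
      have "(norm u)\<^sup>2 \<le> c1 * (\<Sum>k\<in>G. (norm (y k (c k *\<^sub>R X k)))\<^sup>2)"
        unfolding u_def by (rule upper[OF G])
      also have "\<dots> \<le> c1 * s"
        unfolding s_def
      proof (intro mult_left_mono sum_mono pos)
        fix k
        have "norm (y k (c k *\<^sub>R X k)) \<le> c k * 1"
          using X(1)[of k] c_nonneg[of k] unfolding y_scaleR norm_scaleR E_def
          by (simp add: mult_left_le)
        then show "(norm (y k (c k *\<^sub>R X k)))\<^sup>2 \<le> (c k)\<^sup>2" by (intro power_mono) auto
      qed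
      finally have u: "(norm u)\<^sup>2 \<le> c1 * s" .
      have "s / 2 = (\<Sum>k\<in>G. c k * (c k / 2))"
        by (simp add: s_def power2_eq_square sum_divide_distrib)
      also have "\<dots> \<le> (\<Sum>k\<in>G. c k * f (y k (X k)))"
        by (intro sum_mono mult_left_mono X c_nonneg)
      also have "\<dots> = f u" by (simp add: u_def blinfun.sum_right y_scaleR blinfun.scaleR_right)
      also have "\<dots> \<le> norm f * norm u" using f_le[of u] by linarith
      finally have "(s / 2)\<^sup>2 \<le> (norm f * norm u)\<^sup>2" using \<open>s \<ge> 0\<close> by (intro power_mono) auto
      also have "\<dots> \<le> (norm f)\<^sup>2 * (c1 * s)"
        unfolding power_mult_distrib by (intro mult_left_mono u) simp
      finally have "s * s \<le> (4 * c1 * (norm f)\<^sup>2) * s"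
        by (simp add: power2_eq_square field_simps)
      then show ?thesis
        using \<open>s \<ge> 0\<close> pos unfolding s_def[symmetric] by (cases "s = 0") (auto simp: mult_le_cancel_right)
    qed
    define g where "g n a = f (\<Sum>k\<in>{..<n}. y k (Abs_jt a))" for n a
    \<comment> \<open>By Cauchy-Schwarz the remainder is at most the square-summable tail of
      \<open>c\<close> times the block norms of \<open>x\<close>, and \<open>lower\<close> bounds
      the latter on the whole ball at once.\<close>
    have "uniform_limit jt_ball_coeffs g (\<lambda>a. f (W (Abs_jt a))) sequentially"
    proof (rule uniform_limitI)
      fix e :: real assume "e > 0"
      then have "(e / 2)\<^sup>2 / (c2 + 1) > 0" using pos by simp
      then obtain N where N: "\<And>m n. N \<le> m \<Longrightarrow> (\<Sum>k\<in>{m..<n}. (c k)\<^sup>2) < (e / 2)\<^sup>2 / (c2 + 1)"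
        using summable_tail_sum_small[of "\<lambda>k. (c k)\<^sup>2" "4 * c1 * (norm f)\<^sup>2"] c_sq by (metis zero_le_power2)
      have "dist (g m a) (f (W (Abs_jt a))) < e" if m: "N \<le> m" and a: "a \<in> jt_ball_coeffs" for m a
      proof -
        define x where "x = Abs_jt a"
        have nx: "norm x \<le> 1" using jt_ball_coeffs_jt(2)[OF a] by (simp add: x_def)
        have "\<bar>g n a - g m a\<bar> \<le> e / 2" if "m \<le> n" for n
        proof -
          have "g n a - g m a = (\<Sum>k\<in>{m..<n}. f (y k x))"
          proof -
            have "(\<Sum>k\<in>{..<n}. f (y k x)) = (\<Sum>k\<in>{..<m}. f (y k x)) + (\<Sum>k\<in>{m..<n}. f (y k x))"
              using sum.atLeastLessThan_concat[of 0 m n "\<lambda>k. f (y k x)"] that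
              by (simp add: atLeast0LessThan)
            then show ?thesis by (simp add: g_def x_def blinfun.sum_right)
          qed
          also have "\<bar>\<dots>\<bar> \<le> (\<Sum>k\<in>{m..<n}. \<bar>c k\<bar> * \<bar>norm (y k x)\<bar>)"
            using f_y c_nonneg by (intro order_trans[OF sum_abs sum_mono]) simp
          also have "\<dots> \<le> L2_set c {m..<n} * L2_set (\<lambda>k. norm (y k x)) {m..<n}"
            by (rule L2_set_mult_ineq)
          also have "\<dots> \<le> sqrt ((e / 2)\<^sup>2 / (c2 + 1)) * sqrt (c2 + 1)"
          proof (intro mult_mono)
            show "L2_set c {m..<n} \<le> sqrt ((e / 2)\<^sup>2 / (c2 + 1))"
              unfolding L2_set_def using N[OF m, of n] by simp
            have "(\<Sum>k\<in>{m..<n}. (norm (y k x))\<^sup>2) \<le> c2 * (norm x)\<^sup>2" by (rule lower) simp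
            also have "\<dots> \<le> c2 * 1" using pos nx by (intro mult_left_mono power_le_one) auto
            finally show "L2_set (\<lambda>k. norm (y k x)) {m..<n} \<le> sqrt (c2 + 1)"
              unfolding L2_set_def by simp
          qed (use pos in \<open>auto simp: L2_set_nonneg\<close>)
          also have "\<dots> = e / 2"
            using pos \<open>e > 0\<close> by (simp add: real_sqrt_divide)
          finally show ?thesis .
        qed
        moreover have "(\<lambda>n. \<bar>g n a - g m a\<bar>) \<longlonglongrightarrow> \<bar>f (W x) - g m a\<bar>"
          unfolding g_def x_def[symmetric] W
          by (intro tendsto_intros bounded_linear.tendsto[OF blinfun.bounded_linear_right] sums[unfolded sums_def])
        ultimately have "\<bar>f (W x) - g m a\<bar> \<le> e / 2"
          by (intro LIMSEQ_le_const2) blast+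
        then show ?thesis using \<open>e > 0\<close> by (simp add: x_def dist_real_def abs_minus_commute)
      qed
      then show "\<forall>\<^sub>F m in sequentially. \<forall>a\<in>jt_ball_coeffs. dist (g m a) (f (W (Abs_jt a))) < e"
        unfolding eventually_sequentially by blast
    qed
    moreover have "continuous_on jt_ball_coeffs (g n)" for n
    proof -
      have coord: "continuous_on jt_ball_coeffs (\<lambda>a :: node \<Rightarrow> real. a \<alpha>)" for \<alpha>
        by (rule continuous_on_subset[OF continuous_on_product_coordinates]) simp
      have "g n a = (\<Sum>k<n. \<Sum>\<gamma>\<in>R k. a \<gamma> * f (v k \<gamma>))" if "a \<in> jt_ball_coeffs" for a
        by (simp add: g_def y_def finite_rank_op_def blinfun.sum_right blinfun.scaleR_right
            jt_ball_coeffs_jt(1)[OF that])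
      then show ?thesis
        using continuous_on_cong[of jt_ball_coeffs jt_ball_coeffs "g n" "\<lambda>a. \<Sum>k<n. \<Sum>\<gamma>\<in>R k. a \<gamma> * f (v k \<gamma>)"]
          continuous_on_sum[of "{..<n}" jt_ball_coeffs "\<lambda>k a. \<Sum>\<gamma>\<in>R k. a \<gamma> * f (v k \<gamma>)"]
          continuous_on_sum[of _ jt_ball_coeffs "\<lambda>\<gamma> a. a \<gamma> * f (v _ \<gamma>)"]
          continuous_on_mult_right[OF coord]
        by simp
    qed
    ultimately have "continuous_on jt_ball_coeffs (\<lambda>a. f (W (Abs_jt a)))"
      by (intro uniform_limit_theorem[of _ g sequentially]) auto
    then show "continuous_map (top_of_set jt_ball_coeffs) euclideanreal (\<lambda>a. f (W (Abs_jt a)))"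
      by simp
  qed
  moreover have "compactin (top_of_set jt_ball_coeffs) jt_ball_coeffs"
    using compact_jt_ball_coeffs by (simp add: compactin_subtopology)
  ultimately have "compactin weak_topology ((\<lambda>a. W (Abs_jt a)) ` jt_ball_coeffs)"
    by (rule image_compactin[rotated])
  then have "weakly_compact (W ` cball 0 1)"
    by (simp add: weakly_compact_def cball_eq_jt_ball_coeffs image_image)
  then show thesis using that[of W] sums W by simp
qed


section \<open>Averages of branch sums on weakly compact sets\<close>

text \<open>By compactness every index is followed, uniformly on \<open>D\<close>, by one at which the branch sum is
  tiny. An index \<open>r i\<close> at which it is not small thus costs a fixed amount of variation, and the
  variation on \<open>D\<close> is bounded because \<open>D\<close> is.\<close>

lemma small_averages:
  fixes \<delta> :: real
  assumes D: "weakly_compact D" and "\<delta> > 0"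
  obtains A k where "finite A" "A \<noteq> {}" "A \<subseteq> {k0..<k}"
    "\<forall>x\<in>D. \<bar>\<Sum>a\<in>A. branch_sum \<beta> a x\<bar> \<le> \<delta> * real (card A)"
proof -
  obtain M where M: "M > 0" "\<And>x. x \<in> D \<Longrightarrow> norm x \<le> M"
    using weakly_compact_jt_bounded[OF D] by blast
  have "\<exists>m. n < m \<and> (\<forall>x\<in>D. \<exists>k\<in>{n..<m}. \<bar>branch_sum \<beta> k x\<bar> < \<delta> / 4)" for n
    using weakly_compact_eventually_small[OF D, of "\<delta> / 4" "branch_sum \<beta>" n] \<open>\<delta> > 0\<close> branch_sum_tendsto_0
    by (metis divide_pos_pos zero_less_numeral)
  then obtain q where q: "\<And>n. n < q n" "\<And>n x. x \<in> D \<Longrightarrow> \<exists>k\<in>{n..<q n}. \<bar>branch_sum \<beta> k x\<bar> < \<delta> / 4"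
    by metis
  define r where "r = rec_nat k0 (\<lambda>_ n. q n)"
  have r0: "r 0 = k0" and rS: "r (Suc i) = q (r i)" for i by (simp_all add: r_def)
  have mono: "strict_mono r" using q(1) by (simp add: strict_mono_Suc_iff rS)
  \<comment> \<open>At most \<open>16 * M ^ 2 / \<delta> ^ 2\<close> indices are bad, and each costs
    at most \<open>M\<close>. With this \<open>N\<close> they use up no more than half of the
    allowed total \<open>\<delta> * N\<close>.\<close>
  obtain N :: nat where N: "real N > 32 * M ^ 3 / \<delta> ^ 3" using reals_Archimedean2 by blast
  have "32 * M ^ 3 / \<delta> ^ 3 > 0" using M(1) \<open>\<delta> > 0\<close> by simp
  then have "N > 0" using N by (cases N) auto
  have main: "\<bar>\<Sum>i<N. branch_sum \<beta> (r i) x\<bar> \<le> \<delta> * N" if x: "x \<in> D" for x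
  proof -
    define s where "s i = branch_sum \<beta> i x" for i
    define J where "J = {i. i < N \<and> \<bar>s (r i)\<bar> \<ge> \<delta> / 2}"
    have finJ: "finite J" by (simp add: J_def)
    have "\<exists>k. r i \<le> k \<and> k < r (Suc i) \<and> \<bar>s k\<bar> < \<delta> / 4" for i
      using q(2)[OF x, of "r i"] by (auto simp: s_def rS)
    then obtain k where k: "\<And>i. r i \<le> k i" "\<And>i. k i < r (Suc i)" "\<And>i. \<bar>s (k i)\<bar> < \<delta> / 4"
      by metis
    \<comment> \<open>For a bad index the branch sum falls from at least \<open>\<delta> / 2\<close>
      at \<open>r i\<close> to below \<open>\<delta> / 4\<close> at \<open>k i\<close>, so the piece
      in between has sum at least \<open>\<delta> / 4\<close>. The pieces are disjoint, and their
      squares add up within the squared norm.\<close>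
    define T where "T i = zero_ext \<beta> ` {r i..<k i}" for i
    have seg: "T i \<in> segments" if "i \<in> J" for i
    proof -
      have "r i \<noteq> k i" using that k(3)[of i] \<open>\<delta> > 0\<close> by (auto simp: J_def)
      then show ?thesis unfolding T_def using zero_ext_segment[of "r i" "k i - 1" \<beta>] k(1)[of i] by simp
    qed
    have "(\<Sum>i\<in>J. (norm (restrict_jt (T i) x))\<^sup>2) \<le> (norm x)\<^sup>2"
    proof (rule sum_norm_restrict_le[OF finJ segment_tree_convex[OF seg]])
      show "disjoint_family_on T J"
        unfolding disjoint_family_on_def
      proof (intro ballI impI)
        fix i j :: nat assume "i \<noteq> j"
        have "r (Suc i) \<le> r j \<or> r (Suc j) \<le> r i"
          using \<open>i \<noteq> j\<close> strict_mono_less_eq[OF mono] by (metis Suc_leI linorder_neqE_nat)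
        then have "{r i..<k i} \<inter> {r j..<k j} = {}" using k(2)[of i] k(2)[of j] by auto
        then show "T i \<inter> T j = {}" unfolding T_def by auto
      qed
    qed
    moreover have "(\<delta> / 4)\<^sup>2 \<le> (norm (restrict_jt (T i) x))\<^sup>2" if "i \<in> J" for i
    proof -
      have "s (r i) - s (k i) = node_sum (T i) x"
        using branch_sum_split[of "r i" "k i" \<beta> x, OF k(1)] by (simp add: s_def T_def node_sum_zero_ext)
      also have "\<dots> = node_sum (T i) (restrict_jt (T i) x)"
        unfolding node_sum.rep_eq
        by (intro sum.cong refl) (simp add: jt_coeff_restrict segment_tree_convex[OF seg[OF that]])
      finally have "\<bar>s (r i) - s (k i)\<bar> \<le> norm (restrict_jt (T i) x)"
        using abs_node_sum_le[OF seg[OF that]] by simp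
      moreover have "\<bar>s (r i)\<bar> \<ge> \<delta> / 2" using that by (simp add: J_def)
      ultimately have "\<delta> / 4 \<le> norm (restrict_jt (T i) x)" using k(3)[of i] by linarith
      then show ?thesis using \<open>\<delta> > 0\<close> by (intro power_mono) auto
    qed
    then have "(\<Sum>i\<in>J. (\<delta> / 4)\<^sup>2) \<le> (\<Sum>i\<in>J. (norm (restrict_jt (T i) x))\<^sup>2)" by (intro sum_mono)
    ultimately have "card J * (\<delta> / 4)\<^sup>2 \<le> M\<^sup>2"
      using power_mono[OF M(2)[OF x], of 2] by simp
    then have cardJ: "card J * \<delta>\<^sup>2 \<le> 16 * M\<^sup>2" by (simp add: power_divide)
    have "card J * M \<le> N * \<delta> / 2"
    proof -
      have "card J * M * \<delta>\<^sup>2 \<le> 16 * M ^ 3"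
        using mult_right_mono[OF cardJ, of M] M(1) by (simp add: power3_eq_cube power2_eq_square mult_ac)
      also have "\<dots> \<le> N * \<delta> / 2 * \<delta>\<^sup>2"
        using N \<open>\<delta> > 0\<close> by (simp add: field_simps power3_eq_cube power2_eq_square)
      finally show ?thesis using \<open>\<delta> > 0\<close> by (simp add: mult_le_cancel_right)
    qed
    moreover have "\<bar>\<Sum>i<N. s (r i)\<bar> \<le> (\<Sum>i<N. \<delta> / 2 + (if i \<in> J then M else 0))"
    proof (intro order_trans[OF sum_abs sum_mono])
      fix i assume "i \<in> {..<N}"
      have "\<bar>s (r i)\<bar> \<le> M" using abs_branch_sum_le_norm[of \<beta> "r i" x] M(2)[OF x] by (simp add: s_def)
      then show "\<bar>s (r i)\<bar> \<le> \<delta> / 2 + (if i \<in> J then M else 0)"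
        using \<open>i \<in> {..<N}\<close> \<open>\<delta> > 0\<close> by (auto simp: J_def)
    qed
    moreover have "(\<Sum>i<N. \<delta> / 2 + (if i \<in> J then M else 0)) = N * \<delta> / 2 + card J * M"
    proof -
      have "J \<subseteq> {..<N}" by (auto simp: J_def)
      then have "{..<N} \<inter> J = J" by blast
      then show ?thesis by (simp add: sum.distrib sum.If_cases)
    qed
    ultimately show ?thesis by (simp add: s_def mult.commute)
  qed
  show thesis
  proof (rule that[of "r ` {..<N}" "r N"])
    show "r ` {..<N} \<noteq> {}" using \<open>N > 0\<close> by auto
    show "r ` {..<N} \<subseteq> {k0..<r N}"
      using strict_mono_less_eq[OF mono, of 0] strict_mono_less[OF mono] by (auto simp: r0)
    have inj: "inj_on r {..<N}" using strict_mono_imp_inj_on[OF mono] inj_on_subset by blast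
    show "\<forall>x\<in>D. \<bar>\<Sum>a\<in>r ` {..<N}. branch_sum \<beta> a x\<bar> \<le> \<delta> * real (card (r ` {..<N}))"
      using main by (simp add: sum.reindex[OF inj] card_image[OF inj])
  qed simp
qed

section \<open>The averaging operators\<close>

text \<open>If the numbers of appended zeros differed, the longer of the two roots would end in
  0.\<close>

lemma branch_root_unique:
  assumes "zero_ext \<beta> i = zero_ext \<beta>' i'" "\<beta> \<in> branch_roots n" "\<beta>' \<in> branch_roots n'"
  shows "\<beta> = \<beta>'"
proof -
  have *: "\<beta> = \<beta>'" if eq: "zero_ext \<beta> i = zero_ext \<beta>' i'" and le: "i \<le> i'" and root: "\<beta> \<in> branch_roots n"
    for \<beta> \<beta>' i i' n
  proof -
    have "zero_ext \<beta>' i' = zero_ext \<beta>' (i' - i) @ replicate i False"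
      using zero_ext_add[of \<beta>' "i' - i" i] le by simp
    then have b: "\<beta> = zero_ext \<beta>' (i' - i)" using eq by (simp add: zero_ext_def)
    show ?thesis
    proof (cases "i' - i")
      case 0
      then show ?thesis using b by simp
    next
      case (Suc k)
      then have "\<beta> = zero_ext \<beta>' k @ [False]" using b zero_ext_add[of \<beta>' k 1] by simp
      then show ?thesis using root by (simp add: branch_roots_def)
    qed
  qed
  show ?thesis
    using *[of \<beta> i \<beta>' i' n] *[of \<beta>' i' \<beta> i n'] assms by (cases "i \<le> i'") auto
qed

lemma branch_root_exists:
  assumes "\<gamma> \<in> nodes_few_ones n"
  obtains \<beta> i where "\<beta> \<in> branch_roots n" "\<gamma> = zero_ext \<beta> i"
proof -
  have "\<exists>\<beta> i. \<gamma> = zero_ext \<beta> i \<and> (\<beta> = [] \<or> last \<beta>)"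
  proof (induction \<gamma> rule: rev_induct)
    case Nil
    show ?case by (rule exI[of _ "[]"], rule exI[of _ 0]) simp
  next
    case (snoc b \<gamma>)
    then obtain \<beta> i where \<beta>: "\<gamma> = zero_ext \<beta> i" "\<beta> = [] \<or> last \<beta>" by blast
    show ?case
    proof (cases b)
      case True
      then show ?thesis by (intro exI[of _ "\<gamma> @ [True]"] exI[of _ 0]) simp
    next
      case False
      then show ?thesis using \<beta> zero_ext_add[of \<beta> i 1] by (intro exI[of _ \<beta>] exI[of _ "Suc i"]) simp
    qed
  qed
  then obtain \<beta> i where \<beta>: "\<gamma> = zero_ext \<beta> i" "\<beta> = [] \<or> last \<beta>" by blast
  then have "\<beta> \<in> branch_roots n"
    using assms by (simp add: branch_roots_def nodes_few_ones_def count_list_zero_ext)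
  with \<beta> show thesis using that by blast
qed

lemma zero_ext_in_nodes_few_ones: "\<beta> \<in> branch_roots n \<Longrightarrow> zero_ext \<beta> i \<in> nodes_few_ones n"
  by (simp add: branch_roots_def nodes_few_ones_def count_list_zero_ext)

lemma restrict_jt_finite:
  assumes "finite T" "tree_convex T"
  shows "restrict_jt T x = (\<Sum>\<gamma>\<in>T. jt_coeff x \<gamma> *\<^sub>R node_vector \<gamma>)"
proof (rule jt_eqI)
  fix \<alpha>
  have "(\<Sum>\<gamma>\<in>T. jt_coeff x \<gamma> * jt_coeff (node_vector \<gamma>) \<alpha>) = (\<Sum>\<gamma>\<in>T. if \<gamma> = \<alpha> then jt_coeff x \<gamma> else 0)"
    by (intro sum.cong refl) (auto simp: jt_coeff_node_vector)
  then show "jt_coeff (restrict_jt T x) \<alpha> = jt_coeff (\<Sum>\<gamma>\<in>T. jt_coeff x \<gamma> *\<^sub>R node_vector \<gamma>) \<alpha>"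
    using assms by (simp add: jt_coeff_restrict)
qed

text \<open>On the branch of zeros above a root \<open>\<beta>\<close>, the block \<open>j\<close> consists of the positions in
  \<open>{M \<beta> j..<M \<beta> (Suc j)}\<close> and is marked by its last node. The operator sends a node to its
  difference with a convex combination of the mark of its block and the previous mark, so that the
  sum of the blocks subtracts from \<open>x\<close> the differences of consecutive averages
  over \<open>A \<beta> j\<close> of branch sums, placed at the marks.\<close>

locale averaging_scheme =
  fixes n :: nat and M :: "node \<Rightarrow> nat \<Rightarrow> nat" and A :: "node \<Rightarrow> nat \<Rightarrow> nat set"
  assumes M_0: "M \<beta> 0 = 0"
    and A_nonempty: "A \<beta> j \<noteq> {}"
    and A_subset: "A \<beta> j \<subseteq> {M \<beta> j..<M \<beta> (Suc j)}"
begin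

lemma M_less: "M \<beta> j < M \<beta> (Suc j)"
  using A_nonempty[of \<beta> j] A_subset[of \<beta> j] by force

lemma M_strict_mono: "strict_mono (M \<beta>)"
  using M_less by (simp add: strict_mono_Suc_iff)

lemma finite_A: "finite (A \<beta> j)"
  using A_subset finite_subset by blast

lemma card_A_pos: "card (A \<beta> j) > 0"
  using finite_A A_nonempty by (simp add: card_gt_0_iff)

definition block :: "node \<Rightarrow> nat \<Rightarrow> node set" where
  "block \<beta> j = zero_ext \<beta> ` {M \<beta> j..<M \<beta> (Suc j)}"

definition last_pos :: "node \<Rightarrow> nat \<Rightarrow> nat" where
  "last_pos \<beta> j = M \<beta> (Suc j) - 1"

definition mark :: "node \<Rightarrow> nat \<Rightarrow> node" where
  "mark \<beta> j = zero_ext \<beta> (last_pos \<beta> j)"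

definition prev_mark :: "node \<Rightarrow> nat \<Rightarrow> jt" where
  "prev_mark \<beta> j = (if j = 0 then 0 else node_vector (mark \<beta> (j - 1)))"

text \<open>The fraction of averaging positions already passed at the node. It makes
  \<open>tau\<close> the mean, over these positions, of the sums from there to the end of the
  block.\<close>

definition weight :: "node \<Rightarrow> nat \<Rightarrow> node \<Rightarrow> real" where
  "weight \<beta> j \<gamma> = real (card {a \<in> A \<beta> j. length \<beta> + a \<le> length \<gamma>}) / real (card (A \<beta> j))"

text \<open>For \<open>j > 0\<close> the coefficients add up to 0, so a segment through the node and
  both marks does not see this vector. For \<open>j = 0\<close> there is no previous mark to balance
  it.\<close>

definition block_vec :: "node \<Rightarrow> nat \<Rightarrow> node \<Rightarrow> jt" where
  "block_vec \<beta> j \<gamma> = node_vector \<gamma> - weight \<beta> j \<gamma> *\<^sub>R node_vector (mark \<beta> j)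
     - (1 - weight \<beta> j \<gamma>) *\<^sub>R prev_mark \<beta> j"

definition block_op :: "node \<Rightarrow> nat \<Rightarrow> jt \<Rightarrow> jt" where
  "block_op \<beta> j = finite_rank_op (block \<beta> j) (block_vec \<beta> j)"

definition tau :: "node \<Rightarrow> nat \<Rightarrow> jt \<Rightarrow> real" where
  "tau \<beta> j x = (\<Sum>\<gamma>\<in>block \<beta> j. weight \<beta> j \<gamma> * jt_coeff x \<gamma>)"

definition rho :: "node \<Rightarrow> nat \<Rightarrow> jt \<Rightarrow> real" where
  "rho \<beta> j x = (\<Sum>\<gamma>\<in>block \<beta> j. jt_coeff x \<gamma>) - tau \<beta> j x"

definition average :: "node \<Rightarrow> nat \<Rightarrow> jt \<Rightarrow> real" where
  "average \<beta> j x = (\<Sum>a\<in>A \<beta> j. branch_sum \<beta> a x) / real (card (A \<beta> j))"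

section \<open>Positions, blocks and marks\<close>

lemma finite_block: "finite (block \<beta> j)"
  by (simp add: block_def)

lemma block_segment: "block \<beta> j \<in> segments"
  using zero_ext_segment[of "M \<beta> j" "M \<beta> (Suc j) - 1" \<beta>] M_less[of \<beta> j] by (simp add: block_def)

lemma block_tree_convex: "tree_convex (block \<beta> j)"
  by (rule segment_tree_convex[OF block_segment])

lemma last_pos_bounds: "M \<beta> j \<le> last_pos \<beta> j" "last_pos \<beta> j < M \<beta> (Suc j)"
  using M_less[of \<beta> j] by (auto simp: last_pos_def)

lemma last_pos_mono: "j < k \<Longrightarrow> last_pos \<beta> j < M \<beta> k"
  using last_pos_bounds(2)[of \<beta> j] strict_mono_less_eq[OF M_strict_mono, of \<beta> "Suc j" k] by simp

lemma block_index_unique: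
  assumes "M \<beta> j \<le> i" "i < M \<beta> (Suc j)" "M \<beta> k \<le> i" "i < M \<beta> (Suc k)"
  shows "j = k"
proof (rule ccontr)
  assume "j \<noteq> k"
  then have "Suc j \<le> k \<or> Suc k \<le> j" by linarith
  then have "M \<beta> (Suc j) \<le> M \<beta> k \<or> M \<beta> (Suc k) \<le> M \<beta> j"
    using strict_mono_less_eq[OF M_strict_mono, of \<beta>] by blast
  with assms show False by linarith
qed

lemma block_index_exists: "\<exists>j. M \<beta> j \<le> i \<and> i < M \<beta> (Suc j)"
proof -
  have ex: "\<exists>j. i < M \<beta> (Suc j)"
    using strict_mono_imp_increasing[OF M_strict_mono, of "Suc i" \<beta>] by (intro exI[of _ i]) simp
  define j where "j = (LEAST j. i < M \<beta> (Suc j))"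
  have 1: "i < M \<beta> (Suc j)" unfolding j_def by (rule LeastI_ex[OF ex])
  have "M \<beta> j \<le> i"
  proof (cases j)
    case (Suc k)
    then have "\<not> i < M \<beta> (Suc k)" using not_less_Least[of k "\<lambda>j. i < M \<beta> (Suc j)"] by (simp add: j_def)
    with Suc show ?thesis by simp
  qed (simp add: M_0)
  with 1 show ?thesis by blast
qed

lemma zero_ext_in_block_iff:
  assumes "\<beta> \<in> branch_roots n" "\<beta>' \<in> branch_roots n"
  shows "zero_ext \<beta> i \<in> block \<beta>' j \<longleftrightarrow> \<beta> = \<beta>' \<and> M \<beta> j \<le> i \<and> i < M \<beta> (Suc j)"
proof (cases "\<beta> = \<beta>'")
  case True
  then show ?thesis by (auto simp: block_def)
next
  case False
  then have "zero_ext \<beta> i \<noteq> zero_ext \<beta>' k" for k using branch_root_unique[OF _ assms] by blast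
  with False show ?thesis by (auto simp: block_def)
qed

lemma zero_ext_eq_mark_iff:
  assumes "\<beta> \<in> branch_roots n" "\<beta>' \<in> branch_roots n"
  shows "zero_ext \<beta> i = mark \<beta>' j \<longleftrightarrow> \<beta> = \<beta>' \<and> i = last_pos \<beta> j"
proof (cases "\<beta> = \<beta>'")
  case False
  then have "zero_ext \<beta> i \<noteq> zero_ext \<beta>' k" for k using branch_root_unique[OF _ assms] by blast
  with False show ?thesis by (simp add: mark_def)
qed (simp add: mark_def)

text \<open>The weight counts averaging positions, so exchanging the two sums gives one final piece
  of the block per position.\<close>

lemma tau_sum:
  "real (card (A \<beta> j)) * tau \<beta> j x = (\<Sum>a\<in>A \<beta> j. node_sum (zero_ext \<beta> ` {a..<M \<beta> (Suc j)}) x)"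
proof -
  let ?B = "{M \<beta> j..<M \<beta> (Suc j)}"
  have "real (card (A \<beta> j)) * tau \<beta> j x = (\<Sum>\<gamma>\<in>block \<beta> j. real (card (A \<beta> j)) * (weight \<beta> j \<gamma> * jt_coeff x \<gamma>))"
    by (simp add: tau_def sum_distrib_left)
  also have "\<dots> = (\<Sum>i\<in>?B. real (card (A \<beta> j)) * (weight \<beta> j (zero_ext \<beta> i) * jt_coeff x (zero_ext \<beta> i)))"
    unfolding block_def by (simp add: sum.reindex inj_zero_ext)
  also have "\<dots> = (\<Sum>i\<in>?B. real (card {a \<in> A \<beta> j. a \<le> i}) * jt_coeff x (zero_ext \<beta> i))"
    using card_A_pos[of \<beta> j] by (intro sum.cong refl) (simp add: weight_def)
  also have "\<dots> = (\<Sum>i\<in>?B. \<Sum>a\<in>A \<beta> j. if a \<le> i then jt_coeff x (zero_ext \<beta> i) else 0)"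
  proof (intro sum.cong refl)
    fix i
    have "A \<beta> j \<inter> {a. a \<le> i} = {a \<in> A \<beta> j. a \<le> i}" by blast
    then show "real (card {a \<in> A \<beta> j. a \<le> i}) * jt_coeff x (zero_ext \<beta> i) =
        (\<Sum>a\<in>A \<beta> j. if a \<le> i then jt_coeff x (zero_ext \<beta> i) else 0)"
      using finite_A by (simp add: sum.If_cases)
  qed
  also have "\<dots> = (\<Sum>a\<in>A \<beta> j. \<Sum>i\<in>?B. if a \<le> i then jt_coeff x (zero_ext \<beta> i) else 0)"
    by (rule sum.swap)
  also have "\<dots> = (\<Sum>a\<in>A \<beta> j. node_sum (zero_ext \<beta> ` {a..<M \<beta> (Suc j)}) x)"
  proof (intro sum.cong refl)
    fix a assume "a \<in> A \<beta> j"
    then have "?B \<inter> {i. a \<le> i} = {a..<M \<beta> (Suc j)}" using A_subset[of \<beta> j] by auto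
    then show "(\<Sum>i\<in>?B. if a \<le> i then jt_coeff x (zero_ext \<beta> i) else 0) =
        node_sum (zero_ext \<beta> ` {a..<M \<beta> (Suc j)}) x"
      by (simp add: sum.If_cases node_sum_zero_ext)
  qed
  finally show ?thesis .
qed

lemma tau_average: "tau \<beta> j x = average \<beta> j x - branch_sum \<beta> (M \<beta> (Suc j)) x"
proof -
  have "node_sum (zero_ext \<beta> ` {a..<M \<beta> (Suc j)}) x = branch_sum \<beta> a x - branch_sum \<beta> (M \<beta> (Suc j)) x"
    if "a \<in> A \<beta> j" for a
    using branch_sum_split[of a "M \<beta> (Suc j)" \<beta> x] A_subset[of \<beta> j] that by (force simp: node_sum_zero_ext)
  then have "real (card (A \<beta> j)) * tau \<beta> j x =
      (\<Sum>a\<in>A \<beta> j. branch_sum \<beta> a x) - real (card (A \<beta> j)) * branch_sum \<beta> (M \<beta> (Suc j)) x"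
    by (simp add: tau_sum sum_subtractf)
  then show ?thesis using card_A_pos[of \<beta> j] by (simp add: average_def field_simps)
qed

text \<open>A mark receives \<open>tau\<close> from its own block and \<open>rho\<close> from the
  next one. The branch sums at the common boundary cancel and only averages remain, which is why the
  correction can be kept small.\<close>

lemma tau_rho: "tau \<beta> j x + rho \<beta> (Suc j) x = average \<beta> j x - average \<beta> (Suc j) x"
proof -
  have "(\<Sum>\<gamma>\<in>block \<beta> (Suc j). jt_coeff x \<gamma>) =
      branch_sum \<beta> (M \<beta> (Suc j)) x - branch_sum \<beta> (M \<beta> (Suc (Suc j))) x"
    using branch_sum_split[of "M \<beta> (Suc j)" "M \<beta> (Suc (Suc j))" \<beta> x] M_less[of \<beta> "Suc j"]
    by (simp add: block_def sum.reindex inj_zero_ext)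
  then show ?thesis by (simp add: rho_def tau_average)
qed

lemma block_op_eq:
  "block_op \<beta> j x = restrict_jt (block \<beta> j) x - tau \<beta> j x *\<^sub>R node_vector (mark \<beta> j)
     - rho \<beta> j x *\<^sub>R prev_mark \<beta> j"
proof -
  have "block_op \<beta> j x = (\<Sum>\<gamma>\<in>block \<beta> j. jt_coeff x \<gamma> *\<^sub>R node_vector \<gamma>
      - (weight \<beta> j \<gamma> * jt_coeff x \<gamma>) *\<^sub>R node_vector (mark \<beta> j)
      - (jt_coeff x \<gamma> - weight \<beta> j \<gamma> * jt_coeff x \<gamma>) *\<^sub>R prev_mark \<beta> j)"
    unfolding block_op_def finite_rank_op_def block_vec_def
    by (intro sum.cong refl) (simp add: algebra_simps)
  also have "\<dots> = (\<Sum>\<gamma>\<in>block \<beta> j. jt_coeff x \<gamma> *\<^sub>R node_vector \<gamma>)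
      - tau \<beta> j x *\<^sub>R node_vector (mark \<beta> j) - rho \<beta> j x *\<^sub>R prev_mark \<beta> j"
    by (simp only: sum_subtractf scaleR_sum_left[symmetric] tau_def rho_def)
  finally show ?thesis by (simp add: restrict_jt_finite[OF finite_block block_tree_convex])
qed

text \<open>The block itself contributes 1, \<open>tau\<close> as a mean of segment sums 1, and
  \<open>rho\<close> as a segment sum minus \<open>tau\<close> 2.\<close>

lemma norm_block_op_le: "norm (block_op \<beta> j x) \<le> 4 * norm (restrict_jt (block \<beta> j) x)"
proof -
  define y where "y = restrict_jt (block \<beta> j) x"
  have sum_y: "node_sum S x = node_sum S y" if "S \<subseteq> block \<beta> j" for S
    unfolding node_sum.rep_eq y_def
    by (intro sum.cong refl) (use that in \<open>auto simp: jt_coeff_restrict block_tree_convex\<close>)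
  have "\<bar>node_sum (zero_ext \<beta> ` {a..<M \<beta> (Suc j)}) x\<bar> \<le> norm y" if "a \<in> A \<beta> j" for a
  proof -
    have "node_sum (zero_ext \<beta> ` {a..<M \<beta> (Suc j)}) x = node_sum (zero_ext \<beta> ` {a..<M \<beta> (Suc j)}) y"
      using A_subset[of \<beta> j] that by (intro sum_y) (auto simp: block_def)
    moreover have "zero_ext \<beta> ` {a..<M \<beta> (Suc j)} \<noteq> {}" using A_subset[of \<beta> j] that by auto
    ultimately show ?thesis
      using abs_node_sum_le zero_ext_interval_cases[of \<beta> a "M \<beta> (Suc j)"] by metis
  qed
  then have "\<bar>real (card (A \<beta> j)) * tau \<beta> j x\<bar> \<le> (\<Sum>a\<in>A \<beta> j. norm y)"
    unfolding tau_sum by (intro order_trans[OF sum_abs sum_mono])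
  then have "real (card (A \<beta> j)) * \<bar>tau \<beta> j x\<bar> \<le> real (card (A \<beta> j)) * norm y" by (simp add: abs_mult)
  then have tau: "\<bar>tau \<beta> j x\<bar> \<le> norm y" using card_A_pos[of \<beta> j] by (simp add: mult_le_cancel_left)
  have "\<bar>node_sum (block \<beta> j) x\<bar> \<le> norm y"
    using sum_y[of "block \<beta> j"] abs_node_sum_le[OF block_segment, of \<beta> j y] by simp
  then have rho: "\<bar>rho \<beta> j x\<bar> \<le> 2 * norm y"
    using tau unfolding rho_def node_sum.rep_eq by linarith
  have "norm (tau \<beta> j x *\<^sub>R node_vector (mark \<beta> j)) \<le> norm y * 1"
    unfolding norm_scaleR by (intro mult_mono norm_node_vector_le tau) auto
  moreover have "norm (rho \<beta> j x *\<^sub>R prev_mark \<beta> j) \<le> (2 * norm y) * 1"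
    unfolding norm_scaleR by (intro mult_mono rho) (auto simp: prev_mark_def norm_node_vector_le)
  moreover have "norm (block_op \<beta> j x) \<le> norm y + norm (tau \<beta> j x *\<^sub>R node_vector (mark \<beta> j))
      + norm (rho \<beta> j x *\<^sub>R prev_mark \<beta> j)"
    unfolding block_op_eq y_def[symmetric]
    using norm_triangle_ineq4[of "y - tau \<beta> j x *\<^sub>R node_vector (mark \<beta> j)" "rho \<beta> j x *\<^sub>R prev_mark \<beta> j"]
      norm_triangle_ineq4[of y "tau \<beta> j x *\<^sub>R node_vector (mark \<beta> j)"] by linarith
  ultimately show ?thesis by (simp add: y_def)
qed

lemma jt_coeff_block_op:
  "jt_coeff (block_op \<beta> j x) \<gamma> = (if \<gamma> \<in> block \<beta> j then jt_coeff x \<gamma> else 0)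
     - (if \<gamma> = mark \<beta> j then tau \<beta> j x else 0)
     - (if 0 < j \<and> \<gamma> = mark \<beta> (j - 1) then rho \<beta> j x else 0)"
  by (simp add: block_op_eq jt_coeff_restrict[OF block_tree_convex] prev_mark_def jt_coeff_node_vector)

text \<open>For \<open>j > 0\<close> the segment must cut the stretch from the previous mark to the
  mark of block \<open>j\<close>, because by cancellation a stretch inside or outside it gives 0. A
  segment meets the branch in an interval with two ends, so two such blocks are possible; block 0
  may be a third.\<close>

lemma card_blocks_cut_by_segment:
  assumes S: "S \<in> segments" and fin: "finite J"
    and cut: "\<And>j. j \<in> J \<Longrightarrow> \<exists>\<gamma>\<in>block \<beta> j. sum (jt_coeff (block_vec \<beta> j \<gamma>)) S \<noteq> 0"
  shows "card J \<le> 3"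
proof -
  have sum_S: "sum (jt_coeff (block_vec \<beta> j \<gamma>)) S = (if \<gamma> \<in> S then 1 else 0)
      - weight \<beta> j \<gamma> * (if mark \<beta> j \<in> S then 1 else 0)
      - (1 - weight \<beta> j \<gamma>) * (if 0 < j \<and> mark \<beta> (j - 1) \<in> S then 1 else 0)" for j \<gamma>
    using finite_segment[OF S]
    by (simp add: block_vec_def prev_mark_def jt_coeff_node_vector sum_subtractf flip: sum_distrib_left)
  let ?I = "\<lambda>j. {last_pos \<beta> (j - 1)..last_pos \<beta> j}"
  have in_S: "(\<exists>i\<in>?I j. zero_ext \<beta> i \<in> S) \<and> (\<exists>i\<in>?I j. zero_ext \<beta> i \<notin> S)" if j: "j \<in> J - {0}" for j
  proof -
    obtain \<gamma> where \<gamma>: "\<gamma> \<in> block \<beta> j" "sum (jt_coeff (block_vec \<beta> j \<gamma>)) S \<noteq> 0" using cut j by blast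
    obtain i where i: "M \<beta> j \<le> i" "i < M \<beta> (Suc j)" "\<gamma> = zero_ext \<beta> i" using \<gamma>(1) by (auto simp: block_def)
    have "last_pos \<beta> (j - 1) < M \<beta> j" using j by (intro last_pos_mono) auto
    then have "i \<in> ?I j" "last_pos \<beta> (j - 1) \<in> ?I j" "last_pos \<beta> j \<in> ?I j"
      using i(1,2) last_pos_bounds(1)[of \<beta> j] by (auto simp: last_pos_def)
    then show ?thesis
      using \<gamma>(2) sum_S[of j \<gamma>] j by (auto simp: i(3) mark_def split: if_splits)
  qed
  have "card (J - {0}) \<le> 2"
  proof (rule card_le_2_if_no_three)
    fix a b c assume abc: "a \<in> J - {0}" "b \<in> J - {0}" "c \<in> J - {0}" "a < b" "b < c"
    obtain i where i: "i \<in> ?I a" "zero_ext \<beta> i \<in> S" using in_S[OF abc(1)] by blast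
    obtain k where k: "k \<in> ?I c" "zero_ext \<beta> k \<in> S" using in_S[OF abc(3)] by blast
    obtain l where l: "l \<in> ?I b" "zero_ext \<beta> l \<notin> S" using in_S[OF abc(2)] by blast
    have mono: "last_pos \<beta> p \<le> last_pos \<beta> q" if "p \<le> q" for p q
      using strict_mono_less_eq[OF M_strict_mono, of \<beta> "Suc p" "Suc q"] that by (simp add: last_pos_def)
    have "a \<le> b - 1" "b \<le> c - 1" using abc(4,5) by simp_all
    from this[THEN mono] have "i \<le> l" "l \<le> k" using i(1) k(1) l(1) by simp_all
    then have "zero_ext \<beta> l \<in> S"
      using tree_convexD[OF segment_tree_convex[OF S] i(2) k(2)] by simp
    with l(2) show False by simp
  qed (use fin in simp)
  moreover have "card J \<le> card (insert 0 (J - {0}))" using fin by (intro card_mono) auto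
  moreover have "card (insert 0 (J - {0})) \<le> Suc (card (J - {0}))" by (rule card_insert_le_m1) auto
  ultimately show ?thesis by linarith
qed

text \<open>The pairs of a root and a block number are enumerated by their codes; a natural number that
  codes no such pair gets the empty block.\<close>

definition is_code :: "nat \<Rightarrow> bool" where
  "is_code k \<longleftrightarrow> (\<exists>\<beta> j. \<beta> \<in> branch_roots n \<and> k = to_nat (\<beta>, j :: nat))"

definition code_block :: "nat \<Rightarrow> node set" where
  "code_block k = (if is_code k then case_prod block (from_nat k) else {})"

definition code_vec :: "nat \<Rightarrow> node \<Rightarrow> jt" where
  "code_vec k = case_prod block_vec (from_nat k)"

definition code_op :: "nat \<Rightarrow> jt \<Rightarrow> jt" where
  "code_op k = finite_rank_op (code_block k) (code_vec k)"

lemma is_code_to_nat: "is_code (to_nat (\<beta>, j :: nat)) \<longleftrightarrow> \<beta> \<in> branch_roots n"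
  by (auto simp: is_code_def)

lemma code_block_to_nat: "\<beta> \<in> branch_roots n \<Longrightarrow> code_block (to_nat (\<beta>, j)) = block \<beta> j"
  by (simp add: code_block_def is_code_to_nat)

lemma code_op_to_nat: "\<beta> \<in> branch_roots n \<Longrightarrow> code_op (to_nat (\<beta>, j)) = block_op \<beta> j"
  by (simp add: code_op_def code_block_to_nat code_vec_def block_op_def)

lemma code_op_not_code: "\<not> is_code k \<Longrightarrow> code_op k x = 0"
  by (simp add: code_op_def code_block_def finite_rank_op_def)

lemma is_codeE:
  assumes "is_code k"
  obtains \<beta> j where "\<beta> \<in> branch_roots n" "k = to_nat (\<beta>, j :: nat)"
  using assms by (auto simp: is_code_def)

text \<open>A segment meets the branches of at most \<open>n + 1\<close> roots and cuts at most 3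
  blocks on each. Being cut is a property of the block vectors alone, so the arguments
  \<open>X k\<close> may differ from block to block, as the duality argument for the sum
  requires.\<close>

lemma code_op_upper:
  assumes G: "finite G"
  shows "(norm (\<Sum>k\<in>G. code_op k (X k)))\<^sup>2 \<le> real (3 * (n + 1)) * (\<Sum>k\<in>G. (norm (code_op k (X k)))\<^sup>2)"
proof (rule norm_sum_le_multiplicity[OF G])
  fix S assume S: "S \<in> segments"
  then obtain \<alpha> \<gamma> where S': "S = {\<beta>. prefix \<alpha> \<beta> \<and> prefix \<beta> \<gamma>}" by (auto simp: segments_def)
  define B where "B = {\<beta> \<in> branch_roots n. prefix \<beta> \<gamma>}"
  have finB: "finite B"
    using finite_prefixes[of \<gamma> "\<lambda>\<beta>. \<beta> \<in> branch_roots n"] by (simp add: B_def conj_commute)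
  define J where "J \<beta> = {j. to_nat (\<beta>, j) \<in> G \<and>
      (\<exists>\<delta>\<in>block \<beta> j. sum (jt_coeff (block_vec \<beta> j \<delta>)) S \<noteq> 0)}" for \<beta>
  have finJ: "finite (J \<beta>)" for \<beta>
  proof (rule finite_subset)
    show "J \<beta> \<subseteq> (\<lambda>j. to_nat (\<beta>, j :: nat)) -` G" by (auto simp: J_def)
    show "finite ((\<lambda>j. to_nat (\<beta>, j :: nat)) -` G)"
      by (rule finite_vimageI[OF G]) (auto intro: injI)
  qed
  have "{k \<in> G. sum (jt_coeff (code_op k (X k))) S \<noteq> 0} \<subseteq> to_nat ` Sigma B J"
  proof
    fix k assume "k \<in> {k \<in> G. sum (jt_coeff (code_op k (X k))) S \<noteq> 0}"
    then have k: "k \<in> G" "sum (jt_coeff (code_op k (X k))) S \<noteq> 0" by auto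
    then have "is_code k" using code_op_not_code[of k "X k"] by force
    then obtain \<beta> j where \<beta>: "\<beta> \<in> branch_roots n" "k = to_nat (\<beta>, j :: nat)" by (rule is_codeE)
    have "sum (jt_coeff (block_op \<beta> j (X k))) S =
        (\<Sum>\<delta>\<in>block \<beta> j. jt_coeff (X k) \<delta> * sum (jt_coeff (block_vec \<beta> j \<delta>)) S)"
      unfolding block_op_def finite_rank_op_def
      by (simp add: sum_distrib_left) (rule sum.swap)
    then have "(\<Sum>\<delta>\<in>block \<beta> j. jt_coeff (X k) \<delta> * sum (jt_coeff (block_vec \<beta> j \<delta>)) S) \<noteq> 0"
      using k(2) \<beta> by (simp add: code_op_to_nat)
    then obtain \<delta> where \<delta>: "\<delta> \<in> block \<beta> j" "sum (jt_coeff (block_vec \<beta> j \<delta>)) S \<noteq> 0"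
      by (metis (no_types, lifting) mult_eq_0_iff sum.neutral)
    have "\<exists>i. zero_ext \<beta> i \<in> S"
    proof (rule ccontr)
      assume none: "\<not> ?thesis"
      have "jt_coeff (block_vec \<beta> j \<delta>) \<alpha> = 0" if "\<alpha> \<in> S" for \<alpha>
      proof -
        have "\<alpha> \<noteq> \<delta>" "\<alpha> \<noteq> mark \<beta> j" "\<alpha> \<noteq> mark \<beta> (j - 1)"
          using none that \<delta>(1) by (auto simp: block_def mark_def)
        then show ?thesis by (simp add: block_vec_def prev_mark_def jt_coeff_node_vector)
      qed
      then have "sum (jt_coeff (block_vec \<beta> j \<delta>)) S = 0" by (rule sum.neutral[rule_format])
      with \<delta>(2) show False by simp
    qed
    then obtain i where "prefix (zero_ext \<beta> i) \<gamma>" using S' by blast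
    then have "prefix \<beta> \<gamma>" unfolding zero_ext_def by (rule append_prefixD)
    then have "(\<beta>, j) \<in> Sigma B J" using \<beta> k(1) \<delta> by (auto simp: B_def J_def)
    then show "k \<in> to_nat ` Sigma B J" using \<beta>(2) by blast
  qed
  moreover have "finite (Sigma B J)" using finB finJ by (rule finite_SigmaI)
  ultimately have "card {k \<in> G. sum (jt_coeff (code_op k (X k))) S \<noteq> 0} \<le> card (Sigma B J)"
    by (meson card_image_le card_mono finite_imageI order_trans)
  also have "\<dots> = (\<Sum>\<beta>\<in>B. card (J \<beta>))" using finB finJ by (simp add: card_SigmaI)
  also have "\<dots> \<le> (\<Sum>\<beta>\<in>B. 3)"
    by (intro sum_mono card_blocks_cut_by_segment[OF S finJ]) (auto simp: J_def)
  also have "\<dots> \<le> 3 * (n + 1)" using card_branch_roots_below[of n \<gamma>] by (simp add: B_def)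
  finally show "card {k \<in> G. sum (jt_coeff (code_op k (X k))) S \<noteq> 0} \<le> 3 * (n + 1)" .
qed

text \<open>Distinct codes have disjoint blocks, so the restrictions of \<open>x\<close> add up
  within its squared norm; 16 is the square of the constant for a single block.\<close>

lemma code_op_lower:
  assumes G: "finite G"
  shows "(\<Sum>k\<in>G. (norm (code_op k x))\<^sup>2) \<le> 16 * (norm x)\<^sup>2"
proof -
  have conv: "tree_convex (code_block k)" for k
  proof (cases "is_code k")
    case True
    then show ?thesis by (auto simp: code_block_def block_tree_convex split: prod.split)
  qed (simp add: code_block_def tree_convex_def)
  have "(norm (code_op k x))\<^sup>2 \<le> 16 * (norm (restrict_jt (code_block k) x))\<^sup>2" for k
  proof (cases "is_code k")
    case True
    then obtain \<beta> j where \<beta>: "\<beta> \<in> branch_roots n" "k = to_nat (\<beta>, j :: nat)" by (rule is_codeE)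
    have "norm (code_op k x) \<le> 4 * norm (restrict_jt (code_block k) x)"
      using norm_block_op_le[of \<beta> j x] \<beta> by (simp add: code_op_to_nat code_block_to_nat)
    from power_mono[OF this, of 2] show ?thesis by (simp add: power_mult_distrib)
  qed (simp add: code_op_not_code)
  then have "(\<Sum>k\<in>G. (norm (code_op k x))\<^sup>2) \<le> 16 * (\<Sum>k\<in>G. (norm (restrict_jt (code_block k) x))\<^sup>2)"
    unfolding sum_distrib_left by (intro sum_mono)
  also have "(\<Sum>k\<in>G. (norm (restrict_jt (code_block k) x))\<^sup>2) \<le> (norm x)\<^sup>2"
  proof (rule sum_norm_restrict_le[OF G conv])
    show "disjoint_family_on code_block G"
      unfolding disjoint_family_on_def
    proof (intro ballI impI equals0I)
      fix k l \<gamma> assume kl: "k \<noteq> l" "\<gamma> \<in> code_block k \<inter> code_block l"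
      then have "is_code k" "is_code l" by (auto simp: code_block_def split: if_splits)
      then obtain \<beta> j \<beta>' j' where \<beta>: "\<beta> \<in> branch_roots n" "k = to_nat (\<beta>, j :: nat)"
          "\<beta>' \<in> branch_roots n" "l = to_nat (\<beta>', j' :: nat)" by (metis is_codeE)
      then have \<gamma>: "\<gamma> \<in> block \<beta> j" "\<gamma> \<in> block \<beta>' j'" using kl(2) by (auto simp: code_block_to_nat)
      then obtain i where i: "\<gamma> = zero_ext \<beta> i" by (auto simp: block_def)
      then have "\<beta> = \<beta>'" "j = j'"
        using \<gamma> zero_ext_in_block_iff[OF \<beta>(1)] \<beta>(1,3) block_index_unique[of \<beta> j i j'] by auto
      with kl(1) \<beta> show False by simp
    qed
  qed
  finally show ?thesis by simp
qed

text \<open>The node lies in one block only and can only be the mark of that block, which the next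
  block uses as previous mark. So at most two codes contribute to its coefficient.\<close>

lemma code_op_coeff_zero_ext:
  assumes \<beta>: "\<beta> \<in> branch_roots n" and j: "M \<beta> j \<le> i" "i < M \<beta> (Suc j)"
  shows "(\<lambda>k. jt_coeff (code_op k x) (zero_ext \<beta> i)) sums
    (jt_coeff x (zero_ext \<beta> i) - (if i = last_pos \<beta> j then average \<beta> j x - average \<beta> (Suc j) x else 0))"
proof -
  let ?c = "\<lambda>k. jt_coeff (code_op k x) (zero_ext \<beta> i)"
  have coeff: "jt_coeff (block_op \<beta>' j' x) (zero_ext \<beta> i) =
      (if \<beta> = \<beta>' \<and> j' = j then jt_coeff x (zero_ext \<beta> i) - (if i = last_pos \<beta> j then tau \<beta> j x else 0)
       else if \<beta> = \<beta>' \<and> j' = Suc j then - (if i = last_pos \<beta> j then rho \<beta> (Suc j) x else 0) else 0)"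
    if "\<beta>' \<in> branch_roots n" for \<beta>' j'
  proof -
    have in_block: "zero_ext \<beta> i \<in> block \<beta>' j' \<longleftrightarrow> \<beta> = \<beta>' \<and> j' = j"
      using zero_ext_in_block_iff[OF \<beta> that] block_index_unique[of \<beta> j i j'] j by auto
    have at_mark: "zero_ext \<beta> i = mark \<beta>' k \<longleftrightarrow> \<beta> = \<beta>' \<and> k = j \<and> i = last_pos \<beta> j" for k
      using zero_ext_eq_mark_iff[OF \<beta> that] block_index_unique[of \<beta> j i k] j last_pos_bounds[of \<beta> k] by auto
    have prev: "(0 < j' \<and> \<beta> = \<beta>' \<and> j' - 1 = j \<and> i = last_pos \<beta> j) \<longleftrightarrow>
        (\<beta> = \<beta>' \<and> j' = Suc j \<and> i = last_pos \<beta> j)" by auto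
    show ?thesis
      unfolding jt_coeff_block_op in_block at_mark prev
      by (cases "\<beta> = \<beta>'"; cases "j' = j"; cases "j' = Suc j") simp_all
  qed
  have "?c sums (\<Sum>k\<in>{to_nat (\<beta>, j), to_nat (\<beta>, Suc j)}. ?c k)"
  proof (rule sums_finite)
    fix k assume k: "k \<notin> {to_nat (\<beta>, j), to_nat (\<beta>, Suc j)}"
    show "?c k = 0"
    proof (cases "is_code k")
      case True
      then obtain \<beta>' j' where \<beta>': "\<beta>' \<in> branch_roots n" "k = to_nat (\<beta>', j' :: nat)" by (rule is_codeE)
      then show ?thesis using k coeff[OF \<beta>'(1), of j'] by (auto simp: code_op_to_nat)
    qed (simp add: code_op_not_code)
  qed simp
  moreover have "(\<Sum>k\<in>{to_nat (\<beta>, j), to_nat (\<beta>, Suc j)}. ?c k) =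
      jt_coeff x (zero_ext \<beta> i) - (if i = last_pos \<beta> j then tau \<beta> j x + rho \<beta> (Suc j) x else 0)"
    using coeff[OF \<beta>, of j] coeff[OF \<beta>, of "Suc j"] by (simp add: code_op_to_nat[OF \<beta>])
  ultimately show ?thesis by (simp only: tau_rho)
qed

lemma code_op_coeff_outside:
  assumes "\<gamma> \<notin> nodes_few_ones n"
  shows "jt_coeff (code_op k x) \<gamma> = 0"
proof (cases "is_code k")
  case True
  then obtain \<beta> j where \<beta>: "\<beta> \<in> branch_roots n" "k = to_nat (\<beta>, j :: nat)" by (rule is_codeE)
  then have "\<gamma> \<noteq> zero_ext \<beta> i" for i using assms zero_ext_in_nodes_few_ones by blast
  then show ?thesis using \<beta> by (auto simp: code_op_to_nat jt_coeff_block_op block_def mark_def)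
qed (simp add: code_op_not_code)

lemma sum_dyadic_codes_le:
  assumes "finite (P :: (node \<times> nat) set)"
  shows "(\<Sum>p\<in>P. (1 / 2) ^ Suc (to_nat p)) \<le> (1 :: real)"
proof -
  have inj: "inj_on to_nat P" by (rule inj_on_subset[OF inj_to_nat]) simp
  have "(\<Sum>p\<in>P. (1 / 2) ^ Suc (to_nat p)) = (\<Sum>k\<in>to_nat ` P. (1 / 2 :: real) ^ Suc k)"
    by (simp add: sum.reindex[OF inj])
  also have "\<dots> \<le> (\<Sum>k. (1 / 2) ^ Suc k)"
    using assms power_half_series by (intro sum_le_suminf) (auto simp: sums_iff)
  also have "\<dots> = 1" using power_half_series by (simp add: sums_iff)
  finally show ?thesis .
qed

text \<open>The difference lives on the marks, where it is a difference of two consecutive averages.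
  A mark determines its code, so each of the two averages gives a dyadic sum of at most
  \<open>e\<close>, and the sum of absolute coefficients bounds the norm.\<close>

lemma norm_diff_code_sum_le:
  assumes W: "\<And>x. (\<lambda>k. code_op k x) sums W x"
    and supp: "\<And>\<gamma>. \<gamma> \<notin> nodes_few_ones n \<Longrightarrow> jt_coeff x \<gamma> = 0"
    and small: "\<And>\<beta> j. \<beta> \<in> branch_roots n \<Longrightarrow> \<bar>average \<beta> j x\<bar> \<le> e * (1 / 2) ^ Suc (to_nat (\<beta>, j))"
    and "e > 0"
  shows "norm (x - W x) \<le> 2 * e"
proof (rule norm_jt_le_sum_abs)
  fix \<Gamma> :: "node set" assume fin: "finite \<Gamma>"
  let ?d = "\<lambda>p :: node \<times> nat. e * (1 / 2) ^ Suc (to_nat p)"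
  have coeff_W: "(\<lambda>k. jt_coeff (code_op k x) \<gamma>) sums jt_coeff (W x) \<gamma>" for \<gamma>
    by (rule bounded_linear.sums[OF bounded_linear_coeff W])
  have ex: "\<exists>p. \<gamma> = mark (fst p) (snd p) \<and> \<bar>jt_coeff (x - W x) \<gamma>\<bar> \<le> ?d p + ?d (fst p, Suc (snd p))"
    if nz: "jt_coeff (x - W x) \<gamma> \<noteq> 0" for \<gamma>
  proof -
    have "\<gamma> \<in> nodes_few_ones n"
    proof (rule ccontr)
      assume out: "\<gamma> \<notin> nodes_few_ones n"
      then have "jt_coeff (W x) \<gamma> = 0"
        using coeff_W[of \<gamma>] sums_unique2[OF _ sums_zero] by (simp add: code_op_coeff_outside)
      with out supp nz show False by simp
    qed
    then obtain \<beta> i where \<beta>: "\<beta> \<in> branch_roots n" "\<gamma> = zero_ext \<beta> i" by (rule branch_root_exists)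
    obtain j where j: "M \<beta> j \<le> i" "i < M \<beta> (Suc j)" using block_index_exists by blast
    have eq: "jt_coeff (x - W x) \<gamma> = (if i = last_pos \<beta> j then average \<beta> j x - average \<beta> (Suc j) x else 0)"
      using sums_unique2[OF coeff_W[of \<gamma>]] code_op_coeff_zero_ext[OF \<beta>(1) j, of x] \<beta>(2) by simp
    then have "i = last_pos \<beta> j" using nz by (auto split: if_splits)
    moreover have "\<bar>average \<beta> j x - average \<beta> (Suc j) x\<bar> \<le> ?d (\<beta>, j) + ?d (\<beta>, Suc j)"
      using small[OF \<beta>(1), of j] small[OF \<beta>(1), of "Suc j"] by linarith
    ultimately show ?thesis using \<beta> eq by (intro exI[of _ "(\<beta>, j)"]) (simp add: mark_def)
  qed
  define \<Gamma>' where "\<Gamma>' = {\<gamma> \<in> \<Gamma>. jt_coeff (x - W x) \<gamma> \<noteq> 0}"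
  have fin': "finite \<Gamma>'" using fin by (simp add: \<Gamma>'_def)
  have "\<forall>\<gamma>\<in>\<Gamma>'. \<exists>p. \<gamma> = mark (fst p) (snd p) \<and>
      \<bar>jt_coeff (x - W x) \<gamma>\<bar> \<le> ?d p + ?d (fst p, Suc (snd p))"
    using ex by (simp add: \<Gamma>'_def)
  from bchoice[OF this] obtain q where q: "\<forall>\<gamma>\<in>\<Gamma>'. \<gamma> = mark (fst (q \<gamma>)) (snd (q \<gamma>)) \<and>
      \<bar>jt_coeff (x - W x) \<gamma>\<bar> \<le> ?d (q \<gamma>) + ?d (fst (q \<gamma>), Suc (snd (q \<gamma>)))"
    by (elim exE)
  have inj: "inj_on q \<Gamma>'"
  proof (rule inj_onI)
    fix \<gamma> \<delta> assume "\<gamma> \<in> \<Gamma>'" "\<delta> \<in> \<Gamma>'" "q \<gamma> = q \<delta>"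
    then show "\<gamma> = \<delta>" using q by metis
  qed
  then have inj': "inj_on (\<lambda>\<gamma>. (fst (q \<gamma>), Suc (snd (q \<gamma>)))) \<Gamma>'"
    by (auto simp: inj_on_def prod_eq_iff)
  have bound: "(\<Sum>\<gamma>\<in>\<Gamma>'. ?d (h \<gamma>)) \<le> e" if "inj_on h \<Gamma>'" for h :: "node \<Rightarrow> node \<times> nat"
  proof -
    have "(\<Sum>\<gamma>\<in>\<Gamma>'. ?d (h \<gamma>)) = e * (\<Sum>p\<in>h ` \<Gamma>'. (1 / 2) ^ Suc (to_nat p))"
      by (simp add: sum.reindex[OF that] sum_distrib_left)
    also have "\<dots> \<le> e * 1" using fin' \<open>e > 0\<close> by (intro mult_left_mono sum_dyadic_codes_le) auto
    finally show ?thesis by simp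
  qed
  have "(\<Sum>\<gamma>\<in>\<Gamma>. \<bar>jt_coeff (x - W x) \<gamma>\<bar>) = (\<Sum>\<gamma>\<in>\<Gamma>'. \<bar>jt_coeff (x - W x) \<gamma>\<bar>)"
    using fin by (intro sum.mono_neutral_right) (auto simp: \<Gamma>'_def)
  also have "\<dots> \<le> (\<Sum>\<gamma>\<in>\<Gamma>'. ?d (q \<gamma>) + ?d (fst (q \<gamma>), Suc (snd (q \<gamma>))))"
    using q by (intro sum_mono) blast
  also have "\<dots> \<le> 2 * e"
    using bound[OF inj] bound[OF inj'] by (simp only: sum.distrib)
  finally show "(\<Sum>\<gamma>\<in>\<Gamma>. \<bar>jt_coeff (x - W x) \<gamma>\<bar>) \<le> 2 * e" .
qed

end

lemma weakly_compact_approximation_X_sub: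
  fixes D :: "jt set" and \<epsilon> :: real
  assumes D: "weakly_compact D" and supp: "\<And>x. x \<in> D \<Longrightarrow> x \<in> X_sub n" and "\<epsilon> > 0"
  obtains W :: "jt \<Rightarrow>\<^sub>L jt" where "weakly_compact (W ` cball 0 1)"
    "\<And>x. x \<in> D \<Longrightarrow> norm (x - W x) \<le> \<epsilon>"
proof -
  \<comment> \<open>Summable over all pairs of a root and a block number; the factor 1/2 compensates
    for the two averages at each mark.\<close>
  define d where "d \<beta> j = \<epsilon> / 2 * (1 / 2) ^ Suc (to_nat (\<beta> :: node, j :: nat))" for \<beta> j
  have d: "d \<beta> j > 0" for \<beta> j using \<open>\<epsilon> > 0\<close> by (simp add: d_def)
  \<comment> \<open>The state at \<open>Suc j\<close> holds the end of block \<open>j\<close>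
    together with the averaging set inside that block, hence the shift of index below. The second
    entry at 0 is a placeholder.\<close>
  have "\<exists>s :: nat \<Rightarrow> nat \<times> nat set. \<forall>j. (j = 0 \<longrightarrow> fst (s j) = 0) \<and>
      snd (s (Suc j)) \<noteq> {} \<and> snd (s (Suc j)) \<subseteq> {fst (s j)..<fst (s (Suc j))} \<and>
      (\<forall>x\<in>D. \<bar>\<Sum>a\<in>snd (s (Suc j)). branch_sum \<beta> a x\<bar> \<le> d \<beta> j * real (card (snd (s (Suc j)))))" for \<beta>
  proof -
    have "\<exists>s :: nat \<Rightarrow> nat \<times> nat set. \<forall>j. (j = 0 \<longrightarrow> fst (s j) = 0) \<and>
      (snd (s (Suc j)) \<noteq> {} \<and> snd (s (Suc j)) \<subseteq> {fst (s j)..<fst (s (Suc j))} \<and>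
      (\<forall>x\<in>D. \<bar>\<Sum>a\<in>snd (s (Suc j)). branch_sum \<beta> a x\<bar> \<le> d \<beta> j * real (card (snd (s (Suc j))))))"
    proof (rule dependent_nat_choice)
      show "\<exists>t :: nat \<times> nat set. 0 = (0 :: nat) \<longrightarrow> fst t = 0" by (intro exI[of _ "(0, {})"]) simp
      fix t :: "nat \<times> nat set" and j :: nat
      obtain A k where "finite A" "A \<noteq> {}" "A \<subseteq> {fst t..<k}"
        "\<forall>x\<in>D. \<bar>\<Sum>a\<in>A. branch_sum \<beta> a x\<bar> \<le> d \<beta> j * real (card A)"
        by (rule small_averages[OF D d])
      then show "\<exists>u :: nat \<times> nat set. (Suc j = 0 \<longrightarrow> fst u = 0) \<and>
          snd u \<noteq> {} \<and> snd u \<subseteq> {fst t..<fst u} \<and>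
          (\<forall>x\<in>D. \<bar>\<Sum>a\<in>snd u. branch_sum \<beta> a x\<bar> \<le> d \<beta> j * real (card (snd u)))"
        by (intro exI[of _ "(k, A)"]) simp
    qed
    then show ?thesis by simp
  qed
  then obtain s :: "node \<Rightarrow> nat \<Rightarrow> nat \<times> nat set" where s: "\<And>\<beta> j. (j = 0 \<longrightarrow> fst (s \<beta> j) = 0) \<and>
      snd (s \<beta> (Suc j)) \<noteq> {} \<and> snd (s \<beta> (Suc j)) \<subseteq> {fst (s \<beta> j)..<fst (s \<beta> (Suc j))} \<and>
      (\<forall>x\<in>D. \<bar>\<Sum>a\<in>snd (s \<beta> (Suc j)). branch_sum \<beta> a x\<bar> \<le> d \<beta> j * real (card (snd (s \<beta> (Suc j)))))"
    by metis
  interpret averaging_scheme n "\<lambda>\<beta> j. fst (s \<beta> j)" "\<lambda>\<beta> j. snd (s \<beta> (Suc j))"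
    by unfold_locales (use s in auto)
  obtain W :: "jt \<Rightarrow>\<^sub>L jt" where W: "\<And>x. (\<lambda>k. code_op k x) sums W x" "weakly_compact (W ` cball 0 1)"
    using l2_block_operator[of code_block code_vec "real (3 * (n + 1))" 16]
      code_op_upper code_op_lower unfolding code_op_def by auto
  have "norm (x - W x) \<le> \<epsilon>" if x: "x \<in> D" for x
  proof -
    have "norm (x - W x) \<le> 2 * (\<epsilon> / 2)"
    proof (rule norm_diff_code_sum_le[OF W(1)])
      show "jt_coeff x \<gamma> = 0" if "\<gamma> \<notin> nodes_few_ones n" for \<gamma>
        using X_sub_coeff_eq_0[OF supp[OF x] that] .
      show "\<bar>average \<beta> j x\<bar> \<le> \<epsilon> / 2 * (1 / 2) ^ Suc (to_nat (\<beta>, j))" for \<beta> j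
      proof -
        have "\<bar>\<Sum>a\<in>snd (s \<beta> (Suc j)). branch_sum \<beta> a x\<bar> \<le> d \<beta> j * real (card (snd (s \<beta> (Suc j))))"
          using s x by blast
        then show ?thesis
          using card_A_pos[of \<beta> j] unfolding average_def d_def[symmetric] by (simp add: pos_divide_le_eq abs_divide)
      qed
    qed (use \<open>\<epsilon> > 0\<close> in simp)
    then show ?thesis by simp
  qed
  then show thesis using that[of W] W(2) by blast
qed


section \<open>The unbounded approximation property\<close>

lemma unbounded_WAP_Z: "unbounded_WAP TYPE(Z)"
  unfolding unbounded_WAP_def
proof (intro allI impI)
  fix D :: "Z set" and \<epsilon> :: real
  assume D: "weakly_compact D" and "\<epsilon> > 0"
  have "\<epsilon> / 4 > 0" using \<open>\<epsilon> > 0\<close> by simp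
  then obtain N where N: "\<And>x. x \<in> D \<Longrightarrow> Z_tail N x \<le> \<epsilon> / 4"
    using weakly_compact_Z_tails[OF D] by blast
  \<comment> \<open>The first \<open>N\<close> coordinates together cost at most
    \<open>\<epsilon> / 4\<close>, as does the tail; the total \<open>\<epsilon> / 2\<close> makes
    the supremum strictly smaller than \<open>\<epsilon>\<close>.\<close>
  define \<eta> where "\<eta> = \<epsilon> / 4 / (N + 1)"
  have "\<eta> > 0" using \<open>\<epsilon> > 0\<close> by (simp add: \<eta>_def)
  have "\<exists>W :: jt \<Rightarrow>\<^sub>L jt. weakly_compact (blinfun_apply W ` cball 0 1) \<and>
      (\<forall>x\<in>D. norm (Z_coord x k - blinfun_apply W (Z_coord x k)) \<le> \<eta>)" for k
  proof -
    have "weakly_compact (Z_proj k ` D)" by (rule weakly_compact_blinfun_image[OF D])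
    moreover have "x \<in> X_sub k" if "x \<in> Z_proj k ` D" for x using that by auto
    ultimately obtain W :: "jt \<Rightarrow>\<^sub>L jt" where W: "weakly_compact (W ` cball 0 1)"
        "\<And>x. x \<in> Z_proj k ` D \<Longrightarrow> norm (x - W x) \<le> \<eta>"
      using weakly_compact_approximation_X_sub[of "Z_proj k ` D" k \<eta>] \<open>\<eta> > 0\<close> by metis
    then show ?thesis by (intro exI[of _ W]) auto
  qed
  then obtain W :: "nat \<Rightarrow> jt \<Rightarrow>\<^sub>L jt" where W: "\<And>k. weakly_compact (W k ` cball 0 1)"
      "\<And>k x. x \<in> D \<Longrightarrow> norm (Z_coord x k - W k (Z_coord x k)) \<le> \<eta>"
    by metis
  define V where "V m = (\<Sum>k<m. Z_inj k o\<^sub>L W k o\<^sub>L Z_proj k)" for m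
  have V_apply: "V m x = (\<Sum>k<m. Z_inj k (W k (Z_coord x k)))" for m x
    by (simp add: V_def blinfun.sum_left)
  have "\<exists>K. weakly_compact K \<and> V m ` cball 0 1 \<subseteq> K" for m
  proof (induction m)
    case 0
    have "weakly_compact {0 :: Z}" by (simp add: weakly_compact_def)
    then show ?case by (intro exI[of _ "{0}"]) (auto simp: V_apply)
  next
    case (Suc m)
    then obtain K where K: "weakly_compact K" "V m ` cball 0 1 \<subseteq> K" by blast
    let ?L = "Z_inj m ` W m ` cball 0 1"
    have "V (Suc m) x \<in> (\<lambda>(a, b). a + b) ` (K \<times> ?L)" if "x \<in> cball 0 1" for x
    proof (rule image_eqI)
      show "V (Suc m) x = (\<lambda>(a, b). a + b) (V m x, Z_inj m (W m (Z_coord x m)))"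
        by (simp add: V_apply)
      have "Z_coord x m \<in> cball 0 1" using that norm_Z_coord_le[of x m] by simp
      then show "(V m x, Z_inj m (W m (Z_coord x m))) \<in> K \<times> ?L" using K(2) that by blast
    qed
    then show ?case
      using weakly_compact_plus[OF K(1) weakly_compact_blinfun_image[OF W(1)[of m], of "Z_inj m"]] by blast
  qed
  then obtain K where K: "weakly_compact K" "V N ` cball 0 1 \<subseteq> K" by blast
  have wc: "weakly_compact_operator (V N)"
    by (rule weakly_compact_operatorI[OF _ K]) (rule separating_functional_Z)
  have "norm (x - V N x) \<le> \<epsilon> / 2" if x: "x \<in> D" for x
  proof -
    \<comment> \<open>\<open>W k\<close> may leave \<open>X_sub k\<close>, but
      \<open>Z_inj k\<close> cuts its values back. The cut fixes the coordinate of \<open>x\<close>,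
      so it acts on the error alone and cannot enlarge it.\<close>
    have coord: "Z_coord (x - V N x) k =
        (if k < N then restrict_jt (nodes_few_ones k) (Z_coord x k - W k (Z_coord x k)) else Z_coord x k)" for k
    proof -
      have "restrict_jt (nodes_few_ones k) (Z_coord x k) = Z_coord x k"
        by (rule jt_eqI) (auto simp: jt_coeff_restrict tree_convex_nodes_few_ones
            X_sub_coeff_eq_0[OF Z_coord_in])
      then have "Z_coord x k - restrict_jt (nodes_few_ones k) (W k (Z_coord x k)) =
          restrict_jt (nodes_few_ones k) (Z_coord x k - W k (Z_coord x k))"
        using linear_diff[OF bounded_linear.linear[OF bounded_linear_restrict[OF tree_convex_nodes_few_ones]]]
        by metis
      then show ?thesis
        by (simp add: minus_Z.rep_eq V_apply Z_coord_sum Z_coord_inj)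
    qed
    have "Z_tail N (x - V N x) = Z_tail N x" by (simp add: Z_tail_def coord)
    then have "norm (x - V N x) = (\<Sum>k\<in>{0..<N}. norm (Z_coord (x - V N x) k)) + Z_tail N x"
      using Z_tail_split[of 0 N "x - V N x"] by (simp add: Z_tail_0)
    also have "\<dots> \<le> (\<Sum>k\<in>{0..<N}. \<eta>) + \<epsilon> / 4"
    proof (intro add_mono sum_mono N x)
      fix k assume "k \<in> {0..<N}"
      then show "norm (Z_coord (x - V N x) k) \<le> \<eta>"
        using norm_restrict_le[OF tree_convex_nodes_few_ones, of k "Z_coord x k - W k (Z_coord x k)"] W(2)[OF x, of k]
        by (simp add: coord)
    qed
    also have "(\<Sum>k\<in>{0..<N}. \<eta>) \<le> \<epsilon> / 4"
      using \<open>\<epsilon> > 0\<close> by (simp add: \<eta>_def field_simps)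
    finally show ?thesis by simp
  qed
  then have "(SUP x\<in>D. ennreal (norm (x - V N x))) \<le> ennreal (\<epsilon> / 2)"
    by (intro SUP_least ennreal_leI)
  also have "\<dots> < ennreal \<epsilon>" using \<open>\<epsilon> > 0\<close> by (simp add: ennreal_less_iff)
  finally show "\<exists>V :: Z \<Rightarrow>\<^sub>L Z. weakly_compact_operator V \<and>
      (SUP x\<in>D. ennreal (norm (x - blinfun_apply V x))) < ennreal \<epsilon>"
    using wc by blast
qed

theorem mainTheorem7:
  shows "unbounded_WAP TYPE(Z) \<and> \<not> WAP TYPE(Z)"
  using unbounded_WAP_Z not_WAP_Z by simp

end
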